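(* Let $A$ be a finite set with $|A|\ge2$, let $G$ be a finite $A$-generated group and let $(p_n)_{n\ge1}$ be a sequence of primes. Set $G_0:=G$ and $G_n:=G_{n-1}^{\widetilde{\mathbb{Z}/p_n}}$ for $n\ge1$. Then the Cayley graph (with respect to $A$) of the profinite group $\mathcal{G}:=\varprojlim G_n$ is tree-like.
   Context: Let $F$ be the free group on $A$, $\widetilde A=A\cup A^{-1}$. An $A$-generated group is a pair $(G,\varphi)$ with $\varphi:A\to G$ a (not necessarily injective) map such that $\varphi(A)$ generates $G$; one writes $a$ for the image of $a\in \widetilde A$. For a finite $A$-generated group $G$ with $R=\ker(F\twoheadrightarrow G)$ and a prime $p$ let $G^{\mathbb{Z}/p}:=F/R^p[R,R]$ and $G^{\widetilde{\mathbb{Z}/p}}:=G^{\mathbb{Z}/p}/Z(G^{\mathbb{Z}/p})$, where $Z(\cdot)$ denotes the center. It is again a finite $A$-generated group, with a canonical ($A$-preserving) morphism $G^{\widetilde{\mathbb{Z}/p}}\twoheadrightarrow G$ (if $G$ is non-trivial, the center of $G^{\mathbb{Z}/p}$ lies in $\ker(G^{\mathbb{Z}/p}\twoheadrightarrow G)$; the case of trivial $G$ is obvious). The inverse limit is taken along these canonical morphisms. A graph (in the sense of Serre) has a vertex set and an edge set with initial/terminal vertex maps and an edge inversion $e\mapsto e^{-1}$ exchanging positive and negative edges; subgraphs are closed under endpoints and inversion. A profinite graph is a projective limit of finite discrete graphs; a subgraph of a profinite graph is required to be topologically closed. A profinite graph is connected if all its finite continuous quotient graphs are connected as abstract graphs.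 A connected profinite graph $\Gamma$ is tree-like if for every pair $\{u,v\}$ of vertices the intersection of all connected subgraphs of $\Gamma$ containing $\{u,v\}$ is connected. The Cayley graph of $\mathcal G$ is the profinite graph with vertex set $\mathcal G$ and edge set $\mathcal G\times\widetilde A$; the edge $(g,a)$ goes from $g$ to $ga$ and has inverse $(ga,a^{-1})$. *)

theory Defs
  imports
    "HOL-Algebra.Product_Groups"
    "HOL-Algebra.Generated_Groups"
    "HOL-Computational_Algebra.Primes"
    "HOL-Analysis.Function_Topology"
    "HOL-Analysis.Product_Topology"
begin

section \<open>The free group on a set\<close>

text \<open>
  The letter \<open>(a, True)\<close> is \<open>a\<close> and \<open>(a, False)\<close> is its formal inverse.
  Elements of the free group are the freely reduced words.
\<close>

type_synonym 'a letter = "'a \<times> bool"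
type_synonym 'a word = "'a letter list"

definition letters :: "'a set \<Rightarrow> 'a letter set" where
  "letters A = A \<times> UNIV"

definition linv :: "'a letter \<Rightarrow> 'a letter" where
  "linv l = (fst l, \<not> snd l)"

definition reduced :: "'a word \<Rightarrow> bool" where
  "reduced w \<longleftrightarrow> successively (\<lambda>x y. y \<noteq> linv x) w"

fun cons_red :: "'a letter \<Rightarrow> 'a word \<Rightarrow> 'a word" where
  "cons_red l [] = [l]"
| "cons_red l (m # w) = (if m = linv l then w else l # m # w)"

definition freduce :: "'a word \<Rightarrow> 'a word" where
  "freduce w = foldr cons_red w []"

definition free_group :: "'a set \<Rightarrow> 'a word monoid" where
  "free_group A =
    \<lparr>carrier = {w. set w \<subseteq> letters A \<and> reduced w},
     monoid.mult = (\<lambda>u v. freduce (u @ v)),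
     one = []\<rparr>"


section \<open>Marked groups\<close>

type_synonym ('a, 'g) marked = "'g monoid \<times> ('a \<Rightarrow> 'g)"

definition generated_group :: "'a set \<Rightarrow> ('a, 'g) marked \<Rightarrow> bool" where
  "generated_group A = (\<lambda>(G, \<phi>).
    group G \<and> \<phi> \<in> A \<rightarrow> carrier G \<and> generate G (\<phi> ` A) = carrier G)"

definition letter_val :: "('a, 'g) marked \<Rightarrow> 'a letter \<Rightarrow> 'g" where
  "letter_val = (\<lambda>(G, \<phi>) (a, b). if b then \<phi> a else inv\<^bsub>G\<^esub> (\<phi> a))"

text \<open>\<open>word_val M\<close> is the canonical epimorphism from the free group.\<close>

definition word_val :: "('a, 'g) marked \<Rightarrow> 'a word \<Rightarrow> 'g" where
  "word_val M w = foldr (\<lambda>l x. letter_val M l \<otimes>\<^bsub>fst M\<^esub> x) w \<one>\<^bsub>fst M\<^esub>"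

definition relators :: "'a set \<Rightarrow> ('a, 'g) marked \<Rightarrow> 'a word set" where
  "relators A M = kernel (free_group A) (fst M) (word_val M)"

definition quotient_marked :: "'a set \<Rightarrow> 'a word set \<Rightarrow> ('a, 'a word set) marked" where
  "quotient_marked A N =
    (free_group A Mod N, \<lambda>a. N #>\<^bsub>free_group A\<^esub> [(a, True)])"

text \<open>
  The canonical copy of \<open>G\<close> as a quotient of the free group. It is isomorphic to \<open>G\<close>
  by a generator-preserving isomorphism (lemma \<open>canonical_copy_iso\<close> below) and serves to
  make the iteration \<open>tilde_seq\<close> well-typed.
\<close>

definition canonical_copy :: "'a set \<Rightarrow> ('a, 'g) marked \<Rightarrow> ('a, 'a word set) marked" where
  "canonical_copy A M = quotient_marked A (relators A M)"

definition canonical_morphism ::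
    "'a set \<Rightarrow> ('a, 'g) marked \<Rightarrow> ('a, 'h) marked \<Rightarrow> 'g \<Rightarrow> 'h" where
  "canonical_morphism A = (\<lambda>(G, \<phi>) (H, \<psi>).
    THE f. f \<in> hom G H \<and> f \<in> extensional (carrier G) \<and> (\<forall>a\<in>A. f (\<phi> a) = \<psi> a))"


section \<open>The expansions of a marked group by a prime\<close>

definition power_subgroup :: "('g, 'm) monoid_scheme \<Rightarrow> nat \<Rightarrow> 'g set \<Rightarrow> 'g set" where
  "power_subgroup G p R = generate G ((\<lambda>x. x [^]\<^bsub>G\<^esub> p) ` R)"

definition group_center :: "('g, 'm) monoid_scheme \<Rightarrow> 'g set" where
  "group_center G = {z \<in> carrier G. \<forall>x\<in>carrier G. z \<otimes>\<^bsub>G\<^esub> x = x \<otimes>\<^bsub>G\<^esub> z}"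

definition Zp_expansion :: "'a set \<Rightarrow> nat \<Rightarrow> ('a, 'g) marked \<Rightarrow> ('a, 'a word set) marked" where
  "Zp_expansion A p M =
    (let F = free_group A; R = relators A M
     in quotient_marked A (power_subgroup F p R <#>\<^bsub>F\<^esub> derived F R))"

definition Zp_tilde_expansion ::
    "'a set \<Rightarrow> nat \<Rightarrow> ('a, 'g) marked \<Rightarrow> ('a, 'a word set set) marked" where
  "Zp_tilde_expansion A p M =
    (let (E, \<phi>) = Zp_expansion A p M
     in (E Mod group_center E, \<lambda>a. group_center E #>\<^bsub>E\<^esub> \<phi> a))"

text \<open>\<open>tilde_seq A p M n\<close> is \<open>G\<^sub>n\<close>; the value \<open>p 0\<close> is never used.\<close>

primrec tilde_seq ::
    "'a set \<Rightarrow> (nat \<Rightarrow> nat) \<Rightarrow> ('a, 'g) marked \<Rightarrow> nat \<Rightarrow> ('a, 'a word set) marked" where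
  "tilde_seq A p M 0 = canonical_copy A M"
| "tilde_seq A p M (Suc n) =
    canonical_copy A (Zp_tilde_expansion A (p (Suc n)) (tilde_seq A p M n))"


section \<open>Inverse limits of sequences of marked groups\<close>

definition threads :: "'a set \<Rightarrow> (nat \<Rightarrow> ('a, 'g) marked) \<Rightarrow> (nat \<Rightarrow> 'g) set" where
  "threads A M = {x \<in> \<Pi>\<^sub>E n\<in>UNIV. carrier (fst (M n)).
    \<forall>n. canonical_morphism A (M (Suc n)) (M n) (x (Suc n)) = x n}"

definition limit_marked ::
    "'a set \<Rightarrow> (nat \<Rightarrow> ('a, 'g) marked) \<Rightarrow> ('a, nat \<Rightarrow> 'g) marked" where
  "limit_marked A M =
    ((product_group UNIV (\<lambda>n. fst (M n))) \<lparr>carrier := threads A M\<rparr>,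
     \<lambda>a n. snd (M n) a)"

definition limit_topology :: "'a set \<Rightarrow> (nat \<Rightarrow> ('a, 'g) marked) \<Rightarrow> (nat \<Rightarrow> 'g) topology" where
  "limit_topology A M =
    subtopology (product_topology (\<lambda>n. discrete_topology (carrier (fst (M n)))) UNIV)
      (threads A M)"


section \<open>Serre graphs and profinite graphs\<close>

record ('v, 'e) serre_graph =
  verts :: "'v set"
  edges :: "'e set"
  pos_edges :: "'e set"
  src :: "'e \<Rightarrow> 'v"
  tgt :: "'e \<Rightarrow> 'v"
  einv :: "'e \<Rightarrow> 'e"

definition is_serre_graph :: "('v, 'e, 'z) serre_graph_scheme \<Rightarrow> bool" where
  "is_serre_graph \<Gamma> \<longleftrightarrow>
    src \<Gamma> \<in> edges \<Gamma> \<rightarrow> verts \<Gamma> \<and> tgt \<Gamma> \<in> edges \<Gamma> \<rightarrow> verts \<Gamma> \<and>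
    einv \<Gamma> \<in> edges \<Gamma> \<rightarrow> edges \<Gamma> \<and>
    (\<forall>e\<in>edges \<Gamma>. einv \<Gamma> (einv \<Gamma> e) = e \<and>
       src \<Gamma> (einv \<Gamma> e) = tgt \<Gamma> e \<and> tgt \<Gamma> (einv \<Gamma> e) = src \<Gamma> e) \<and>
    pos_edges \<Gamma> \<subseteq> edges \<Gamma> \<and>
    einv \<Gamma> ` pos_edges \<Gamma> = edges \<Gamma> - pos_edges \<Gamma>"

definition connected_graph :: "('v, 'e, 'z) serre_graph_scheme \<Rightarrow> bool" where
  "connected_graph \<Gamma> \<longleftrightarrow>
    (\<forall>u\<in>verts \<Gamma>. \<forall>v\<in>verts \<Gamma>. (u, v) \<in> {(src \<Gamma> e, tgt \<Gamma> e) | e. e \<in> edges \<Gamma>}\<^sup>*)"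

record ('v, 'e) top_graph = "('v, 'e) serre_graph" +
  vtop :: "'v topology"
  etop :: "'e topology"

text \<open>
  Finite continuous quotient graphs of \<open>\<Gamma>\<close> are given by pairs of equivalence relations, one on
  the vertices and one on the edges, with finitely many classes, all of them open, which are
  compatible with the graph structure. As graph morphisms send edges to edges and preserve
  the orientation, positive edges are never identified with negative ones.
\<close>

type_synonym ('v, 'e) graph_cong = "('v \<times> 'v) set \<times> ('e \<times> 'e) set"

definition graph_congruence ::
    "('v, 'e, 'z) serre_graph_scheme \<Rightarrow> ('v, 'e) graph_cong \<Rightarrow> bool" where
  "graph_congruence \<Gamma> = (\<lambda>(\<theta>, \<eta>).
    equiv (verts \<Gamma>) \<theta> \<and> equiv (edges \<Gamma>) \<eta> \<and>
    (\<forall>(e, f)\<in>\<eta>. (src \<Gamma> e, src \<Gamma> f) \<in> \<theta> \<and> (tgt \<Gamma> e, tgt \<Gamma> f) \<in> \<theta> \<and>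
       (einv \<Gamma> e, einv \<Gamma> f) \<in> \<eta> \<and> (e \<in> pos_edges \<Gamma> \<longleftrightarrow> f \<in> pos_edges \<Gamma>)))"

definition finite_continuous_congruence ::
    "('v, 'e, 'z) top_graph_scheme \<Rightarrow> ('v, 'e) graph_cong \<Rightarrow> bool" where
  "finite_continuous_congruence \<Gamma> = (\<lambda>(\<theta>, \<eta>).
    graph_congruence \<Gamma> (\<theta>, \<eta>) \<and>
    finite (verts \<Gamma> // \<theta>) \<and> (\<forall>C \<in> verts \<Gamma> // \<theta>. openin (vtop \<Gamma>) C) \<and>
    finite (edges \<Gamma> // \<eta>) \<and> (\<forall>C \<in> edges \<Gamma> // \<eta>. openin (etop \<Gamma>) C))"

definition quotient_graph ::
    "('v, 'e, 'z) serre_graph_scheme \<Rightarrow> ('v, 'e) graph_cong \<Rightarrow> ('v set, 'e set) serre_graph" where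
  "quotient_graph \<Gamma> = (\<lambda>(\<theta>, \<eta>).
    \<lparr>verts = verts \<Gamma> // \<theta>,
     edges = edges \<Gamma> // \<eta>,
     pos_edges = pos_edges \<Gamma> // \<eta>,
     src = (\<lambda>C. \<theta> `` (src \<Gamma> ` C)),
     tgt = (\<lambda>C. \<theta> `` (tgt \<Gamma> ` C)),
     einv = (\<lambda>C. \<eta> `` (einv \<Gamma> ` C))\<rparr>)"

text \<open>
  The space of the projective limit of the discrete quotient sets of \<open>X\<close> by the equivalence
  relations \<open>r i\<close> (\<open>i \<in> I\<close>). When \<open>r j\<close> refines \<open>r i\<close>, the bonding map sends a class of
  \<open>r j\<close> to the class of \<open>r i\<close> that includes it.
\<close>

definition quotient_limit ::
    "'i set \<Rightarrow> ('i \<Rightarrow> 'i \<Rightarrow> bool) \<Rightarrow> 'x set \<Rightarrow> ('i \<Rightarrow> ('x \<times> 'x) set) \<Rightarrow> ('i \<Rightarrow> 'x set) topology"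
  where
  "quotient_limit I finer X r =
    subtopology (product_topology (\<lambda>i. discrete_topology (X // r i)) I)
      {c. \<forall>i\<in>I. \<forall>j\<in>I. finer j i \<longrightarrow> c j \<subseteq> c i}"

definition finer_cong :: "('v, 'e) graph_cong \<Rightarrow> ('v, 'e) graph_cong \<Rightarrow> bool" where
  "finer_cong j i \<longleftrightarrow> fst j \<subseteq> fst i \<and> snd j \<subseteq> snd i"

text \<open>
  A projective limit of finite discrete graphs may be presented by its own quotients (the images
  of the projections to the given finite graphs), so that the index set can be taken to be a
  directed set of finite continuous congruences.
\<close>

definition profinite_graph :: "('v, 'e, 'z) top_graph_scheme \<Rightarrow> bool" where
  "profinite_graph \<Gamma> \<longleftrightarrow>
    is_serre_graph \<Gamma> \<and> topspace (vtop \<Gamma>) = verts \<Gamma> \<and> topspace (etop \<Gamma>) = edges \<Gamma> \<and>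
    (\<exists>I. I \<noteq> {} \<and> (\<forall>i\<in>I. finite_continuous_congruence \<Gamma> i) \<and>
      (\<forall>i\<in>I. \<forall>j\<in>I. \<exists>k\<in>I. finer_cong k i \<and> finer_cong k j) \<and>
      homeomorphic_map (vtop \<Gamma>) (quotient_limit I finer_cong (verts \<Gamma>) fst)
        (\<lambda>v. \<lambda>i\<in>I. fst i `` {v}) \<and>
      homeomorphic_map (etop \<Gamma>) (quotient_limit I finer_cong (edges \<Gamma>) snd)
        (\<lambda>e. \<lambda>i\<in>I. snd i `` {e}))"

definition connected_profinite :: "('v, 'e, 'z) top_graph_scheme \<Rightarrow> bool" where
  "connected_profinite \<Gamma> \<longleftrightarrow>
    (\<forall>c. finite_continuous_congruence \<Gamma> c \<longrightarrow> connected_graph (quotient_graph \<Gamma> c))"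

definition closed_subgraph ::
    "('v, 'e, 'z) top_graph_scheme \<Rightarrow> 'v set \<Rightarrow> 'e set \<Rightarrow> bool" where
  "closed_subgraph \<Gamma> V E \<longleftrightarrow>
    closedin (vtop \<Gamma>) V \<and> closedin (etop \<Gamma>) E \<and>
    V \<subseteq> verts \<Gamma> \<and> E \<subseteq> edges \<Gamma> \<and>
    (\<forall>e\<in>E. src \<Gamma> e \<in> V \<and> tgt \<Gamma> e \<in> V \<and> einv \<Gamma> e \<in> E)"

definition restrict_graph ::
    "('v, 'e) top_graph \<Rightarrow> 'v set \<Rightarrow> 'e set \<Rightarrow> ('v, 'e) top_graph" where
  "restrict_graph \<Gamma> V E =
    \<Gamma>\<lparr>verts := V, edges := E, pos_edges := pos_edges \<Gamma> \<inter> E,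
      vtop := subtopology (vtop \<Gamma>) V, etop := subtopology (etop \<Gamma>) E\<rparr>"

definition connected_subgraphs ::
    "('v, 'e) top_graph \<Rightarrow> 'v set \<Rightarrow> ('v set \<times> 'e set) set" where
  "connected_subgraphs \<Gamma> W =
    {(V, E). closed_subgraph \<Gamma> V E \<and> connected_profinite (restrict_graph \<Gamma> V E) \<and> W \<subseteq> V}"

definition tree_like :: "('v, 'e) top_graph \<Rightarrow> bool" where
  "tree_like \<Gamma> \<longleftrightarrow>
    profinite_graph \<Gamma> \<and> connected_profinite \<Gamma> \<and>
    (\<forall>u\<in>verts \<Gamma>. \<forall>v\<in>verts \<Gamma>.
      connected_profinite
        (restrict_graph \<Gamma>
          (\<Inter>(V, E) \<in> connected_subgraphs \<Gamma> {u, v}. V)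
          (\<Inter>(V, E) \<in> connected_subgraphs \<Gamma> {u, v}. E)))"


section \<open>Cayley graphs\<close>

definition cayley_graph ::
    "'a set \<Rightarrow> ('a, 'g) marked \<Rightarrow> 'g topology \<Rightarrow> ('g, 'g \<times> 'a letter) top_graph" where
  "cayley_graph A M T =
    \<lparr>verts = carrier (fst M),
     edges = carrier (fst M) \<times> letters A,
     pos_edges = carrier (fst M) \<times> (A \<times> {True}),
     src = fst,
     tgt = (\<lambda>(g, l). g \<otimes>\<^bsub>fst M\<^esub> letter_val M l),
     einv = (\<lambda>(g, l). (g \<otimes>\<^bsub>fst M\<^esub> letter_val M l, linv l)),
     vtop = T,
     etop = prod_topology T (discrete_topology (letters A))\<rparr>"


section \<open>The free group is a group, and the canonical copy is isomorphic to the group\<close>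

lemma linv_linv [simp]: "linv (linv l) = l"
  by (simp add: linv_def)

lemma reduced_simps [simp]:
  "reduced []" "reduced [x]" "reduced (x # y # w) \<longleftrightarrow> y \<noteq> linv x \<and> reduced (y # w)"
  by (auto simp: reduced_def)

lemma reduced_tl: "reduced (x # w) \<Longrightarrow> reduced w"
  by (cases w) auto

lemma reduced_cons_red: "reduced w \<Longrightarrow> reduced (cons_red l w)"
  by (cases w) (auto dest: reduced_tl)

lemma cons_red_linv: "reduced w \<Longrightarrow> cons_red (linv l) (cons_red l w) = w"
proof (cases w)
  case (Cons m v)
  then show "reduced w \<Longrightarrow> cons_red (linv l) (cons_red l w) = w"
    by (cases v) auto
qed auto

lemma cons_red_linv': "reduced w \<Longrightarrow> cons_red l (cons_red (linv l) w) = w"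
  using cons_red_linv[of w "linv l"] by simp

lemma reduced_act: "reduced v \<Longrightarrow> reduced (foldr cons_red u v)"
  by (induction u) (auto intro: reduced_cons_red)

lemma freduce_id: "reduced w \<Longrightarrow> freduce w = w"
proof (induction w)
  case (Cons l w)
  then show ?case
    by (cases w) (auto simp: freduce_def)
qed (simp add: freduce_def)

lemma set_cons_red: "set (cons_red l w) \<subseteq> insert l (set w)"
  by (cases w) auto

lemma set_act: "set (foldr cons_red u v) \<subseteq> set u \<union> set v"
proof (induction u)
  case (Cons l u)
  then show ?case
    using set_cons_red[of l "foldr cons_red u v"] by auto
qed auto

lemma free_mult: "reduced v \<Longrightarrow> freduce (u @ v) = foldr cons_red u v"
  using freduce_id[of v] by (simp add: freduce_def)

lemma act_cons_red:
  assumes "reduced v"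
  shows "foldr cons_red (cons_red l u) v = cons_red l (foldr cons_red u v)"
proof (cases u)
  case (Cons m u')
  show ?thesis
    using Cons cons_red_linv'[OF reduced_act[OF assms, of u'], of l] by auto
qed auto

lemma act_act:
  assumes "reduced w"
  shows "foldr cons_red (foldr cons_red u v) w = foldr cons_red u (foldr cons_red v w)"
  by (induction u) (auto simp: act_cons_red assms)

lemma act_inverse:
  assumes "reduced w"
  shows "foldr cons_red (rev (map linv u)) (foldr cons_red u w) = w"
  using assms by (induction u) (auto simp: cons_red_linv reduced_act)

lemma linv_letters: "l \<in> letters A \<Longrightarrow> linv l \<in> letters A"
  by (auto simp: letters_def linv_def)

lemma group_free_group: "group (free_group A)"
proof (rule groupI)
  fix x y z
  assume x: "x \<in> carrier (free_group A)" and y: "y \<in> carrier (free_group A)"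
  show "x \<otimes>\<^bsub>free_group A\<^esub> y \<in> carrier (free_group A)"
    using x y set_act[of x y] reduced_act[of y x] by (auto simp: free_group_def free_mult)
  assume z: "z \<in> carrier (free_group A)"
  show "x \<otimes>\<^bsub>free_group A\<^esub> y \<otimes>\<^bsub>free_group A\<^esub> z = x \<otimes>\<^bsub>free_group A\<^esub> (y \<otimes>\<^bsub>free_group A\<^esub> z)"
    using x y z by (simp add: free_group_def free_mult reduced_act act_act)
next
  show "\<one>\<^bsub>free_group A\<^esub> \<in> carrier (free_group A)"
    by (simp add: free_group_def)
next
  fix x assume "x \<in> carrier (free_group A)"
  then show "\<one>\<^bsub>free_group A\<^esub> \<otimes>\<^bsub>free_group A\<^esub> x = x"
    by (simp add: free_group_def freduce_id)
next
  fix x assume x: "x \<in> carrier (free_group A)"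
  define y where "y = foldr cons_red (rev (map linv x)) []"
  have "set y \<subseteq> letters A"
    using x set_act[of "rev (map linv x)" "[]"] linv_letters
    by (force simp: y_def free_group_def)
  moreover have "reduced y"
    by (simp add: y_def reduced_act)
  moreover have "foldr cons_red y x = []"
    using x act_act[of x "rev (map linv x)" "[]"] act_inverse[of "[]" x] freduce_id[of x]
    by (simp add: y_def free_group_def freduce_def)
  ultimately show "\<exists>y\<in>carrier (free_group A). y \<otimes>\<^bsub>free_group A\<^esub> x = \<one>\<^bsub>free_group A\<^esub>"
    using x by (auto simp: free_group_def free_mult)
qed

context
  fixes A :: "'a set" and G :: "'g monoid" and \<phi> :: "'a \<Rightarrow> 'g"
  assumes gen: "generated_group A (G, \<phi>)"
begin

interpretation G: group G
  using gen by (simp add: generated_group_def)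

lemma marking_closed: "a \<in> A \<Longrightarrow> \<phi> a \<in> carrier G"
  using gen by (auto simp: generated_group_def)

lemma letter_val_closed: "l \<in> letters A \<Longrightarrow> letter_val (G, \<phi>) l \<in> carrier G"
  by (auto simp: letters_def letter_val_def marking_closed)

lemma letter_val_linv:
  "l \<in> letters A \<Longrightarrow> letter_val (G, \<phi>) (linv l) = inv\<^bsub>G\<^esub> (letter_val (G, \<phi>) l)"
  by (auto simp: letters_def letter_val_def linv_def marking_closed)

lemma word_val_closed: "set w \<subseteq> letters A \<Longrightarrow> word_val (G, \<phi>) w \<in> carrier G"
  by (induction w) (auto simp: word_val_def letter_val_closed)

lemma word_val_append:
  assumes "set u \<subseteq> letters A" "set v \<subseteq> letters A"
  shows "word_val (G, \<phi>) (u @ v) = word_val (G, \<phi>) u \<otimes>\<^bsub>G\<^esub> word_val (G, \<phi>) v"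
  using assms(1)
proof (induction u)
  case (Cons l u)
  then show ?case
    using word_val_closed[of u] word_val_closed[OF assms(2)] letter_val_closed[of l]
    by (simp add: word_val_def G.m_assoc)
next
  case Nil
  then show ?case
    using word_val_closed[OF assms(2)] by (simp add: word_val_def)
qed

lemma word_val_cons_red:
  assumes "l \<in> letters A" "set w \<subseteq> letters A"
  shows "word_val (G, \<phi>) (cons_red l w) = letter_val (G, \<phi>) l \<otimes>\<^bsub>G\<^esub> word_val (G, \<phi>) w"
proof (cases w)
  case (Cons m v)
  have "letter_val (G, \<phi>) l \<otimes>\<^bsub>G\<^esub> (inv\<^bsub>G\<^esub> (letter_val (G, \<phi>) l) \<otimes>\<^bsub>G\<^esub> word_val (G, \<phi>) v)
      = word_val (G, \<phi>) v"
    using assms Cons word_val_closed[of v] letter_val_closed[of l]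
    by (simp add: G.m_assoc[symmetric])
  then show ?thesis
    using Cons letter_val_linv[OF assms(1)] by (auto simp: word_val_def)
qed (simp add: word_val_def)

lemma word_val_freduce:
  "set w \<subseteq> letters A \<Longrightarrow> word_val (G, \<phi>) (freduce w) = word_val (G, \<phi>) w"
proof (induction w)
  case (Cons l w)
  have "set (freduce w) \<subseteq> letters A"
    using Cons.prems set_act[of w "[]"] by (auto simp: freduce_def)
  then have "word_val (G, \<phi>) (freduce (l # w))
      = letter_val (G, \<phi>) l \<otimes>\<^bsub>G\<^esub> word_val (G, \<phi>) (freduce w)"
    using word_val_cons_red[of l "freduce w"] Cons.prems by (simp add: freduce_def)
  then show ?case
    using Cons by (simp add: word_val_def)
qed (simp add: freduce_def)

lemma group_hom_word_val: "group_hom (free_group A) G (word_val (G, \<phi>))"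
proof (intro group_hom.intro group_hom_axioms.intro homI)
  show "group (free_group A)" "group G"
    by (rule group_free_group, rule G.group_axioms)
  fix x y
  assume xy: "x \<in> carrier (free_group A)" "y \<in> carrier (free_group A)"
  then show "word_val (G, \<phi>) x \<in> carrier G"
    by (simp add: free_group_def word_val_closed)
  show "word_val (G, \<phi>) (x \<otimes>\<^bsub>free_group A\<^esub> y) = word_val (G, \<phi>) x \<otimes>\<^bsub>G\<^esub> word_val (G, \<phi>) y"
    using xy word_val_freduce[of "x @ y"] by (simp add: free_group_def word_val_append)
qed

lemma word_val_letter:
  assumes "a \<in> A"
  shows "[(a, True)] \<in> carrier (free_group A)" "word_val (G, \<phi>) [(a, True)] = \<phi> a"
  using assms
  by (auto simp: free_group_def letters_def word_val_def letter_val_def marking_closed)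

lemma word_val_surj: "word_val (G, \<phi>) ` carrier (free_group A) = carrier G"
proof -
  interpret h: group_hom "free_group A" G "word_val (G, \<phi>)"
    by (rule group_hom_word_val)
  have "\<phi> ` A \<subseteq> word_val (G, \<phi>) ` carrier (free_group A)"
    using word_val_letter by (auto simp: image_iff) metis
  then have "carrier G \<subseteq> word_val (G, \<phi>) ` carrier (free_group A)"
    using G.generate_subgroup_incl[OF _ h.img_is_subgroup, of "\<phi> ` A"] gen
    by (simp add: generated_group_def)
  then show ?thesis
    using h.hom_closed by auto
qed

lemma canonical_copy_iso:
  "\<exists>f \<in> iso (fst (canonical_copy A (G, \<phi>))) G. \<forall>a\<in>A. f (snd (canonical_copy A (G, \<phi>)) a) = \<phi> a"
proof
  interpret h: group_hom "free_group A" G "word_val (G, \<phi>)"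
    by (rule group_hom_word_val)
  let ?f = "\<lambda>X. the_elem (word_val (G, \<phi>) ` X)"
  show "?f \<in> iso (fst (canonical_copy A (G, \<phi>))) G"
    using h.FactGroup_iso_set[OF word_val_surj]
    by (simp add: canonical_copy_def quotient_marked_def relators_def)
  show "\<forall>a\<in>A. ?f (snd (canonical_copy A (G, \<phi>)) a) = \<phi> a"
  proof
    fix a assume a: "a \<in> A"
    let ?K = "relators A (G, \<phi>)"
    have "word_val (G, \<phi>) x = \<phi> a" if "x \<in> ?K #>\<^bsub>free_group A\<^esub> [(a, True)]" for x
      using that word_val_letter[OF a] gen a
      by (auto simp: r_coset_def relators_def kernel_def generated_group_def Pi_iff)
    moreover have "[(a, True)] \<in> ?K #>\<^bsub>free_group A\<^esub> [(a, True)]"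
      using word_val_letter(1)[OF a] h.subgroup_kernel
      by (simp add: relators_def h.G.rcos_self)
    ultimately have "word_val (G, \<phi>) ` (?K #>\<^bsub>free_group A\<^esub> [(a, True)]) = {\<phi> a}"
      by force
    then show "?f (snd (canonical_copy A (G, \<phi>)) a) = \<phi> a"
      by (simp add: canonical_copy_def quotient_marked_def)
  qed
qed

end

end

theory Submission
  imports
    Defs
    "HOL-Algebra.Multiplicative_Group"
    "HOL-Algebra.SndIsomorphismGrp"
    "HOL-Analysis.T1_Spaces"
begin

text \<open>
  Let \<open>R\<close> be the kernel of the map from the free group \<open>F\<close> onto \<open>G\<close>.  A word in \<open>R\<^sup>p[R, R]\<close> labels a closed path
  in the Cayley graph of \<open>G\<close> that passes every edge a number of times divisible by \<open>p\<close>.  A word that is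
  central modulo \<open>R\<^sup>p[R, R]\<close> has a translation invariant flow, because commutators with it have no flow
  modulo \<open>p\<close>.  So an element of the next group determines, for each letter, the flow modulo \<open>p\<close> up to a
  constant; this property is all that is used about the tower.

  Fix \<open>g \<noteq> 1\<close> in the limit.  Call an edge at level \<open>n\<close> forced if, for some \<open>m \<ge> n\<close>, all paths at level \<open>m\<close>
  from \<open>1\<close> to \<open>g\<close> pass over it.  The forced edges connect \<open>1\<close> to \<open>g\<close>.  Otherwise let \<open>K\<close> be the component of
  \<open>1\<close> in the preimage, at level \<open>n + 1\<close>, of the edges forced by level \<open>n + 2\<close>.  The flow \<open>f\<close> of \<open>g\<close> is constant
  modulo the prime on the fibre of an edge that is not forced, so \<open>f - r f\<close> vanishes there for each \<open>r\<close> in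
  the kernel from level \<open>n + 1\<close> to level \<open>n\<close>.  Since there are two nontrivial letters, \<open>r\<close> can be
  chosen so that all paths to \<open>r\<close> pass through the image of \<open>g\<close> at level \<open>n\<close>, that is, outside \<open>K\<close>.  Then
  the boundary of \<open>f - r f\<close> sums to \<open>-1\<close> over \<open>K\<close>, although the flow out of \<open>K\<close> is zero.

  Each forced edge is therefore the image of forced edges at all higher levels, and by compactness of an
  edge of the limit that lies in every connected closed subgraph containing \<open>1\<close> and \<open>g\<close>.  Hence at every
  level \<open>1\<close> and \<open>g\<close> are connected inside the intersection \<open>T\<close> of these subgraphs.  By compactness again \<open>T\<close>
  includes a connected closed subgraph that contains both, and this is \<open>T\<close> itself.
\<close>


section \<open>Signed edge counts of paths in a Cayley graph and their conservation law\<close>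

section \<open>Words, paths and flows\<close>

lemma (in group) mult_inv_eq_one_iff:
  "x \<in> carrier G \<Longrightarrow> y \<in> carrier G \<Longrightarrow> x \<otimes> inv y = \<one> \<longleftrightarrow> x = y"
  using inv_solve_right[of "\<one>" x y] by auto

lemma (in group) inv_mult_eq_one_iff:
  "x \<in> carrier G \<Longrightarrow> y \<in> carrier G \<Longrightarrow> inv x \<otimes> y = \<one> \<longleftrightarrow> y = x"
  using inv_solve_left[of "\<one>" x y] by auto

locale marked_group =
  fixes A :: "'a set" and M :: "('a, 'g) marked"
  assumes generated: "generated_group A M"
begin

abbreviation G where "G \<equiv> fst M"

lemma generated_pair: "generated_group A (fst M, snd M)"
  using generated by simp

sublocale G: group "fst M"
  using generated by (cases M) (simp add: generated_group_def)

lemma letter_val_in: "l \<in> letters A \<Longrightarrow> letter_val M l \<in> carrier G"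
  using letter_val_closed[OF generated_pair] by simp

lemma letter_val_inverse: "l \<in> letters A \<Longrightarrow> letter_val M (linv l) = inv\<^bsub>G\<^esub> letter_val M l"
  using letter_val_linv[OF generated_pair] by simp

lemma word_val_in: "set w \<subseteq> letters A \<Longrightarrow> word_val M w \<in> carrier G"
  using word_val_closed[OF generated_pair] by simp

lemma word_val_Nil [simp]: "word_val M [] = \<one>\<^bsub>G\<^esub>"
  by (simp add: word_val_def)

lemma word_val_Cons [simp]: "word_val M (l # w) = letter_val M l \<otimes>\<^bsub>G\<^esub> word_val M w"
  by (simp add: word_val_def)

lemma word_val_app:
  "set u \<subseteq> letters A \<Longrightarrow> set v \<subseteq> letters A \<Longrightarrow>
    word_val M (u @ v) = word_val M u \<otimes>\<^bsub>G\<^esub> word_val M v"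
  using word_val_append[OF generated_pair] by simp

lemma word_val_freduced: "set w \<subseteq> letters A \<Longrightarrow> word_val M (freduce w) = word_val M w"
  using word_val_freduce[OF generated_pair] by simp

lemma word_val_onto:
  assumes "x \<in> carrier G"
  obtains w where "set w \<subseteq> letters A" "word_val M w = x"
  using word_val_surj[OF generated_pair] assms by (force simp: free_group_def)

lemma group_hom_word: "group_hom (free_group A) G (word_val M)"
  using group_hom_word_val[OF generated_pair] by simp

end

definition winv :: "'a word \<Rightarrow> 'a word" where
  "winv w = rev (map linv w)"

lemma winv_letters: "set w \<subseteq> letters A \<Longrightarrow> set (winv w) \<subseteq> letters A"
  by (force simp: winv_def intro: linv_letters)

context marked_group
begin

lemma word_val_winv:
  "set w \<subseteq> letters A \<Longrightarrow> word_val M (winv w) = inv\<^bsub>G\<^esub> word_val M w"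
proof (induction w)
  case (Cons l w)
  have "word_val M (winv (l # w)) = word_val M (winv w @ [linv l])"
    by (simp add: winv_def)
  also have "\<dots> = inv\<^bsub>G\<^esub> word_val M w \<otimes>\<^bsub>G\<^esub> inv\<^bsub>G\<^esub> letter_val M l"
    using Cons winv_letters[of w A]
    by (subst word_val_app) (auto simp: letter_val_inverse linv_letters letter_val_in)
  finally show ?case
    using Cons by (simp add: G.inv_mult_group letter_val_in word_val_in)
qed (simp add: winv_def)

end

text \<open>
  An edge is named by its initial vertex and a positive letter.  Hence the letter \<open>(a, False)\<close>, read at
  the identity, runs backwards through the edge that starts at the value of that letter.
\<close>

fun flow :: "('a, 'g) marked \<Rightarrow> 'a word \<Rightarrow> 'g \<Rightarrow> 'a \<Rightarrow> int" where
  "flow M [] g a = 0"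
| "flow M (l # w) g a =
    (if fst l = a
     then if snd l then of_bool (g = \<one>\<^bsub>fst M\<^esub>) else - of_bool (g = letter_val M l)
     else 0) + flow M w (inv\<^bsub>fst M\<^esub> (letter_val M l) \<otimes>\<^bsub>fst M\<^esub> g) a"

text \<open>Unlike \<open>flow\<close>, which cancels, this records each edge that the path crosses
  in either direction, so it is not invariant under free reduction.\<close>

fun path_edges :: "('a, 'g) marked \<Rightarrow> 'a word \<Rightarrow> ('g \<times> 'a) set" where
  "path_edges M [] = {}"
| "path_edges M (l # w) =
    insert (if snd l then \<one>\<^bsub>fst M\<^esub> else letter_val M l, fst l)
      ((\<lambda>(g, a). (letter_val M l \<otimes>\<^bsub>fst M\<^esub> g, a)) ` path_edges M w)"

context marked_group
begin

lemma marking_in: "a \<in> A \<Longrightarrow> snd M a \<in> carrier G"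
  using marking_closed[OF generated_pair] .

lemma letter_val_pos: "letter_val M (a, True) = snd M a"
  by (cases M) (simp add: letter_val_def)

lemma letter_val_neg: "letter_val M (a, False) = inv\<^bsub>G\<^esub> snd M a"
  by (cases M) (simp add: letter_val_def)

lemma path_edges_carrier:
  "set w \<subseteq> letters A \<Longrightarrow> path_edges M w \<subseteq> carrier G \<times> A"
proof (induction w)
  case (Cons l w)
  then show ?case
    by (cases l) (auto simp: letter_val_in letters_def)
qed auto

lemma path_edges_app:
  assumes "set u \<subseteq> letters A" "set v \<subseteq> letters A"
  shows "path_edges M (u @ v) =
    path_edges M u \<union> (\<lambda>(g, a). (word_val M u \<otimes>\<^bsub>G\<^esub> g, a)) ` path_edges M v"
  using assms(1)
proof (induction u)
  case Nil
  have "(\<lambda>(g, a). (\<one>\<^bsub>G\<^esub> \<otimes>\<^bsub>G\<^esub> g, a)) ` path_edges M v = (\<lambda>x. x) ` path_edges M v"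
    using path_edges_carrier[OF assms(2)] by (intro image_cong) auto
  then show ?case by simp
next
  case (Cons l u)
  have "(\<lambda>(g, a). (letter_val M l \<otimes>\<^bsub>G\<^esub> (word_val M u \<otimes>\<^bsub>G\<^esub> g), a)) ` path_edges M v
     = (\<lambda>(g, a). (letter_val M l \<otimes>\<^bsub>G\<^esub> word_val M u \<otimes>\<^bsub>G\<^esub> g, a)) ` path_edges M v"
    using path_edges_carrier[OF assms(2)] Cons.prems
    by (intro image_cong) (auto simp: G.m_assoc letter_val_in word_val_in)
  then show ?case
    using Cons by (simp add: image_Un image_image split_def)
qed

lemma path_edges_snoc:
  assumes "set w \<subseteq> letters A" "a \<in> A"
  shows "path_edges M (w @ [(a, True)]) = insert (word_val M w, a) (path_edges M w)"
    and "path_edges M (w @ [(a, False)]) =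
      insert (word_val M w \<otimes>\<^bsub>G\<^esub> inv\<^bsub>G\<^esub> snd M a, a) (path_edges M w)"
  using assms by (auto simp: path_edges_app letters_def word_val_in letter_val_neg)

lemma flow_eq_0:
  "set w \<subseteq> letters A \<Longrightarrow> g \<in> carrier G \<Longrightarrow> (g, a) \<notin> path_edges M w \<Longrightarrow> flow M w g a = 0"
proof (induction w arbitrary: g)
  case (Cons l w)
  have l: "letter_val M l \<in> carrier G"
    using Cons.prems letter_val_in by auto
  have "(inv\<^bsub>G\<^esub> letter_val M l \<otimes>\<^bsub>G\<^esub> g, a) \<notin> path_edges M w"
  proof
    assume "(inv\<^bsub>G\<^esub> letter_val M l \<otimes>\<^bsub>G\<^esub> g, a) \<in> path_edges M w"
    then have "(letter_val M l \<otimes>\<^bsub>G\<^esub> (inv\<^bsub>G\<^esub> letter_val M l \<otimes>\<^bsub>G\<^esub> g), a) \<in> path_edges M (l # w)"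
      by force
    then show False
      using Cons.prems l by (simp add: G.m_assoc[symmetric])
  qed
  then have "flow M w (inv\<^bsub>G\<^esub> letter_val M l \<otimes>\<^bsub>G\<^esub> g) a = 0"
    using Cons l by simp
  then show ?case
    using Cons.prems by (auto split: if_splits)
qed simp

lemma flow_app:
  assumes "set u \<subseteq> letters A" "g \<in> carrier G"
  shows "flow M (u @ v) g a = flow M u g a + flow M v (inv\<^bsub>G\<^esub> word_val M u \<otimes>\<^bsub>G\<^esub> g) a"
  using assms
proof (induction u arbitrary: g)
  case (Cons l u)
  then have l: "letter_val M l \<in> carrier G" and u: "word_val M u \<in> carrier G"
    using letter_val_in word_val_in by auto
  have "inv\<^bsub>G\<^esub> word_val M (l # u) \<otimes>\<^bsub>G\<^esub> g
      = inv\<^bsub>G\<^esub> word_val M u \<otimes>\<^bsub>G\<^esub> (inv\<^bsub>G\<^esub> letter_val M l \<otimes>\<^bsub>G\<^esub> g)"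
    using l u Cons.prems by (simp add: G.inv_mult_group G.m_assoc)
  then show ?case
    using Cons l by simp
qed auto

lemma flow_cancel:
  assumes "l \<in> letters A" "g \<in> carrier G"
  shows "flow M (l # linv l # w) g a = flow M w g a"
proof -
  obtain b s where l: "l = (b, s)" by (cases l)
  have b: "snd M b \<in> carrier G"
    using assms l marking_in by (auto simp: letters_def)
  have e': "inv\<^bsub>G\<^esub> snd M b \<otimes>\<^bsub>G\<^esub> g = inv\<^bsub>G\<^esub> snd M b \<longleftrightarrow> g = \<one>\<^bsub>G\<^esub>"
    using b assms by simp
  have e'': "snd M b \<otimes>\<^bsub>G\<^esub> g = \<one>\<^bsub>G\<^esub> \<longleftrightarrow> g = inv\<^bsub>G\<^esub> snd M b"
    using b assms G.inv_mult_eq_one_iff[of "inv\<^bsub>G\<^esub> snd M b" g] by simp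
  show ?thesis
    using b assms e' e''
    by (cases s) (auto simp: l linv_def letter_val_pos letter_val_neg G.m_assoc[symmetric])
qed

lemma flow_cons_red:
  assumes "l \<in> letters A" "g \<in> carrier G"
  shows "flow M (cons_red l w) g a = flow M (l # w) g a"
proof (cases w)
  case (Cons m v)
  then show ?thesis
    using flow_cancel[OF assms] by (auto simp del: flow.simps)
qed simp

text \<open>An edge crossed forth and at once back contributes nothing. Hence the flow is well
  defined on the free group, although \<open>path_edges\<close> is not.\<close>

lemma flow_freduce:
  "set w \<subseteq> letters A \<Longrightarrow> g \<in> carrier G \<Longrightarrow> flow M (freduce w) g a = flow M w g a"
proof (induction w arbitrary: g)
  case (Cons l w)
  have "flow M (freduce (l # w)) g a = flow M (l # freduce w) g a"
    using flow_cons_red[of l g "freduce w" a] Cons.prems by (simp add: freduce_def)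
  then show ?case
    using Cons letter_val_in by simp
qed (simp add: freduce_def)

text \<open>The path of \<open>winv w\<close> starts at the identity and not at the end of
  \<open>w\<close>; this accounts for the translation by the value of \<open>w\<close>.\<close>

lemma flow_winv:
  assumes "set w \<subseteq> letters A" "g \<in> carrier G"
  shows "flow M (winv w) g a = - flow M w (word_val M w \<otimes>\<^bsub>G\<^esub> g) a"
proof -
  \<comment> \<open>Induction on the last letter of \<open>w\<close>: it meets its inverse in the
    middle, where \<open>flow_cancel\<close> applies.\<close>
  have *: "flow M (w @ winv w) g a = 0" if "set w \<subseteq> letters A" "g \<in> carrier G" for w g
    using that
  proof (induction w arbitrary: g rule: rev_induct)
    case (snoc l w)
    have "flow M ((w @ [l]) @ winv (w @ [l])) g a = flow M (w @ (l # linv l # winv w)) g a"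
      by (simp add: winv_def)
    also have "\<dots> = flow M (w @ winv w) g a"
      using snoc.prems flow_cancel[of l "inv\<^bsub>G\<^esub> word_val M w \<otimes>\<^bsub>G\<^esub> g" "winv w" a] word_val_in[of w]
      by (simp add: flow_app del: flow.simps)
    finally show ?case
      using snoc by simp
  qed (simp add: winv_def)
  have "flow M (w @ winv w) (word_val M w \<otimes>\<^bsub>G\<^esub> g) a = 0"
    using assms word_val_in by (intro *) auto
  then show ?thesis
    using assms word_val_in[of w] by (simp add: flow_app G.m_assoc[symmetric])
qed

text \<open>Equal values make \<open>u\<close> followed by the reversed \<open>v\<close> a closed
  path, and the translations in \<open>flow_app\<close> and \<open>flow_winv\<close> cancel.\<close>

lemma flow_diff:
  assumes "set u \<subseteq> letters A" "set v \<subseteq> letters A" "g \<in> carrier G"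
    and "word_val M u = word_val M v"
  shows "flow M (u @ winv v) g a = flow M u g a - flow M v g a"
  using assms word_val_in[of v] by (simp add: flow_app flow_winv G.m_assoc[symmetric])

text \<open>Kirchhoff's law, inflow minus outflow: the end of the path gains 1 and its start loses
  1. In the induction, a new first letter adds one edge and translates the remaining path.\<close>

lemma flow_boundary:
  assumes "finite A"
  shows "set w \<subseteq> letters A \<Longrightarrow> x \<in> carrier G \<Longrightarrow>
    (\<Sum>a\<in>A. flow M w (x \<otimes>\<^bsub>G\<^esub> inv\<^bsub>G\<^esub> snd M a) a - flow M w x a) =
      of_bool (x = word_val M w) - of_bool (x = \<one>\<^bsub>G\<^esub>)"
proof (induction w arbitrary: x)
  case Nil
  then show ?case by simp
next
  case (Cons l w)
  obtain b s where l: "l = (b, s)" by (cases l)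
  let ?t = "letter_val M l"
  have t: "?t \<in> carrier G" and w: "word_val M w \<in> carrier G" and b: "snd M b \<in> carrier G" "b \<in> A"
    using Cons.prems letter_val_in word_val_in l marking_in by (auto simp: letters_def)
  \<comment> \<open>The flow of the first edge alone; only the summand of its letter
    \<open>b\<close> has a boundary.\<close>
  define h where "h = (\<lambda>g a. if b = a
     then if s then of_bool (g = \<one>\<^bsub>G\<^esub>) else - of_bool (g = ?t) else (0::int))"
  have eq: "flow M (l # w) g a = h g a + flow M w (inv\<^bsub>G\<^esub> ?t \<otimes>\<^bsub>G\<^esub> g) a" for g a
    by (auto simp: l h_def)
  have x: "inv\<^bsub>G\<^esub> ?t \<otimes>\<^bsub>G\<^esub> x \<in> carrier G"
    using t Cons.prems by simp
  have "(\<Sum>a\<in>A. flow M (l # w) (x \<otimes>\<^bsub>G\<^esub> inv\<^bsub>G\<^esub> snd M a) a - flow M (l # w) x a) =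
    (\<Sum>a\<in>A. h (x \<otimes>\<^bsub>G\<^esub> inv\<^bsub>G\<^esub> snd M a) a - h x a) +
    (\<Sum>a\<in>A. flow M w (inv\<^bsub>G\<^esub> ?t \<otimes>\<^bsub>G\<^esub> x \<otimes>\<^bsub>G\<^esub> inv\<^bsub>G\<^esub> snd M a) a - flow M w (inv\<^bsub>G\<^esub> ?t \<otimes>\<^bsub>G\<^esub> x) a)"
    unfolding eq sum.distrib[symmetric] using t Cons.prems marking_in
    by (intro sum.cong) (auto simp: G.m_assoc)
  also have "(\<Sum>a\<in>A. flow M w (inv\<^bsub>G\<^esub> ?t \<otimes>\<^bsub>G\<^esub> x \<otimes>\<^bsub>G\<^esub> inv\<^bsub>G\<^esub> snd M a) a - flow M w (inv\<^bsub>G\<^esub> ?t \<otimes>\<^bsub>G\<^esub> x) a)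
     = of_bool (inv\<^bsub>G\<^esub> ?t \<otimes>\<^bsub>G\<^esub> x = word_val M w) - of_bool (inv\<^bsub>G\<^esub> ?t \<otimes>\<^bsub>G\<^esub> x = \<one>\<^bsub>G\<^esub>)"
    using Cons x by simp
  also have "(\<Sum>a\<in>A. h (x \<otimes>\<^bsub>G\<^esub> inv\<^bsub>G\<^esub> snd M a) a - h x a) = h (x \<otimes>\<^bsub>G\<^esub> inv\<^bsub>G\<^esub> snd M b) b - h x b"
  proof -
    have "(\<Sum>a\<in>A. h (x \<otimes>\<^bsub>G\<^esub> inv\<^bsub>G\<^esub> snd M a) a - h x a) =
      (\<Sum>a\<in>A. if a = b then h (x \<otimes>\<^bsub>G\<^esub> inv\<^bsub>G\<^esub> snd M b) b - h x b else 0)"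
      by (intro sum.cong) (auto simp: h_def)
    then show ?thesis using assms b by simp
  qed
  also have "\<dots> = of_bool (x = ?t) - of_bool (x = \<one>\<^bsub>G\<^esub>)"
    using b Cons.prems G.mult_inv_eq_one_iff
    by (cases s) (auto simp: h_def l letter_val_pos letter_val_neg)
  finally show ?case
    using t w Cons.prems G.inv_solve_left[of "word_val M w" ?t x] G.inv_mult_eq_one_iff[OF t, of x]
    by (auto simp: eq_commute[of "word_val M w"])
qed

end


section \<open>Closed paths whose flow is not invariant under translations\<close>

section \<open>Cycles in Cayley graphs\<close>

context marked_group
begin

lemma set_concat_replicate_letters:
  "set u \<subseteq> letters A \<Longrightarrow> set (concat (replicate k u)) \<subseteq> letters A"
  by (induction k) auto

lemma word_val_power:
  "set u \<subseteq> letters A \<Longrightarrow> word_val M (concat (replicate k u)) = word_val M u [^]\<^bsub>G\<^esub> k"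
proof (induction k)
  case (Suc k)
  then show ?case
    using set_concat_replicate_letters[of u k] word_val_in
      G.nat_pow_Suc2[of "word_val M u" k]
    by (simp add: word_val_app)
qed simp

lemma flow_power:
  assumes "set u \<subseteq> letters A" "g \<in> carrier G"
  shows "flow M (concat (replicate k u)) g a =
    (\<Sum>i<k. flow M u (inv\<^bsub>G\<^esub> (word_val M u [^]\<^bsub>G\<^esub> i) \<otimes>\<^bsub>G\<^esub> g) a)"
proof (induction k)
  case (Suc k)
  have "concat (replicate (Suc k) u) = concat (replicate k u) @ u"
    by (induction k) auto
  then show ?case
    using Suc assms set_concat_replicate_letters[of u k]
    by (simp add: flow_app word_val_power)
qed simp

lemma set_letter_power: "c \<in> A \<Longrightarrow> set (replicate k (c, True)) \<subseteq> letters A"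
  by (auto simp: letters_def)

lemma word_val_letter_power:
  "c \<in> A \<Longrightarrow> word_val M (replicate k (c, True)) = snd M c [^]\<^bsub>G\<^esub> k"
  using word_val_power[of "[(c, True)]" k] marking_in[of c]
  by (simp add: letters_def letter_val_pos)

lemma flow_letter_power:
  assumes "c \<in> A" "g \<in> carrier G"
  shows "flow M (replicate k (c, True)) g a =
    (if c = a then \<Sum>i<k. of_bool (g = snd M c [^]\<^bsub>G\<^esub> i) else 0)"
  using assms marking_in[of c] flow_power[of "[(c, True)]" g k a]
  by (auto simp: letters_def letter_val_pos G.inv_mult_eq_one_iff simp del: sum_of_bool_eq)

text \<open>This supplies two edges at one vertex, with the same letter, whose flows are incongruent
  modulo every integer greater than 1. Powers of the product \<open>?z\<close> give such a cycle
  unless the inverse of \<open>?a\<close> is itself a power of \<open>?z\<close>; in that case the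
  two generators commute, and their commutator serves.\<close>

lemma ex_unbalanced_cycle:
  assumes fin: "finite (carrier G)" and ab: "a \<in> A" "b \<in> A" "a \<noteq> b"
    and nt: "snd M a \<noteq> \<one>\<^bsub>G\<^esub>" "snd M b \<noteq> \<one>\<^bsub>G\<^esub>"
  obtains v where "set v \<subseteq> letters A" "word_val M v = \<one>\<^bsub>G\<^esub>"
    "flow M v \<one>\<^bsub>G\<^esub> a = 1" "flow M v (inv\<^bsub>G\<^esub> snd M a) a = 0"
proof -
  let ?a = "snd M a" and ?b = "snd M b"
  have in_G: "?a \<in> carrier G" "?b \<in> carrier G"
    using ab marking_in by auto
  let ?z = "?a \<otimes>\<^bsub>G\<^esub> ?b"
  have z: "?z \<in> carrier G"
    using in_G by simp
  have letters_ab: "(a, s) \<in> letters A" "(b, s) \<in> letters A" for s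
    using ab by (auto simp: letters_def)
  show ?thesis
  proof (cases "\<exists>i::nat. inv\<^bsub>G\<^esub> ?a = ?z [^]\<^bsub>G\<^esub> i")
    case False
    define u where "u = [(a, True), (b, True)]"
    have u: "set u \<subseteq> letters A" "word_val M u = ?z"
      using letters_ab in_G by (auto simp: u_def letter_val_pos)
    \<comment> \<open>With the order as exponent, the cycle leaves the identity along
      \<open>a\<close> exactly once.\<close>
    define k where "k = G.ord ?z"
    have k: "k > 0" "?z [^]\<^bsub>G\<^esub> k = \<one>\<^bsub>G\<^esub>"
      using G.ord_ge_1[OF fin z] G.pow_ord_eq_1[OF z] by (auto simp: k_def)
    have min: "?z [^]\<^bsub>G\<^esub> i \<noteq> \<one>\<^bsub>G\<^esub>" if "0 < i" "i < k" for i :: nat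
      using that G.pow_eq_id[OF z, of i] by (auto simp: k_def dest: dvd_imp_le)
    define v where "v = concat (replicate k u)"
    have flow_u: "flow M u g a = of_bool (g = \<one>\<^bsub>G\<^esub>)" for g
      using ab by (simp add: u_def)
    have flow_v: "flow M v g a = (\<Sum>i<k. of_bool (g = ?z [^]\<^bsub>G\<^esub> i))" if "g \<in> carrier G" for g
      using that u z by (simp add: v_def flow_power flow_u G.inv_mult_eq_one_iff)
    have "flow M v \<one>\<^bsub>G\<^esub> a = (\<Sum>i<k. if i = 0 then 1 else 0)"
      by (subst flow_v[OF G.one_closed], rule sum.cong)
        (use min in \<open>auto simp: eq_commute[of "\<one>\<^bsub>G\<^esub>"]\<close>)
    then have "flow M v \<one>\<^bsub>G\<^esub> a = 1"
      using k by simp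
    moreover have "flow M v (inv\<^bsub>G\<^esub> ?a) a = 0"
      using False in_G by (simp add: flow_v)
    ultimately show ?thesis
      using that[of v] u k set_concat_replicate_letters[of u k]
      by (simp add: v_def word_val_power)
  next
    case True
    then obtain i :: nat where i: "inv\<^bsub>G\<^esub> ?a = ?z [^]\<^bsub>G\<^esub> i" ..
    \<comment> \<open>A power of \<open>?z\<close> commutes with \<open>?z\<close>; cancelling shows
      that \<open>?a\<close> and \<open>?b\<close> commute.\<close>
    have "inv\<^bsub>G\<^esub> ?a \<otimes>\<^bsub>G\<^esub> ?z = ?z \<otimes>\<^bsub>G\<^esub> inv\<^bsub>G\<^esub> ?a"
      unfolding i using z by (metis G.nat_pow_Suc G.nat_pow_Suc2)
    then have b_conj: "?a \<otimes>\<^bsub>G\<^esub> ?b \<otimes>\<^bsub>G\<^esub> inv\<^bsub>G\<^esub> ?a = ?b"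
      using in_G by (simp add: G.m_assoc[symmetric])
    \<comment> \<open>The commutator crosses the \<open>a\<close>-edge at \<open>?b\<close>
      backwards; that edge must not be the one that enters the identity.\<close>
    have ne: "inv\<^bsub>G\<^esub> ?a \<noteq> ?b"
    proof
      assume "inv\<^bsub>G\<^esub> ?a = ?b"
      then have "?z = \<one>\<^bsub>G\<^esub>"
        using in_G by (metis G.r_inv)
      then have "inv\<^bsub>G\<^esub> ?a = \<one>\<^bsub>G\<^esub>"
        using i by simp
      then show False
        using nt in_G by (metis G.inv_inv G.inv_one)
    qed
    define v where "v = [(a, True), (b, True), (a, False), (b, False)]"
    have val_v: "word_val M v = \<one>\<^bsub>G\<^esub>"
      using in_G b_conj by (simp add: v_def letter_val_pos letter_val_neg G.m_assoc[symmetric])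
    have flow_v: "flow M v g a = of_bool (g = \<one>\<^bsub>G\<^esub>) - of_bool (g = ?b)" if "g \<in> carrier G" for g
    proof -
      have "inv\<^bsub>G\<^esub> ?b \<otimes>\<^bsub>G\<^esub> (inv\<^bsub>G\<^esub> ?a \<otimes>\<^bsub>G\<^esub> g) = inv\<^bsub>G\<^esub> ?a \<longleftrightarrow>
        inv\<^bsub>G\<^esub> ?a \<otimes>\<^bsub>G\<^esub> g = ?b \<otimes>\<^bsub>G\<^esub> inv\<^bsub>G\<^esub> ?a"
        using G.inv_solve_left[of "inv\<^bsub>G\<^esub> ?a" ?b "inv\<^bsub>G\<^esub> ?a \<otimes>\<^bsub>G\<^esub> g"] in_G that by auto
      also have "\<dots> \<longleftrightarrow> g = ?a \<otimes>\<^bsub>G\<^esub> (?b \<otimes>\<^bsub>G\<^esub> inv\<^bsub>G\<^esub> ?a)"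
        using G.inv_solve_left[of "?b \<otimes>\<^bsub>G\<^esub> inv\<^bsub>G\<^esub> ?a" ?a g] in_G that by auto
      finally show ?thesis
        using ab b_conj in_G by (simp add: v_def letter_val_pos letter_val_neg G.m_assoc)
    qed
    have "flow M v \<one>\<^bsub>G\<^esub> a = 1" "flow M v (inv\<^bsub>G\<^esub> ?a) a = 0"
      using ne nt in_G by (auto simp: flow_v)
    then show ?thesis
      using that[of v] val_v letters_ab by (simp add: v_def)
  qed
qed

text \<open>If \<open>h\<close> is not a power of some generator, the cycle of powers of that
  generator passes the identity but not \<open>h\<close>. So \<open>h\<close> is a power of both
  \<open>a\<close> and \<open>b\<close>. Going to \<open>h\<close> along powers of \<open>a\<close>
  and back along powers of \<open>b\<close> gives a cycle with \<open>a\<close>-flow 1 at the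
  identity and 0 at \<open>h\<close>.\<close>

lemma invariant_cycles_imp_one:
  fixes p :: int
  assumes fin: "finite (carrier G)" and ab: "a \<in> A" "b \<in> A" "a \<noteq> b"
    and h: "h \<in> carrier G" and p: "p > 1"
    and inv: "\<And>v g c. set v \<subseteq> letters A \<Longrightarrow> word_val M v = \<one>\<^bsub>G\<^esub> \<Longrightarrow> g \<in> carrier G \<Longrightarrow> c \<in> A \<Longrightarrow>
      p dvd flow M v (inv\<^bsub>G\<^esub> h \<otimes>\<^bsub>G\<^esub> g) c - flow M v g c"
  shows "h = \<one>\<^bsub>G\<^esub>"
proof (rule ccontr)
  assume h1: "h \<noteq> \<one>\<^bsub>G\<^esub>"
  have power: "\<exists>i::nat. h = snd M c [^]\<^bsub>G\<^esub> i" if c: "c \<in> A" for c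
  proof (rule ccontr)
    assume no: "\<nexists>i::nat. h = snd M c [^]\<^bsub>G\<^esub> i"
    let ?c = "snd M c"
    define k where "k = G.ord ?c"
    have cG: "?c \<in> carrier G" using c marking_in by auto
    have k: "k > 0" "?c [^]\<^bsub>G\<^esub> k = \<one>\<^bsub>G\<^esub>"
      using G.ord_ge_1[OF fin cG] G.pow_ord_eq_1[OF cG] by (auto simp: k_def)
    have min: "?c [^]\<^bsub>G\<^esub> i \<noteq> \<one>\<^bsub>G\<^esub>" if "0 < i" "i < k" for i :: nat
      using that G.pow_eq_id[OF cG, of i] by (auto simp: k_def dest: dvd_imp_le)
    define v where "v = replicate k (c, True)"
    have v: "set v \<subseteq> letters A" "word_val M v = \<one>\<^bsub>G\<^esub>"
      using c k by (simp_all only: v_def word_val_letter_power set_letter_power)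
    have "flow M v \<one>\<^bsub>G\<^esub> c = (\<Sum>i<k. if i = 0 then 1 else 0)"
      unfolding v_def flow_letter_power[OF c G.one_closed] if_P[OF refl]
      by (rule sum.cong) (use min in \<open>auto simp: eq_commute[of "\<one>\<^bsub>G\<^esub>"]\<close>)
    then have "flow M v \<one>\<^bsub>G\<^esub> c = 1"
      using k by simp
    moreover have "flow M v h c = 0"
      using no c h by (simp add: v_def flow_letter_power)
    ultimately show False
      using inv[OF v h c] h p by simp
  qed
  \<comment> \<open>Minimality keeps the \<open>a\<close>-edges of the cycle from starting at
    \<open>h\<close>, and lets only the first of them start at the identity.\<close>
  define i where "i = (LEAST i::nat. h = snd M a [^]\<^bsub>G\<^esub> i)"
  have i: "h = snd M a [^]\<^bsub>G\<^esub> i"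
    unfolding i_def using power[OF ab(1)] by (rule LeastI_ex)
  have least: "h \<noteq> snd M a [^]\<^bsub>G\<^esub> k" if "k < i" for k :: nat
    using that not_less_Least unfolding i_def by blast
  obtain j :: nat where j: "h = snd M b [^]\<^bsub>G\<^esub> j"
    using power[OF ab(2)] by auto
  have aG: "snd M a \<in> carrier G" using ab marking_in by auto
  define u w where "u = replicate i (a, True)" "w = replicate j (b, True)"
  have u: "set u \<subseteq> letters A" "word_val M u = h" and w: "set w \<subseteq> letters A" "word_val M w = h"
    using ab i j by (simp_all only: u_w_def word_val_letter_power set_letter_power)
  have fl: "flow M (u @ winv w) g a = (\<Sum>k<i. of_bool (g = snd M a [^]\<^bsub>G\<^esub> k))" if "g \<in> carrier G" for g
    using ab u w that by (subst flow_diff) (auto simp: flow_letter_power u_w_def)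
  have "snd M a [^]\<^bsub>G\<^esub> k \<noteq> \<one>\<^bsub>G\<^esub>" if k: "0 < k" "k < i" for k :: nat
  proof
    assume eq: "snd M a [^]\<^bsub>G\<^esub> k = \<one>\<^bsub>G\<^esub>"
    have "h = snd M a [^]\<^bsub>G\<^esub> (k + (i - k))"
      using i k by simp
    also have "\<dots> = snd M a [^]\<^bsub>G\<^esub> (i - k)"
      using aG eq by (simp add: G.nat_pow_mult[symmetric])
    finally show False
      using least[of "i - k"] k by simp
  qed
  then have "flow M (u @ winv w) \<one>\<^bsub>G\<^esub> a = (\<Sum>k<i. if k = 0 then 1 else 0)"
    by (subst fl[OF G.one_closed], intro sum.cong) (auto simp: eq_commute[of "\<one>\<^bsub>G\<^esub>"])
  moreover have "i > 0"
    using i h1 by (cases i) auto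
  ultimately have "flow M (u @ winv w) \<one>\<^bsub>G\<^esub> a = 1"
    by simp
  moreover have "flow M (u @ winv w) h a = 0"
    using least h by (simp add: fl)
  moreover have "set (u @ winv w) \<subseteq> letters A"
    using u w winv_letters[of w A] by auto
  moreover have "word_val M (u @ winv w) = \<one>\<^bsub>G\<^esub>"
    using u w h winv_letters[of w A] by (subst word_val_app) (auto simp: word_val_winv)
  ultimately show False
    using inv[of "u @ winv w" h a] ab h p by simp
qed

end

text \<open>The map is not given but encoded by an inclusion of relations, since the expansions are
  known through the words that become trivial in them.\<close>

locale marked_morphism = M1: marked_group A M1 + M0: marked_group A M0
  for A :: "'a set" and M1 :: "('a, 'g) marked" and M0 :: "('a, 'h) marked" +
  assumes refines: "\<And>w. set w \<subseteq> letters A \<Longrightarrow> word_val M1 w = \<one>\<^bsub>fst M1\<^esub> \<Longrightarrow> word_val M0 w = \<one>\<^bsub>fst M0\<^esub>"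
begin

abbreviation \<pi> where "\<pi> \<equiv> canonical_morphism A M1 M0"

lemma refines_eq:
  assumes "set u \<subseteq> letters A" "set v \<subseteq> letters A" "word_val M1 u = word_val M1 v"
  shows "word_val M0 u = word_val M0 v"
proof -
  have v: "set (winv v) \<subseteq> letters A"
    by (rule winv_letters[OF assms(2)])
  have "word_val M0 (u @ winv v) = \<one>\<^bsub>fst M0\<^esub>"
    using assms v M1.word_val_in[of v]
    by (intro refines) (auto simp: M1.word_val_app M1.word_val_winv)
  then show ?thesis
    using assms v M0.word_val_in
    by (simp add: M0.word_val_app M0.word_val_winv M0.G.mult_inv_eq_one_iff)
qed

lemma marking_determines_morphism:
  assumes f: "f \<in> hom M1.G M0.G" "\<And>a. a \<in> A \<Longrightarrow> f (snd M1 a) = snd M0 a"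
    and w: "set w \<subseteq> letters A"
  shows "f (word_val M1 w) = word_val M0 w"
proof -
  interpret f: group_hom M1.G M0.G f
    using f by (simp add: group_hom_def group_hom_axioms_def)
  show ?thesis
    using w
  proof (induction w)
    case (Cons l w)
    moreover have "f (letter_val M1 l) = letter_val M0 l"
      using Cons.prems f(2) M1.marking_in
      by (cases l; cases "snd l")
        (auto simp: letters_def M1.letter_val_pos M1.letter_val_neg M0.letter_val_pos M0.letter_val_neg)
    ultimately show ?case
      using M1.letter_val_in M1.word_val_in by simp
  qed simp
qed

text \<open>A value is read off any word for the argument: \<open>refines_eq\<close> makes it
  independent of the word, and the generators leave no other choice. This justifies the definite
  description in \<open>canonical_morphism\<close>.\<close>

lemma canonical_morphism_spec:
  "\<pi> \<in> hom M1.G M0.G \<and> \<pi> \<in> extensional (carrier M1.G) \<and> (\<forall>a\<in>A. \<pi> (snd M1 a) = snd M0 a)"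
proof -
  define f where "f = restrict (\<lambda>x. word_val M0 (SOME w. set w \<subseteq> letters A \<and> word_val M1 w = x))
    (carrier M1.G)"
  have f_val: "f (word_val M1 w) = word_val M0 w" if "set w \<subseteq> letters A" for w
  proof -
    define v where "v = (SOME v. set v \<subseteq> letters A \<and> word_val M1 v = word_val M1 w)"
    have "set v \<subseteq> letters A \<and> word_val M1 v = word_val M1 w"
      unfolding v_def by (rule someI[of _ w]) (use that in simp)
    then show ?thesis
      using that refines_eq[of v w] M1.word_val_in[of w] by (simp add: f_def v_def)
  qed
  have "f \<in> hom M1.G M0.G"
  proof (rule homI)
    fix x y assume "x \<in> carrier M1.G" "y \<in> carrier M1.G"
    then obtain u v where uv: "set u \<subseteq> letters A" "x = word_val M1 u"
      "set v \<subseteq> letters A" "y = word_val M1 v"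
      using M1.word_val_onto by metis
    then have "f (word_val M1 (u @ v)) = word_val M0 (u @ v)"
      by (intro f_val) auto
    then show "f (x \<otimes>\<^bsub>M1.G\<^esub> y) = f x \<otimes>\<^bsub>M0.G\<^esub> f y"
      using uv by (simp add: M1.word_val_app M0.word_val_app f_val)
    show "f x \<in> carrier M0.G"
      using uv M0.word_val_in by (simp add: f_val)
  qed
  moreover have "f (snd M1 a) = snd M0 a" if "a \<in> A" for a
    using f_val[of "[(a, True)]"] that M1.marking_in M0.marking_in
    by (simp add: letters_def M1.letter_val_pos M0.letter_val_pos)
  ultimately have ex: "f \<in> hom M1.G M0.G \<and> f \<in> extensional (carrier M1.G) \<and> (\<forall>a\<in>A. f (snd M1 a) = snd M0 a)"
    by (simp add: f_def)
  have \<pi>_THE: "\<pi> = (THE f. f \<in> hom M1.G M0.G \<and> f \<in> extensional (carrier M1.G) \<and> (\<forall>a\<in>A. f (snd M1 a) = snd M0 a))"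
    by (simp add: canonical_morphism_def split_def)
  have uniq: "g = f"
    if "g \<in> hom M1.G M0.G \<and> g \<in> extensional (carrier M1.G) \<and> (\<forall>a\<in>A. g (snd M1 a) = snd M0 a)" for g
  proof (rule extensionalityI)
    show "g \<in> extensional (carrier M1.G)" "f \<in> extensional (carrier M1.G)"
      using that ex by auto
    fix x assume "x \<in> carrier M1.G"
    then obtain w where "set w \<subseteq> letters A" "word_val M1 w = x"
      by (rule M1.word_val_onto)
    then show "g x = f x"
      using that f_val marking_determines_morphism[of g w] by auto
  qed
  have "\<pi> = f"
    unfolding \<pi>_THE using ex uniq by (rule the_equality)
  then show ?thesis
    using ex by simp
qed

lemma morphism_word_val: "set w \<subseteq> letters A \<Longrightarrow> \<pi> (word_val M1 w) = word_val M0 w"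
  using marking_determines_morphism canonical_morphism_spec by blast

lemma morphism_in: "x \<in> carrier M1.G \<Longrightarrow> \<pi> x \<in> carrier M0.G"
  using canonical_morphism_spec by (auto simp: hom_def)

lemma morphism_mult:
  "x \<in> carrier M1.G \<Longrightarrow> y \<in> carrier M1.G \<Longrightarrow> \<pi> (x \<otimes>\<^bsub>M1.G\<^esub> y) = \<pi> x \<otimes>\<^bsub>M0.G\<^esub> \<pi> y"
  using canonical_morphism_spec by (auto simp: hom_def)

lemma morphism_one [simp]: "\<pi> \<one>\<^bsub>M1.G\<^esub> = \<one>\<^bsub>M0.G\<^esub>"
  using morphism_word_val[of "[]"] by simp

lemma morphism_letter: "l \<in> letters A \<Longrightarrow> \<pi> (letter_val M1 l) = letter_val M0 l"
  using morphism_word_val[of "[l]"] M1.letter_val_in M0.letter_val_in by simp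

lemma morphism_marking: "a \<in> A \<Longrightarrow> \<pi> (snd M1 a) = snd M0 a"
  using canonical_morphism_spec by blast

lemma morphism_inv: "x \<in> carrier M1.G \<Longrightarrow> \<pi> (inv\<^bsub>M1.G\<^esub> x) = inv\<^bsub>M0.G\<^esub> \<pi> x"
  using group_hom.hom_inv[of M1.G M0.G \<pi> x] canonical_morphism_spec
  by (simp add: group_hom_def group_hom_axioms_def)

lemma path_edges_morphism:
  "set w \<subseteq> letters A \<Longrightarrow> path_edges M0 w = (\<lambda>(x, a). (\<pi> x, a)) ` path_edges M1 w"
proof (induction w)
  case (Cons l w)
  have "(\<lambda>(x, a). (letter_val M0 l \<otimes>\<^bsub>M0.G\<^esub> \<pi> x, a)) ` path_edges M1 w =
    (\<lambda>(x, a). (\<pi> (letter_val M1 l \<otimes>\<^bsub>M1.G\<^esub> x), a)) ` path_edges M1 w"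
    using Cons.prems M1.path_edges_carrier[of w] M1.letter_val_in[of l]
    by (intro image_cong) (auto simp: morphism_mult morphism_letter)
  then show ?case
    using Cons morphism_letter by (simp add: image_image split_def)
qed simp

end


section \<open>Edges that all paths must pass, and why they connect the end points\<close>

section \<open>Forced edges\<close>

text \<open>Cut the path just before or just after it crosses the edge; the direction of crossing
  decides which cut ends at which vertex.\<close>

lemma (in marked_group) path_vertex:
  assumes "(h, c) \<in> path_edges M w" "set w \<subseteq> letters A"
  shows "\<exists>u. set u \<subseteq> letters A \<and> word_val M u = h \<and> path_edges M u \<subseteq> path_edges M w"
    and "\<exists>u. set u \<subseteq> letters A \<and> word_val M u = h \<otimes>\<^bsub>G\<^esub> snd M c \<and> path_edges M u \<subseteq> path_edges M w"
proof -
  have "(\<exists>u. set u \<subseteq> letters A \<and> word_val M u = h \<and> path_edges M u \<subseteq> path_edges M w) \<and>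
    (\<exists>u. set u \<subseteq> letters A \<and> word_val M u = h \<otimes>\<^bsub>G\<^esub> snd M c \<and> path_edges M u \<subseteq> path_edges M w)"
    using assms
  proof (induction w rule: rev_induct)
    case (snoc l w)
    obtain d s where l: "l = (d, s)" by (cases l)
    have w: "set w \<subseteq> letters A" and d: "d \<in> A" and dG: "snd M d \<in> carrier G"
      and wG: "word_val M w \<in> carrier G" and wl: "set (w @ [(d, s)]) \<subseteq> letters A"
      using snoc.prems l marking_in word_val_in by (auto simp: letters_def)
    have sub: "path_edges M w \<subseteq> path_edges M (w @ [l])"
      using snoc.prems by (subst path_edges_app) auto
    show ?case
    proof (cases "(h, c) \<in> path_edges M w")
      case True
      then show ?thesis
        using snoc.IH w sub by blast
    next
      case False
      have val: "word_val M (w @ [(d, s)]) = word_val M w \<otimes>\<^bsub>G\<^esub> letter_val M (d, s)"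
        using w wl dG by (subst word_val_app) (auto simp: letter_val_in)
      show ?thesis
      proof (cases s)
        case s: True
        then have "h = word_val M w" "c = d"
          using snoc.prems False path_edges_snoc[OF w d] l by auto
        then show ?thesis
          using w sub wl val s l by (metis letter_val_pos order_refl)
      next
        case s: False
        then have h: "h = word_val M w \<otimes>\<^bsub>G\<^esub> inv\<^bsub>G\<^esub> snd M d" "c = d"
          using snoc.prems False path_edges_snoc[OF w d] l by auto
        then have "h \<otimes>\<^bsub>G\<^esub> snd M c = word_val M w"
          using wG dG by (simp add: G.m_assoc)
        then show ?thesis
          using w sub wl val s l h by (metis letter_val_neg order_refl)
      qed
    qed
  qed simp
  then show "\<exists>u. set u \<subseteq> letters A \<and> word_val M u = h \<and> path_edges M u \<subseteq> path_edges M w"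
    "\<exists>u. set u \<subseteq> letters A \<and> word_val M u = h \<otimes>\<^bsub>G\<^esub> snd M c \<and> path_edges M u \<subseteq> path_edges M w"
    by auto
qed

text \<open>The combinatorial argument knows the prime expansions only through
  \<open>steady\<close>, which \<open>Zp_tilde_expansion_step\<close> establishes.\<close>

locale expansion_step = marked_morphism A M1 M0
  for A :: "'a set" and M1 :: "('a, 'g) marked" and M0 :: "('a, 'h) marked" +
  fixes p :: int
  assumes p_gt_1: "p > 1"
    and steady: "\<And>w x y a. set w \<subseteq> letters A \<Longrightarrow> word_val M1 w = \<one>\<^bsub>fst M1\<^esub> \<Longrightarrow>
      x \<in> carrier (fst M0) \<Longrightarrow> y \<in> carrier (fst M0) \<Longrightarrow> a \<in> A \<Longrightarrow>
      p dvd flow M0 w x a - flow M0 w y a"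
begin

lemma steady_diff:
  assumes "set u \<subseteq> letters A" "set v \<subseteq> letters A" "word_val M1 u = word_val M1 v"
    and "x \<in> carrier M0.G" "y \<in> carrier M0.G" "a \<in> A"
  shows "p dvd (flow M0 u x a - flow M0 v x a) - (flow M0 u y a - flow M0 v y a)"
proof -
  have v: "set (winv v) \<subseteq> letters A"
    by (rule winv_letters[OF assms(2)])
  have "word_val M1 (u @ winv v) = \<one>\<^bsub>M1.G\<^esub>"
    using assms v M1.word_val_in[of v] by (simp add: M1.word_val_app M1.word_val_winv)
  then have "p dvd flow M0 (u @ winv v) x a - flow M0 (u @ winv v) y a"
    using assms v by (intro steady) auto
  then show ?thesis
    using assms refines_eq[of u v] by (simp add: M0.flow_diff)
qed

end

text \<open>Summation by parts: the boundary of a flow summed over the vertices in \<open>K\<close>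
  becomes a sum over the edges that cross the border of \<open>K\<close>.\<close>

lemma (in group) sum_translate_right:
  fixes f :: "'a \<Rightarrow> int"
  assumes c: "c \<in> carrier G"
  shows "(\<Sum>x\<in>carrier G. of_bool (x \<in> K) * (f (x \<otimes> inv c) - f x)) =
    (\<Sum>x\<in>carrier G. (of_bool (x \<otimes> c \<in> K) - of_bool (x \<in> K)) * f x)"
proof -
  have "bij_betw (\<lambda>x. x \<otimes> c) (carrier G) (carrier G)"
    using c by (intro bij_betwI[where g = "\<lambda>x. x \<otimes> inv c"]) (auto simp: m_assoc)
  then have "(\<Sum>x\<in>carrier G. of_bool (x \<in> K) * f (x \<otimes> inv c)) =
    (\<Sum>x\<in>carrier G. of_bool (x \<otimes> c \<in> K) * f (x \<otimes> c \<otimes> inv c))"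
    by (rule sum.reindex_bij_betw[symmetric])
  also have "\<dots> = (\<Sum>x\<in>carrier G. of_bool (x \<otimes> c \<in> K) * f x)"
    using c by (intro sum.cong) (auto simp: m_assoc)
  finally show ?thesis
    by (simp add: right_diff_distrib left_diff_distrib sum_subtractf)
qed

text \<open>The step from \<open>M1\<close> to \<open>M0\<close> supplies an element of the kernel
  outside the component \<open>K\<close>; the step from \<open>M2\<close> to \<open>M1\<close>
  controls flows in \<open>M1\<close>.\<close>

locale two_steps = S1: expansion_step A M1 M0 p + S2: expansion_step A M2 M1 q
  for A :: "'a set" and M2 :: "('a, 'k) marked" and M1 :: "('a, 'g) marked"
    and M0 :: "('a, 'h) marked" and p q :: int
begin

definition forced :: "'a word \<Rightarrow> ('h \<times> 'a) set" where
  "forced w\<^sub>0 = {(h, c). h \<in> carrier (fst M0) \<and> c \<in> A \<and>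
    (\<forall>w. set w \<subseteq> letters A \<longrightarrow> word_val M2 w = word_val M2 w\<^sub>0 \<longrightarrow> (h, c) \<in> path_edges M0 w)}"

text \<open>By contradiction, summing Kirchhoff's law for a corrected flow \<open>F\<close> over
  \<open>K\<close>: every border term is divisible by \<open>q\<close>, but the sum of the boundary
  is -1.\<close>

lemma forced_edges_connect:
  assumes fin: "finite A" "finite (carrier (fst M0))" "finite (carrier (fst M1))"
    and ab: "a \<in> A" "b \<in> A" "a \<noteq> b" "snd M0 a \<noteq> \<one>\<^bsub>fst M0\<^esub>" "snd M0 b \<noteq> \<one>\<^bsub>fst M0\<^esub>"
    and w\<^sub>0: "set w\<^sub>0 \<subseteq> letters A"
  shows "\<exists>w. set w \<subseteq> letters A \<and> word_val M0 w = word_val M0 w\<^sub>0 \<and> path_edges M0 w \<subseteq> forced w\<^sub>0"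
proof (rule ccontr)
  let ?G = "fst M0" and ?H = "fst M1" and ?P = "forced w\<^sub>0"
  let ?z = "word_val M0 w\<^sub>0" and ?g = "word_val M1 w\<^sub>0"
  assume no: "\<not> ?thesis"
  have z: "?z \<in> carrier ?G" and g: "?g \<in> carrier ?H"
    using w\<^sub>0 S1.M0.word_val_in S1.M1.word_val_in by auto
  have \<pi>g: "S1.\<pi> ?g = ?z"
    using w\<^sub>0 by (rule S1.morphism_word_val)
  have unreached: "word_val M0 w \<noteq> ?z" if "set w \<subseteq> letters A" "path_edges M0 w \<subseteq> ?P" for w
    using no that by auto
  \<comment> \<open>The vertices of \<open>M1\<close> reached from the identity by words that use
    only forced edges in \<open>M0\<close>. The assumption \<open>no\<close> says that none of them
    lies over \<open>?z\<close>.\<close>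
  define K where "K = {x. \<exists>w. set w \<subseteq> letters A \<and> word_val M1 w = x \<and> path_edges M0 w \<subseteq> ?P}"
  have K_in: "x \<in> carrier ?H" if "x \<in> K" for x
    using that S1.M1.word_val_in by (auto simp: K_def)
  have K_avoids: "S1.\<pi> x \<noteq> ?z" if "x \<in> K" for x
    using that unreached S1.morphism_word_val by (auto simp: K_def)
  have one_K: "\<one>\<^bsub>?H\<^esub> \<in> K"
    unfolding K_def by (auto intro!: exI[of _ "[]"])
  \<comment> \<open>Together with \<open>K_neg\<close>: edges over forced edges cannot cross the
    border of \<open>K\<close>.\<close>
  have K_pos: "x \<otimes>\<^bsub>?H\<^esub> snd M1 c \<in> K" if x: "x \<in> K" and c: "(S1.\<pi> x, c) \<in> ?P" for x c
  proof -
    obtain w where w: "set w \<subseteq> letters A" "word_val M1 w = x" "path_edges M0 w \<subseteq> ?P"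
      using x by (auto simp: K_def)
    have cA: "c \<in> A" using c by (simp add: forced_def)
    have "word_val M1 (w @ [(c, True)]) = x \<otimes>\<^bsub>?H\<^esub> snd M1 c"
      using w cA S1.M1.marking_in
      by (subst S1.M1.word_val_app) (auto simp: letters_def S1.M1.letter_val_pos)
    moreover have "path_edges M0 (w @ [(c, True)]) \<subseteq> ?P"
      using w c cA S1.M0.path_edges_snoc(1)[of w c] S1.morphism_word_val[of w] by auto
    moreover have "set (w @ [(c, True)]) \<subseteq> letters A"
      using w cA by (auto simp: letters_def)
    ultimately show ?thesis
      unfolding K_def by blast
  qed
  have K_neg: "x \<in> K" if x: "x \<in> carrier ?H" and xc: "x \<otimes>\<^bsub>?H\<^esub> snd M1 c \<in> K"
    and c: "(S1.\<pi> x, c) \<in> ?P" for x c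
  proof -
    obtain w where w: "set w \<subseteq> letters A" "word_val M1 w = x \<otimes>\<^bsub>?H\<^esub> snd M1 c" "path_edges M0 w \<subseteq> ?P"
      using xc by (auto simp: K_def)
    have cA: "c \<in> A" using c by (simp add: forced_def)
    have "word_val M1 (w @ [(c, False)]) = x"
      using w cA x S1.M1.marking_in[OF cA]
      by (subst S1.M1.word_val_app) (auto simp: letters_def S1.M1.letter_val_neg S1.M1.G.m_assoc)
    moreover have "word_val M0 w \<otimes>\<^bsub>?G\<^esub> inv\<^bsub>?G\<^esub> snd M0 c = S1.\<pi> x"
      using S1.morphism_word_val[OF w(1)] w cA x S1.M1.marking_in[OF cA] S1.morphism_in[OF x]
        S1.M0.marking_in[OF cA]
      by (simp add: S1.morphism_mult S1.morphism_marking S1.M0.G.m_assoc flip: S1.morphism_word_val)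
    then have "path_edges M0 (w @ [(c, False)]) \<subseteq> ?P"
      using w c cA S1.M0.path_edges_snoc(2)[of w c] by auto
    moreover have "set (w @ [(c, False)]) \<subseteq> letters A"
      using w cA by (auto simp: letters_def)
    ultimately show ?thesis
      unfolding K_def by blast
  qed
  \<comment> \<open>A path at level 0 that avoids the vertex \<open>?z\<close> has no flow on the edges at \<open>?z\<close>, while \<open>v'\<close> has
    unequal flows on two such edges with the same letter; so the end point \<open>r\<close> of \<open>v'\<close> at level 1 is
    not in \<open>K\<close>.\<close>
  obtain v where v: "set v \<subseteq> letters A" "word_val M0 v = \<one>\<^bsub>?G\<^esub>"
    "flow M0 v \<one>\<^bsub>?G\<^esub> a = 1" "flow M0 v (inv\<^bsub>?G\<^esub> snd M0 a) a = 0"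
    using S1.M0.ex_unbalanced_cycle[OF fin(2) ab] by blast
  \<comment> \<open>The cycle \<open>v\<close> is moved from the identity to \<open>?z\<close>; the
    flow of \<open>w\<^sub>0\<close> there and back cancels.\<close>
  define v' where "v' = w\<^sub>0 @ v @ winv w\<^sub>0"
  have v': "set v' \<subseteq> letters A"
    using v w\<^sub>0 winv_letters[OF w\<^sub>0] by (auto simp: v'_def)
  have val_v': "word_val M0 v' = \<one>\<^bsub>?G\<^esub>"
    using v w\<^sub>0 winv_letters[OF w\<^sub>0] z
    by (simp add: v'_def S1.M0.word_val_app S1.M0.word_val_winv)
  have flow_v': "flow M0 v' (?z \<otimes>\<^bsub>?G\<^esub> x) a = flow M0 v x a" if "x \<in> carrier ?G" for x
    using that v w\<^sub>0 z
    by (simp add: v'_def S1.M0.flow_app S1.M0.flow_winv S1.M0.G.m_assoc[symmetric])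
  define r where "r = word_val M1 v'"
  have r: "r \<in> carrier ?H" "S1.\<pi> r = \<one>\<^bsub>?G\<^esub>"
    using v' val_v' S1.M1.word_val_in S1.morphism_word_val by (auto simp: r_def)
  have aG: "snd M0 a \<in> carrier ?G"
    using ab S1.M0.marking_in by auto
  have "r \<notin> K"
  proof
    assume "r \<in> K"
    then obtain w where w: "set w \<subseteq> letters A" "word_val M1 w = r" "path_edges M0 w \<subseteq> ?P"
      by (auto simp: K_def)
    have avoids: "word_val M0 u \<noteq> ?z" if "set u \<subseteq> letters A" "path_edges M0 u \<subseteq> path_edges M0 w" for u
      using that w unreached by blast
    have "(?z, a) \<notin> path_edges M0 w"
      using S1.M0.path_vertex(1)[OF _ w(1), of ?z a] avoids by blast
    moreover have "?z \<otimes>\<^bsub>?G\<^esub> inv\<^bsub>?G\<^esub> snd M0 a \<otimes>\<^bsub>?G\<^esub> snd M0 a = ?z"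
      using z aG by (simp add: S1.M0.G.m_assoc)
    then have "(?z \<otimes>\<^bsub>?G\<^esub> inv\<^bsub>?G\<^esub> snd M0 a, a) \<notin> path_edges M0 w"
      using S1.M0.path_vertex(2)[OF _ w(1), of "?z \<otimes>\<^bsub>?G\<^esub> inv\<^bsub>?G\<^esub> snd M0 a" a] avoids by auto
    ultimately have "flow M0 w ?z a = 0" "flow M0 w (?z \<otimes>\<^bsub>?G\<^esub> inv\<^bsub>?G\<^esub> snd M0 a) a = 0"
      using w z aG by (auto intro: S1.M0.flow_eq_0)
    moreover have "p dvd (flow M0 w ?z a - flow M0 v' ?z a) -
      (flow M0 w (?z \<otimes>\<^bsub>?G\<^esub> inv\<^bsub>?G\<^esub> snd M0 a) a - flow M0 v' (?z \<otimes>\<^bsub>?G\<^esub> inv\<^bsub>?G\<^esub> snd M0 a) a)"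
      using w v' z aG ab by (intro S1.steady_diff) (auto simp: r_def)
    ultimately have "p dvd 1"
      using flow_v'[of "\<one>\<^bsub>?G\<^esub>"] flow_v'[of "inv\<^bsub>?G\<^esub> snd M0 a"] v z aG by simp
    then show False
      using S1.p_gt_1 by simp
  qed
  have \<pi>r: "S1.\<pi> (inv\<^bsub>?H\<^esub> r \<otimes>\<^bsub>?H\<^esub> x) = S1.\<pi> x" if "x \<in> carrier ?H" for x
    using that r S1.morphism_in[of x] by (simp add: S1.morphism_mult S1.morphism_inv)
  \<comment> \<open>Subtracting the translate by \<open>r\<close> removes the unknown constants off the forced edges.\<close>
  define F where "F = (\<lambda>x c. flow M1 w\<^sub>0 x c - flow M1 w\<^sub>0 (inv\<^bsub>?H\<^esub> r \<otimes>\<^bsub>?H\<^esub> x) c)"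
  \<comment> \<open>Some word \<open>w\<close> with the same value in \<open>M2\<close> misses the
    edge in \<open>M0\<close>, hence misses its whole fibre in \<open>M1\<close>. Both vertices in
    \<open>F\<close> lie in that fibre, so comparing \<open>w\<^sub>0\<close> with \<open>w\<close>
    by \<open>steady_diff\<close> leaves no constant.\<close>
  have F_0: "q dvd F x c" if x: "x \<in> carrier ?H" and c: "c \<in> A" "(S1.\<pi> x, c) \<notin> ?P" for x c
  proof -
    obtain w where w: "set w \<subseteq> letters A" "word_val M2 w = word_val M2 w\<^sub>0"
      "(S1.\<pi> x, c) \<notin> path_edges M0 w"
      using c x S1.morphism_in by (auto simp: forced_def)
    have "(y, c) \<notin> path_edges M1 w" if "S1.\<pi> y = S1.\<pi> x" for y
    proof
      assume "(y, c) \<in> path_edges M1 w"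
      then have "(S1.\<pi> y, c) \<in> path_edges M0 w"
        unfolding S1.path_edges_morphism[OF w(1)] by (rule rev_image_eqI) simp
      then show False
        using w that by simp
    qed
    then have "flow M1 w x c = 0" "flow M1 w (inv\<^bsub>?H\<^esub> r \<otimes>\<^bsub>?H\<^esub> x) c = 0"
      using w x r \<pi>r by (auto intro!: S1.M1.flow_eq_0)
    moreover have "q dvd (flow M1 w\<^sub>0 x c - flow M1 w x c) -
       (flow M1 w\<^sub>0 (inv\<^bsub>?H\<^esub> r \<otimes>\<^bsub>?H\<^esub> x) c - flow M1 w (inv\<^bsub>?H\<^esub> r \<otimes>\<^bsub>?H\<^esub> x) c)"
      using w w\<^sub>0 x r c by (intro S2.steady_diff) auto
    ultimately show ?thesis
      by (simp add: F_def)
  qed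
  have boundary: "(\<Sum>c\<in>A. F (x \<otimes>\<^bsub>?H\<^esub> inv\<^bsub>?H\<^esub> snd M1 c) c - F x c) = - of_bool (x = \<one>\<^bsub>?H\<^esub>)"
    if xK: "x \<in> K" for x
  proof -
    have x: "x \<in> carrier ?H" and rx: "inv\<^bsub>?H\<^esub> r \<otimes>\<^bsub>?H\<^esub> x \<in> carrier ?H"
      using K_in xK r by auto
    have "(\<Sum>c\<in>A. F (x \<otimes>\<^bsub>?H\<^esub> inv\<^bsub>?H\<^esub> snd M1 c) c - F x c) =
      (\<Sum>c\<in>A. flow M1 w\<^sub>0 (x \<otimes>\<^bsub>?H\<^esub> inv\<^bsub>?H\<^esub> snd M1 c) c - flow M1 w\<^sub>0 x c) -
      (\<Sum>c\<in>A. flow M1 w\<^sub>0 (inv\<^bsub>?H\<^esub> r \<otimes>\<^bsub>?H\<^esub> x \<otimes>\<^bsub>?H\<^esub> inv\<^bsub>?H\<^esub> snd M1 c) c -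
        flow M1 w\<^sub>0 (inv\<^bsub>?H\<^esub> r \<otimes>\<^bsub>?H\<^esub> x) c)"
      unfolding sum_subtractf[symmetric] using x r S1.M1.marking_in
      by (intro sum.cong) (auto simp: F_def S1.M1.G.m_assoc)
    also have "\<dots> = (of_bool (x = ?g) - of_bool (x = \<one>\<^bsub>?H\<^esub>)) -
      (of_bool (inv\<^bsub>?H\<^esub> r \<otimes>\<^bsub>?H\<^esub> x = ?g) - of_bool (inv\<^bsub>?H\<^esub> r \<otimes>\<^bsub>?H\<^esub> x = \<one>\<^bsub>?H\<^esub>))"
      using x rx w\<^sub>0 fin by (simp only: S1.M1.flow_boundary)
    \<comment> \<open>The path and its translate by \<open>r\<close> have the end points 1,
      \<open>?g\<close>, \<open>r\<close> and the product of \<open>r\<close> and \<open>?g\<close>.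
      Only 1 is in \<open>K\<close>: the second and the fourth lie over \<open>?z\<close>, and
      \<open>r\<close> was excluded.\<close>
    also have "\<dots> = - of_bool (x = \<one>\<^bsub>?H\<^esub>)"
    proof -
      have "x \<noteq> ?g" "inv\<^bsub>?H\<^esub> r \<otimes>\<^bsub>?H\<^esub> x \<noteq> ?g" "inv\<^bsub>?H\<^esub> r \<otimes>\<^bsub>?H\<^esub> x \<noteq> \<one>\<^bsub>?H\<^esub>"
        using K_avoids[OF xK] \<pi>g \<pi>r[OF x] \<open>r \<notin> K\<close> xK S1.M1.G.inv_mult_eq_one_iff[OF r(1) x] by auto
      then show ?thesis
        by simp
    qed
    finally show ?thesis .
  qed
  have "(\<Sum>x\<in>carrier ?H. of_bool (x \<in> K) * (\<Sum>c\<in>A. F (x \<otimes>\<^bsub>?H\<^esub> inv\<^bsub>?H\<^esub> snd M1 c) c - F x c)) =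
    (\<Sum>c\<in>A. \<Sum>x\<in>carrier ?H. of_bool (x \<in> K) * (F (x \<otimes>\<^bsub>?H\<^esub> inv\<^bsub>?H\<^esub> snd M1 c) c - F x c))"
    unfolding sum_distrib_left by (rule sum.swap)
  also have "\<dots> = (\<Sum>c\<in>A. \<Sum>x\<in>carrier ?H.
      (of_bool (x \<otimes>\<^bsub>?H\<^esub> snd M1 c \<in> K) - of_bool (x \<in> K)) * F x c)"
    using S1.M1.marking_in
    by (intro sum.cong S1.M1.G.sum_translate_right[of _ K "\<lambda>x. F x _"]) auto
  \<comment> \<open>Over a forced edge the indicators of the two ends agree; over any other edge
    \<open>F\<close> is divisible by \<open>q\<close>.\<close>
  also have "q dvd \<dots>"
  proof (intro dvd_sum)
    fix c x assume c: "c \<in> A" and x: "x \<in> carrier ?H"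
    show "q dvd (of_bool (x \<otimes>\<^bsub>?H\<^esub> snd M1 c \<in> K) - of_bool (x \<in> K)) * F x c"
    proof (cases "(S1.\<pi> x, c) \<in> ?P")
      case True
      then have "x \<otimes>\<^bsub>?H\<^esub> snd M1 c \<in> K \<longleftrightarrow> x \<in> K"
        using K_pos K_neg x by blast
      then show ?thesis by simp
    qed (use F_0[OF x c] in simp)
  qed
  finally have "q dvd (\<Sum>x\<in>carrier ?H. of_bool (x \<in> K) * (\<Sum>c\<in>A. F (x \<otimes>\<^bsub>?H\<^esub> inv\<^bsub>?H\<^esub> snd M1 c) c - F x c))" .
  also have "\<dots> = (\<Sum>x\<in>carrier ?H. if x = \<one>\<^bsub>?H\<^esub> then - 1 else 0)"
    using boundary one_K by (intro sum.cong) auto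
  also have "\<dots> = - 1"
    using fin by simp
  finally show False
    using S2.p_gt_1 by simp
qed

end


section \<open>Finiteness of the expansions and the flows of central elements\<close>

section \<open>The expansion by a prime modulo its center\<close>

lemma (in marked_group) generated_image:
  assumes h: "group_hom G H h" and surj: "h ` carrier G = carrier H"
  shows "generated_group A (H, \<lambda>a. h (snd M a))"
    and "set w \<subseteq> letters A \<Longrightarrow> word_val (H, \<lambda>a. h (snd M a)) w = h (word_val M w)"
proof -
  interpret h: group_hom G H h by (rule h)
  have "generate H (h ` snd M ` A) = h ` generate G (snd M ` A)"
    using marking_in by (intro h.generate_img) auto
  also have "generate G (snd M ` A) = carrier G"
    using generated by (simp add: generated_group_def split_def)
  finally have "generate H ((\<lambda>a. h (snd M a)) ` A) = carrier H"
    using surj by (simp add: image_image)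
  then show "generated_group A (H, \<lambda>a. h (snd M a))"
    using marking_in by (auto simp: generated_group_def)
  then interpret N: marked_group A "(H, \<lambda>a. h (snd M a))"
    by unfold_locales
  show "word_val (H, \<lambda>a. h (snd M a)) w = h (word_val M w)" if "set w \<subseteq> letters A"
    using that
  proof (induction w)
    case (Cons l w)
    have "letter_val (H, \<lambda>a. h (snd M a)) l = h (letter_val M l)"
      using Cons.prems N.letter_val_pos N.letter_val_neg marking_in
      by (cases l; cases "snd l") (auto simp: letters_def letter_val_pos letter_val_neg)
    then show ?case
      using Cons letter_val_in word_val_in N.word_val_Cons[of l w] by simp
  qed (use N.word_val_Nil in simp)
qed

text \<open>With the free group as a marked group, its quotients and their word values are instances
  of \<open>generated_image\<close>.\<close>

lemma generated_free_group: "generated_group A (free_group A, \<lambda>a. [(a, True)])"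
proof -
  let ?F = "free_group A" and ?S = "(\<lambda>a. [(a, True)]) ` A"
  interpret F: group ?F by (rule group_free_group)
  have S: "?S \<subseteq> carrier ?F"
    by (auto simp: free_group_def letters_def)
  have letter: "[l] \<in> generate ?F ?S" if l: "l \<in> letters A" for l
  proof (cases "snd l")
    case True
    then show ?thesis
      using l by (cases l) (auto simp: letters_def intro: generate.incl)
  next
    case False
    then obtain a where a: "l = (a, False)" "a \<in> A"
      using l by (cases l) (auto simp: letters_def)
    have "[(a, False)] \<otimes>\<^bsub>?F\<^esub> [(a, True)] = \<one>\<^bsub>?F\<^esub>"
      by (simp add: free_group_def freduce_def linv_def)
    then have "inv\<^bsub>?F\<^esub> [(a, True)] = [(a, False)]"
      using a by (intro F.inv_equality) (auto simp: free_group_def letters_def)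
    then show ?thesis
      using a generate.inv[of "[(a, True)]" ?S ?F] by auto
  qed
  have "w \<in> generate ?F ?S" if "w \<in> carrier ?F" for w
    using that
  proof (induction w)
    case Nil
    then show ?case
      using generate.one[of ?F ?S] by (simp add: free_group_def)
  next
    case (Cons l w)
    have "reduced (l # w)"
      using Cons.prems by (simp add: free_group_def)
    then have "[l] \<otimes>\<^bsub>?F\<^esub> w = l # w"
      using freduce_id[of "l # w"] by (simp add: free_group_def)
    moreover have "w \<in> carrier ?F" "l \<in> letters A"
      using Cons.prems reduced_tl[of l w] by (auto simp: free_group_def)
    ultimately show ?case
      using Cons.IH letter generate.eng[of "[l]" ?F ?S w] by simp
  qed
  then show ?thesis
    using S F.generate_in_carrier[OF S] by (auto simp: generated_group_def group_free_group)
qed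

interpretation free: marked_group A "(free_group A, \<lambda>a. [(a, True)])" for A
  by unfold_locales (rule generated_free_group)

lemma freduce_in_free_group: "set w \<subseteq> letters A \<Longrightarrow> freduce w \<in> carrier (free_group A)"
  using set_act[of w "[]"] reduced_act[of "[]" w] by (auto simp: free_group_def freduce_def)

lemma word_val_free_group:
  "set w \<subseteq> letters A \<Longrightarrow> word_val (free_group A, \<lambda>a. [(a, True)]) w = freduce w"
proof (induction w)
  case (Cons l w)
  have "letter_val (free_group A, \<lambda>a. [(a, True)]) l = [l]"
  proof (cases "snd l")
    case True
    then show ?thesis by (cases l) (simp add: letter_val_def)
  next
    case False
    then obtain a where a: "l = (a, False)" "a \<in> A"
      using Cons.prems by (cases l) (auto simp: letters_def)
    have "[(a, False)] \<otimes>\<^bsub>free_group A\<^esub> [(a, True)] = \<one>\<^bsub>free_group A\<^esub>"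
      by (simp add: free_group_def freduce_def linv_def)
    then have "inv\<^bsub>free_group A\<^esub> [(a, True)] = [(a, False)]"
      using a group.inv_equality[OF group_free_group[of A]] by (auto simp: free_group_def letters_def)
    then show ?thesis
      using a by (simp add: letter_val_def)
  qed
  moreover have "[l] \<otimes>\<^bsub>free_group A\<^esub> freduce w = freduce (l # w)"
  proof -
    have "freduce (l # w) = cons_red l (freduce w)"
      by (simp add: freduce_def)
    then show ?thesis
      using freduce_in_free_group[of w A] Cons.prems free_mult[of "freduce w" "[l]"]
      by (simp add: free_group_def)
  qed
  ultimately show ?case
    using Cons free.word_val_Cons[of A l w] by simp
qed (use free.word_val_Nil in \<open>simp add: freduce_def free_group_def\<close>)

lemma group_hom_r_coset: "N \<lhd> G \<Longrightarrow> group_hom G (G Mod N) (\<lambda>x. N #>\<^bsub>G\<^esub> x)"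
  by (simp add: group_hom_def group_hom_axioms_def normal.factorgroup_is_group normal.r_coset_hom_Mod
      normal.axioms(2) normal_imp_subgroup)

lemma
  assumes N: "N \<lhd> free_group A"
  shows generated_quotient_marked: "generated_group A (quotient_marked A N)"
    and word_val_quotient_marked:
      "set w \<subseteq> letters A \<Longrightarrow> word_val (quotient_marked A N) w = N #>\<^bsub>free_group A\<^esub> freduce w"
  using free.generated_image[of A "free_group A Mod N" "\<lambda>x. N #>\<^bsub>free_group A\<^esub> x"]
    group_hom_r_coset[OF N]
  by (simp_all add: quotient_marked_def carrier_FactGroup word_val_free_group)

lemma (in group) r_coset_eq_self_iff:
  "subgroup N G \<Longrightarrow> x \<in> carrier G \<Longrightarrow> N #> x = N \<longleftrightarrow> x \<in> N"
  using coset_join1[of N x] coset_join2[of x N] by auto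

context marked_group
begin

abbreviation R where "R \<equiv> relators A M"

lemma relators_normal: "R \<lhd> free_group A"
  using group_hom.normal_kernel[OF group_hom_word] by (simp add: relators_def)

lemma in_relators_iff: "w \<in> R \<longleftrightarrow> w \<in> carrier (free_group A) \<and> word_val M w = \<one>\<^bsub>G\<^esub>"
  by (simp add: relators_def kernel_def)

lemma freduce_in_relators_iff:
  "set w \<subseteq> letters A \<Longrightarrow> freduce w \<in> R \<longleftrightarrow> word_val M w = \<one>\<^bsub>G\<^esub>"
  by (simp add: in_relators_iff freduce_in_free_group word_val_freduced)

lemma generated_canonical_copy: "generated_group A (canonical_copy A M)"
  unfolding canonical_copy_def by (rule generated_quotient_marked[OF relators_normal])

text \<open>The copy has the same relations, so passing to it changes nothing that is expressed by
  words.\<close>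

lemma word_val_canonical_copy:
  assumes "set w \<subseteq> letters A"
  shows "word_val (canonical_copy A M) w = \<one>\<^bsub>fst (canonical_copy A M)\<^esub> \<longleftrightarrow> word_val M w = \<one>\<^bsub>G\<^esub>"
proof -
  have "word_val (canonical_copy A M) w = \<one>\<^bsub>fst (canonical_copy A M)\<^esub> \<longleftrightarrow>
      R #>\<^bsub>free_group A\<^esub> freduce w = R"
    using word_val_quotient_marked[OF relators_normal assms]
    by (simp add: canonical_copy_def) (simp add: quotient_marked_def)
  also have "\<dots> \<longleftrightarrow> freduce w \<in> R"
    using group.r_coset_eq_self_iff[OF group_free_group] relators_normal freduce_in_free_group[OF assms]
    by (metis normal_imp_subgroup)
  finally show ?thesis
    using freduce_in_relators_iff[OF assms] by simp
qed

lemma finite_canonical_copy: "finite (carrier G) \<Longrightarrow> finite (carrier (fst (canonical_copy A M)))"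
  using canonical_copy_iso[OF generated_pair] bij_betw_finite by (auto simp: iso_def)

lemma flow_free_mult:
  assumes "x \<in> carrier (free_group A)" "y \<in> carrier (free_group A)" "g \<in> carrier G"
  shows "flow M (x \<otimes>\<^bsub>free_group A\<^esub> y) g a = flow M x g a + flow M y (inv\<^bsub>G\<^esub> word_val M x \<otimes>\<^bsub>G\<^esub> g) a"
  using assms flow_freduce[of "x @ y" g a] flow_app[of x g y a] by (auto simp: free_group_def)

lemma flow_free_diff:
  assumes "x \<in> carrier (free_group A)" "y \<in> carrier (free_group A)" "g \<in> carrier G"
    and "word_val M x = word_val M y"
  shows "flow M (x \<otimes>\<^bsub>free_group A\<^esub> inv\<^bsub>free_group A\<^esub> y) g a = flow M x g a - flow M y g a"
proof -
  interpret w: group_hom "free_group A" G "word_val M" by (rule group_hom_word)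
  let ?z = "x \<otimes>\<^bsub>free_group A\<^esub> inv\<^bsub>free_group A\<^esub> y"
  have "flow M (?z \<otimes>\<^bsub>free_group A\<^esub> y) g a = flow M ?z g a + flow M y g a"
    using assms by (subst flow_free_mult) auto
  moreover have "?z \<otimes>\<^bsub>free_group A\<^esub> y = x"
    using assms by (simp add: w.G.m_assoc)
  ultimately show ?thesis by simp
qed

text \<open>On relators the flow is additive, so it vanishes modulo \<open>p\<close> on \<open>R\<^sup>p[R, R]\<close>.\<close>

definition null_flow :: "nat \<Rightarrow> 'a word set" where
  "null_flow p = {w \<in> R. \<forall>g\<in>carrier G. \<forall>a. int p dvd flow M w g a}"

lemma flow_relators:
  assumes "x \<in> R" "y \<in> R" "g \<in> carrier G"
  shows "flow M (x \<otimes>\<^bsub>free_group A\<^esub> y) g a = flow M x g a + flow M y g a"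
    and "flow M (inv\<^bsub>free_group A\<^esub> x) g a = - flow M x g a"
proof -
  interpret w: group_hom "free_group A" G "word_val M" by (rule group_hom_word)
  show "flow M (x \<otimes>\<^bsub>free_group A\<^esub> y) g a = flow M x g a + flow M y g a"
    using assms by (simp add: in_relators_iff flow_free_mult)
  show "flow M (inv\<^bsub>free_group A\<^esub> x) g a = - flow M x g a"
    using assms flow_free_diff[of "\<one>\<^bsub>free_group A\<^esub>" x g a] w.hom_one
    by (simp add: in_relators_iff) (simp add: free_group_def)
qed

lemma subgroup_null_flow: "subgroup (null_flow p) (free_group A)"
proof -
  interpret R: normal R "free_group A" by (rule relators_normal)
  show ?thesis
  proof (intro R.subgroupI)
    show "null_flow p \<subseteq> carrier (free_group A)"
      by (auto simp: null_flow_def in_relators_iff)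
    have "\<one>\<^bsub>free_group A\<^esub> \<in> null_flow p"
      using R.one_closed by (auto simp: null_flow_def) (simp add: free_group_def)
    then show "null_flow p \<noteq> {}" by auto
    show "inv\<^bsub>free_group A\<^esub> x \<in> null_flow p" if "x \<in> null_flow p" for x
      using that by (auto simp: null_flow_def flow_relators)
    show "x \<otimes>\<^bsub>free_group A\<^esub> y \<in> null_flow p" if "x \<in> null_flow p" "y \<in> null_flow p" for x y
      using that by (auto simp: null_flow_def flow_relators)
  qed
qed

text \<open>This is R^p[R,R], the kernel of the map from the free group onto the expansion before
  the center is divided out.\<close>

abbreviation frattini_kernel where
  "frattini_kernel p \<equiv> power_subgroup (free_group A) p R <#>\<^bsub>free_group A\<^esub> derived (free_group A) R"

lemma frattini_kernel_null_flow: "frattini_kernel p \<subseteq> null_flow p"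
proof -
  interpret R: normal R "free_group A" by (rule relators_normal)
  interpret N: subgroup "null_flow p" "free_group A" by (rule subgroup_null_flow)
  let ?F = "free_group A"
  have pow: "x [^]\<^bsub>?F\<^esub> n \<in> R \<and> (\<forall>g\<in>carrier G. \<forall>a. flow M (x [^]\<^bsub>?F\<^esub> n) g a = int n * flow M x g a)"
    if "x \<in> R" for x and n :: nat
  proof (induction n)
    case 0
    then show ?case
      using R.one_closed by auto (simp add: free_group_def)
  next
    case (Suc n)
    then show ?case
      using that by (auto simp: flow_relators algebra_simps)
  qed
  have "power_subgroup ?F p R \<subseteq> null_flow p"
    unfolding power_subgroup_def using pow
    by (intro R.generate_subgroup_incl[OF _ subgroup_null_flow]) (auto simp: null_flow_def)
  moreover have "derived ?F R \<subseteq> null_flow p"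
    unfolding derived_def
    by (intro R.generate_subgroup_incl[OF _ subgroup_null_flow]) (auto simp: null_flow_def flow_relators)
  ultimately show ?thesis
    unfolding set_mult_def by (blast intro: N.m_closed)
qed

text \<open>Conjugates of \<open>p\<close>-th powers of relators are again such powers, and the
  derived subgroup of a normal subgroup is normal.\<close>

lemma frattini_kernel_normal: "frattini_kernel p \<lhd> free_group A"
proof -
  interpret R: normal R "free_group A" by (rule relators_normal)
  let ?F = "free_group A"
  have P: "power_subgroup ?F p R \<lhd> ?F"
    unfolding power_subgroup_def
  proof (rule R.normal_generateI)
    show "(\<lambda>x. x [^]\<^bsub>?F\<^esub> p) ` R \<subseteq> carrier ?F"
      by auto
    fix h g assume h: "h \<in> (\<lambda>x. x [^]\<^bsub>?F\<^esub> p) ` R" and g: "g \<in> carrier ?F"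
    then obtain x where x: "x \<in> R" "h = x [^]\<^bsub>?F\<^esub> p" by auto
    have "g \<otimes>\<^bsub>?F\<^esub> x [^]\<^bsub>?F\<^esub> n \<otimes>\<^bsub>?F\<^esub> inv\<^bsub>?F\<^esub> g = (g \<otimes>\<^bsub>?F\<^esub> x \<otimes>\<^bsub>?F\<^esub> inv\<^bsub>?F\<^esub> g) [^]\<^bsub>?F\<^esub> n" for n :: nat
    proof (induction n)
      case (Suc n)
      have c: "g \<otimes>\<^bsub>?F\<^esub> x \<otimes>\<^bsub>?F\<^esub> inv\<^bsub>?F\<^esub> g \<in> carrier ?F" "x \<in> carrier ?F"
        using x g by auto
      have "(g \<otimes>\<^bsub>?F\<^esub> x \<otimes>\<^bsub>?F\<^esub> inv\<^bsub>?F\<^esub> g) [^]\<^bsub>?F\<^esub> Suc n =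
          g \<otimes>\<^bsub>?F\<^esub> x [^]\<^bsub>?F\<^esub> n \<otimes>\<^bsub>?F\<^esub> inv\<^bsub>?F\<^esub> g \<otimes>\<^bsub>?F\<^esub> (g \<otimes>\<^bsub>?F\<^esub> x \<otimes>\<^bsub>?F\<^esub> inv\<^bsub>?F\<^esub> g)"
        using Suc by simp
      also have "\<dots> = g \<otimes>\<^bsub>?F\<^esub> x [^]\<^bsub>?F\<^esub> n \<otimes>\<^bsub>?F\<^esub> (inv\<^bsub>?F\<^esub> g \<otimes>\<^bsub>?F\<^esub> (g \<otimes>\<^bsub>?F\<^esub> (x \<otimes>\<^bsub>?F\<^esub> inv\<^bsub>?F\<^esub> g)))"
        using c g by (simp add: R.m_assoc)
      also have "inv\<^bsub>?F\<^esub> g \<otimes>\<^bsub>?F\<^esub> (g \<otimes>\<^bsub>?F\<^esub> (x \<otimes>\<^bsub>?F\<^esub> inv\<^bsub>?F\<^esub> g)) = x \<otimes>\<^bsub>?F\<^esub> inv\<^bsub>?F\<^esub> g"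
        using c g by (simp add: R.m_assoc[symmetric])
      finally show ?case
        using c g by (simp add: R.m_assoc)
    qed (use g in simp)
    then show "g \<otimes>\<^bsub>?F\<^esub> h \<otimes>\<^bsub>?F\<^esub> inv\<^bsub>?F\<^esub> g \<in> (\<lambda>x. x [^]\<^bsub>?F\<^esub> p) ` R"
      using x R.inv_op_closed2[OF g] by auto
  qed
  have D: "derived ?F R \<lhd> ?F"
    by (rule R.derived_is_normal[OF relators_normal])
  show ?thesis
    by (rule R.normal_subgroup_set_mult_closed[OF P D])
qed

end

text \<open>Finitely generated abelian groups of finite exponent are finite: a further generator
  \<open>s\<close> contributes at most \<open>p\<close> translates of the subgroup generated before,
  one for each exponent modulo \<open>p\<close>.\<close>

lemma (in group) finite_generate_commuting:
  assumes B: "subgroup B G" and comm: "\<And>x y. x \<in> B \<Longrightarrow> y \<in> B \<Longrightarrow> x \<otimes> y = y \<otimes> x"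
    and p: "p > 0" "\<And>x. x \<in> B \<Longrightarrow> x [^] (p::nat) = \<one>"
    and S: "finite S" "S \<subseteq> B"
  shows "finite (generate G S)"
  using S
proof (induction S)
  case empty
  then show ?case by (simp add: generate_empty)
next
  case (insert s S)
  interpret B: subgroup B G by (rule B)
  let ?C = "generate G S"
  have C: "?C \<subseteq> B" and s: "s \<in> B"
    using generate_subgroup_incl[OF _ B, of S] insert.prems by auto
  have Cs: "subgroup ?C G"
    using insert.prems by (intro generate_is_subgroup) auto
  interpret C: subgroup ?C G by (rule Cs)
  define X where "X = (\<Union>i::nat. (\<lambda>y. s [^] i \<otimes> y) ` ?C)"
  have pow_B: "s [^] i \<in> B" for i :: nat
    using s by (induction i) auto
  have XI: "s [^] i \<otimes> y \<in> X" if "y \<in> ?C" for i :: nat and y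
    using that by (auto simp: X_def)
  \<comment> \<open>Inverses are positive powers as well, so natural exponents suffice in
    \<open>X\<close>.\<close>
  have s_inv: "inv s = s [^] (p - 1)"
    using p s nat_pow_Suc[of s "p - 1"] by (intro inv_equality) auto
  have "generate G (insert s S) \<subseteq> X"
  proof
    fix x assume "x \<in> generate G (insert s S)"
    then show "x \<in> X"
    proof induction
      case one
      then show ?case using XI[of \<one> 0] by simp
    next
      case (incl h)
      then show ?case
        using XI[of \<one> 1] XI[of h 0] s insert.prems by (auto intro: generate.incl)
    next
      case (inv h)
      then show ?case
        using XI[of \<one> "p - 1"] XI[of "inv h" 0] s s_inv insert.prems pow_B by (auto intro: generate.inv)
    next
      case (eng h1 h2)
      then obtain i j :: nat and y z where *: "h1 = s [^] i \<otimes> y" "h2 = s [^] j \<otimes> z" "y \<in> ?C" "z \<in> ?C"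
        by (auto simp: X_def)
      have yz: "y \<in> B" "z \<in> B" using * C by auto
      have "h1 \<otimes> h2 = s [^] i \<otimes> (y \<otimes> s [^] j) \<otimes> z"
        using * yz pow_B by (simp add: m_assoc)
      also have "y \<otimes> s [^] j = s [^] j \<otimes> y"
        using comm yz pow_B by blast
      also have "s [^] i \<otimes> (s [^] j \<otimes> y) \<otimes> z = s [^] (i + j) \<otimes> (y \<otimes> z)"
        using yz pow_B s by (simp add: m_assoc nat_pow_mult[symmetric])
      finally show ?case
        using XI[of "y \<otimes> z" "i + j"] * by simp
    qed
  qed
  moreover have "X \<subseteq> (\<Union>i\<in>{..<p}. (\<lambda>y. s [^] i \<otimes> y) ` ?C)"
  proof -
    have "s [^] i = s [^] (i mod p)" for i :: nat
    proof -
      have "s [^] i = s [^] (p * (i div p)) \<otimes> s [^] (i mod p)"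
        using s by (simp add: nat_pow_mult)
      also have "s [^] (p * (i div p)) = (s [^] p) [^] (i div p)"
        using s by (simp add: nat_pow_pow)
      finally show ?thesis
        using s p by simp
    qed
    then have "s [^] i \<otimes> y \<in> (\<Union>i\<in>{..<p}. (\<lambda>y. s [^] i \<otimes> y) ` ?C)" if "y \<in> ?C" for i :: nat and y
      using that p by (intro UN_I[of "i mod p"]) auto
    then show ?thesis
      unfolding X_def by blast
  qed
  moreover have "finite (\<Union>i\<in>{..<p}. (\<lambda>y. s [^] i \<otimes> y) ` ?C)"
    using insert by auto
  ultimately show ?case
    by (meson finite_subset order_trans)
qed

text \<open>Schreier's argument: choose a section \<open>t\<close> of the map onto
  \<open>M0\<close>. The finitely many kernel elements \<open>s (l, g)\<close> measure how
  \<open>t\<close> fails to respect letters; they generate a finite subgroup, and its translates by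
  the values of \<open>t\<close> exhaust the group.\<close>

lemma (in marked_morphism) finite_of_finite_kernel_exponent:
  assumes fin: "finite A" "finite (carrier (fst M0))"
    and comm: "\<And>x y. x \<in> carrier (fst M1) \<Longrightarrow> y \<in> carrier (fst M1) \<Longrightarrow> \<pi> x = \<one>\<^bsub>fst M0\<^esub> \<Longrightarrow> \<pi> y = \<one>\<^bsub>fst M0\<^esub> \<Longrightarrow>
      x \<otimes>\<^bsub>fst M1\<^esub> y = y \<otimes>\<^bsub>fst M1\<^esub> x"
    and p: "p > 0" "\<And>x. x \<in> carrier (fst M1) \<Longrightarrow> \<pi> x = \<one>\<^bsub>fst M0\<^esub> \<Longrightarrow> x [^]\<^bsub>fst M1\<^esub> (p::nat) = \<one>\<^bsub>fst M1\<^esub>"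
  shows "finite (carrier (fst M1))"
proof -
  let ?E = "fst M1" and ?G = "fst M0"
  define B where "B = {x \<in> carrier ?E. \<pi> x = \<one>\<^bsub>?G\<^esub>}"
  have B: "subgroup B ?E"
    by (intro M1.G.subgroupI) (auto simp: B_def morphism_inv morphism_mult intro: exI[of _ "\<one>\<^bsub>?E\<^esub>"])
  have "\<exists>x. x \<in> carrier ?E \<and> \<pi> x = g" if g: "g \<in> carrier ?G" for g
    using M0.word_val_onto[OF g] morphism_word_val M1.word_val_in by metis
  then obtain t where t: "\<And>g. g \<in> carrier ?G \<Longrightarrow> t g \<in> carrier ?E" "\<And>g. g \<in> carrier ?G \<Longrightarrow> \<pi> (t g) = g"
    by metis
  have fin_letters: "finite (letters A)"
    using fin by (simp add: letters_def)
  define s where "s = (\<lambda>(l, g). inv\<^bsub>?E\<^esub> t (letter_val M0 l \<otimes>\<^bsub>?G\<^esub> g) \<otimes>\<^bsub>?E\<^esub> letter_val M1 l \<otimes>\<^bsub>?E\<^esub> t g)"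
  \<comment> \<open>The section need not send the identity to the identity; the inserted element
    corrects this for the empty word.\<close>
  define S where "S = insert (inv\<^bsub>?E\<^esub> t \<one>\<^bsub>?G\<^esub>) (s ` (letters A \<times> carrier ?G))"
  have "s (l, g) \<in> B" if "l \<in> letters A" "g \<in> carrier ?G" for l g
    using that t M0.letter_val_in[of l] M1.letter_val_in[of l]
    by (simp add: B_def s_def morphism_mult morphism_inv morphism_letter M0.G.m_assoc)
  then have S: "finite S" "S \<subseteq> B"
    using fin fin_letters t by (auto simp: S_def B_def morphism_inv)
  let ?C = "generate ?E S"
  have C_fin: "finite ?C"
    using comm p S by (intro M1.G.finite_generate_commuting[OF B]) (auto simp: B_def)
  interpret C: subgroup ?C ?E
    using S B by (intro M1.G.generate_is_subgroup) (auto simp: B_def)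
  define X where "X = (\<lambda>(g, c). t g \<otimes>\<^bsub>?E\<^esub> c) ` (carrier ?G \<times> ?C)"
  have "word_val M1 w \<in> X" if "set w \<subseteq> letters A" for w
    using that
  proof (induction w)
    case Nil
    have "inv\<^bsub>?E\<^esub> t \<one>\<^bsub>?G\<^esub> \<in> ?C"
      by (auto simp: S_def intro: generate.incl)
    moreover have "t \<one>\<^bsub>?G\<^esub> \<otimes>\<^bsub>?E\<^esub> inv\<^bsub>?E\<^esub> t \<one>\<^bsub>?G\<^esub> = \<one>\<^bsub>?E\<^esub>"
      using t by simp
    ultimately show ?case
      unfolding X_def by (force intro: rev_image_eqI[of "(\<one>\<^bsub>?G\<^esub>, inv\<^bsub>?E\<^esub> t \<one>\<^bsub>?G\<^esub>)"])
  next
    case (Cons l w)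
    then obtain g c where gc: "g \<in> carrier ?G" "c \<in> ?C" "word_val M1 w = t g \<otimes>\<^bsub>?E\<^esub> c"
      by (auto simp: X_def)
    have l: "l \<in> letters A" "letter_val M1 l \<in> carrier ?E" "letter_val M0 l \<in> carrier ?G"
      using Cons.prems M0.letter_val_in M1.letter_val_in by auto
    have "s (l, g) \<in> ?C"
      using l gc by (auto simp: S_def intro!: generate.incl)
    then have c': "s (l, g) \<otimes>\<^bsub>?E\<^esub> c \<in> ?C"
      using gc by auto
    \<comment> \<open>A letter is moved past the section at the cost of one Schreier
      generator.\<close>
    have eq: "word_val M1 (l # w) = t (letter_val M0 l \<otimes>\<^bsub>?G\<^esub> g) \<otimes>\<^bsub>?E\<^esub> (s (l, g) \<otimes>\<^bsub>?E\<^esub> c)"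
      using l gc t by (simp add: s_def M1.G.m_assoc) (simp add: M1.G.m_assoc[symmetric])
    have "(letter_val M0 l \<otimes>\<^bsub>?G\<^esub> g, s (l, g) \<otimes>\<^bsub>?E\<^esub> c) \<in> carrier ?G \<times> ?C"
      using l gc c' by simp
    then show ?case
      unfolding X_def by (rule rev_image_eqI) (simp only: eq prod.case)
  qed
  then have "carrier ?E \<subseteq> X"
    by (auto elim!: M1.word_val_onto)
  moreover have "finite X"
    using fin C_fin by (simp add: X_def)
  ultimately show ?thesis
    by (rule finite_subset)
qed

lemma (in group) r_coset_eq_iff:
  assumes "subgroup N G" "x \<in> carrier G" "y \<in> carrier G"
  shows "N #> x = N #> y \<longleftrightarrow> x \<otimes> inv y \<in> N"
  using subgroup.rcos_module[OF assms(1) group_axioms assms(3,2)] rcos_self[OF assms(2,1)]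
    repr_independence[OF _ assms(3,1), of x] by auto

lemma (in group) group_center_normal: "group_center G \<lhd> G"
  unfolding normal_inv_iff
proof (intro conjI ballI)
  have in_G: "z \<in> carrier G" if "z \<in> group_center G" for z
    using that unfolding group_center_def by blast
  show "subgroup (group_center G) G"
  proof (rule subgroupI)
    show "group_center G \<subseteq> carrier G" "group_center G \<noteq> {}"
      by (auto simp: group_center_def)
    fix a assume a: "a \<in> group_center G"
    show "inv a \<in> group_center G"
      unfolding group_center_def
    proof (intro CollectI conjI ballI)
      fix x assume x: "x \<in> carrier G"
      have ac: "a \<in> carrier G" "a \<otimes> x = x \<otimes> a"
        using a x by (auto simp: group_center_def)
      have "inv a \<otimes> x = inv a \<otimes> (x \<otimes> a) \<otimes> inv a"
        using ac x by (simp add: m_assoc)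
      also have "\<dots> = inv a \<otimes> (a \<otimes> x) \<otimes> inv a"
        by (simp add: ac)
      also have "\<dots> = x \<otimes> inv a"
        using ac(1) x by (simp add: m_assoc[symmetric])
      finally show "inv a \<otimes> x = x \<otimes> inv a" .
    qed (use in_G[OF a] in simp)
    fix b assume b: "b \<in> group_center G"
    show "a \<otimes> b \<in> group_center G"
      unfolding group_center_def
    proof (intro CollectI conjI ballI)
      fix x assume x: "x \<in> carrier G"
      have abx: "a \<in> carrier G" "b \<in> carrier G" "a \<otimes> x = x \<otimes> a" "b \<otimes> x = x \<otimes> b"
        using a b x by (auto simp: group_center_def)
      have "a \<otimes> b \<otimes> x = a \<otimes> x \<otimes> b"
        using abx(1,2) x by (simp add: m_assoc abx(4))
      then show "a \<otimes> b \<otimes> x = x \<otimes> (a \<otimes> b)"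
        using abx(1,2) x by (simp add: m_assoc abx(3))
    qed (use in_G[OF a] in_G[OF b] in simp)
  qed
  fix x h assume x: "x \<in> carrier G" and h: "h \<in> group_center G"
  then have xh: "h \<in> carrier G" "x \<otimes> h = h \<otimes> x"
    by (auto simp: group_center_def)
  then have "x \<otimes> h \<otimes> inv x = h"
    using x by (simp add: m_assoc)
  then show "x \<otimes> h \<otimes> inv x \<in> group_center G"
    using h by simp
qed

context marked_group
begin

lemma Zp_expansion_eq: "Zp_expansion A p M = quotient_marked A (frattini_kernel p)"
  by (simp add: Zp_expansion_def Let_def)

lemma generated_Zp_expansion: "generated_group A (Zp_expansion A p M)"
  unfolding Zp_expansion_eq by (rule generated_quotient_marked[OF frattini_kernel_normal])

lemma word_val_Zp_expansion:
  "set w \<subseteq> letters A \<Longrightarrow> word_val (Zp_expansion A p M) w = frattini_kernel p #>\<^bsub>free_group A\<^esub> freduce w"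
  unfolding Zp_expansion_eq by (rule word_val_quotient_marked[OF frattini_kernel_normal])

lemma fst_Zp_expansion: "fst (Zp_expansion A p M) = free_group A Mod frattini_kernel p"
  by (simp add: Zp_expansion_eq quotient_marked_def)

lemma Zp_expansion_one_null_flow:
  assumes "set w \<subseteq> letters A" "word_val (Zp_expansion A p M) w = \<one>\<^bsub>fst (Zp_expansion A p M)\<^esub>"
  shows "freduce w \<in> null_flow p"
proof -
  have "freduce w \<in> frattini_kernel p"
    using assms group.r_coset_eq_self_iff[OF group_free_group normal_imp_subgroup[OF frattini_kernel_normal]]
    by (simp add: word_val_Zp_expansion fst_Zp_expansion freduce_in_free_group)
  then show ?thesis
    using frattini_kernel_null_flow by blast
qed

lemma Zp_expansion_morphism: "marked_morphism A (Zp_expansion A p M) M"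
proof (intro marked_morphism.intro marked_morphism_axioms.intro)
  show "marked_group A (Zp_expansion A p M)"
    by unfold_locales (rule generated_Zp_expansion)
  show "marked_group A M"
    by (rule marked_group_axioms)
  show "word_val M w = \<one>\<^bsub>G\<^esub>"
    if "set w \<subseteq> letters A" "word_val (Zp_expansion A p M) w = \<one>\<^bsub>fst (Zp_expansion A p M)\<^esub>" for w
    using Zp_expansion_one_null_flow[OF that] that
    by (simp add: null_flow_def freduce_in_relators_iff)
qed

text \<open>The closed path formed from \<open>u\<close> and the reversed \<open>v\<close> lies in
  R^p[R,R] up to reduction. So the flow modulo \<open>p\<close> is a function on the
  expansion.\<close>

lemma Zp_expansion_flow:
  assumes "set u \<subseteq> letters A" "set v \<subseteq> letters A"
    and "word_val (Zp_expansion A p M) u = word_val (Zp_expansion A p M) v" and "g \<in> carrier G"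
  shows "int p dvd flow M u g a - flow M v g a"
proof -
  interpret E: marked_morphism A "Zp_expansion A p M" M
    by (rule Zp_expansion_morphism)
  have v: "set (winv v) \<subseteq> letters A"
    by (rule winv_letters[OF assms(2)])
  have "word_val (Zp_expansion A p M) (u @ winv v) = \<one>\<^bsub>fst (Zp_expansion A p M)\<^esub>"
    using assms v E.M1.word_val_in[of v] by (simp add: E.M1.word_val_app E.M1.word_val_winv)
  then have "int p dvd flow M (freduce (u @ winv v)) g a"
    using Zp_expansion_one_null_flow[of "u @ winv v" p] assms v by (auto simp: null_flow_def)
  then show ?thesis
    using assms v E.refines_eq[of u v] by (simp add: flow_freduce flow_diff)
qed

text \<open>The kernel of the map onto \<open>G\<close> is the quotient of R by R^p[R,R], in which
  elements commute and have trivial \<open>p\<close>-th powers.\<close>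

lemma finite_Zp_expansion:
  assumes fin: "finite A" "finite (carrier G)" and p: "p > 0"
  shows "finite (carrier (fst (Zp_expansion A p M)))"
proof -
  interpret E: marked_morphism A "Zp_expansion A p M" M
    by (rule Zp_expansion_morphism)
  let ?F = "free_group A" and ?E = "fst (Zp_expansion A p M)" and ?K = "frattini_kernel p"
  interpret R: normal R ?F by (rule relators_normal)
  interpret h: group_hom ?F ?E "\<lambda>x. ?K #>\<^bsub>?F\<^esub> x"
    unfolding fst_Zp_expansion by (rule group_hom_r_coset[OF frattini_kernel_normal])
  have K: "subgroup ?K ?F"
    by (rule normal_imp_subgroup[OF frattini_kernel_normal])
  have in_K: "u \<otimes>\<^bsub>?F\<^esub> v \<in> ?K" if "u \<in> power_subgroup ?F p R" "v \<in> derived ?F R" for u v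
    using that by (auto simp: set_mult_def)
  have rep: "\<exists>u\<in>R. x = ?K #>\<^bsub>?F\<^esub> u" if x: "x \<in> carrier ?E" "E.\<pi> x = \<one>\<^bsub>G\<^esub>" for x
  proof -
    obtain w where w: "set w \<subseteq> letters A" "word_val (Zp_expansion A p M) w = x"
      using E.M1.word_val_onto[OF x(1)] .
    then have "freduce w \<in> R"
      using x E.morphism_word_val[OF w(1)] by (simp add: freduce_in_relators_iff)
    then show ?thesis
      using w word_val_Zp_expansion by auto
  qed
  show ?thesis
  proof (rule E.finite_of_finite_kernel_exponent[OF fin _ p])
    fix x y assume "x \<in> carrier ?E" "y \<in> carrier ?E" "E.\<pi> x = \<one>\<^bsub>G\<^esub>" "E.\<pi> y = \<one>\<^bsub>G\<^esub>"
    then obtain u v where uv: "u \<in> R" "v \<in> R" "x = ?K #>\<^bsub>?F\<^esub> u" "y = ?K #>\<^bsub>?F\<^esub> v"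
      using rep by metis
    have "(u \<otimes>\<^bsub>?F\<^esub> v) \<otimes>\<^bsub>?F\<^esub> inv\<^bsub>?F\<^esub> (v \<otimes>\<^bsub>?F\<^esub> u) = u \<otimes>\<^bsub>?F\<^esub> v \<otimes>\<^bsub>?F\<^esub> inv\<^bsub>?F\<^esub> u \<otimes>\<^bsub>?F\<^esub> inv\<^bsub>?F\<^esub> v"
      using uv by (simp add: R.inv_mult_group R.m_assoc)
    also have "\<dots> \<in> derived ?F R"
      unfolding derived_def using uv by (intro generate.incl) auto
    finally have "(u \<otimes>\<^bsub>?F\<^esub> v) \<otimes>\<^bsub>?F\<^esub> inv\<^bsub>?F\<^esub> (v \<otimes>\<^bsub>?F\<^esub> u) \<in> ?K"
      using in_K[of "\<one>\<^bsub>?F\<^esub>" "(u \<otimes>\<^bsub>?F\<^esub> v) \<otimes>\<^bsub>?F\<^esub> inv\<^bsub>?F\<^esub> (v \<otimes>\<^bsub>?F\<^esub> u)"] uv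
      by (simp add: power_subgroup_def generate.one)
    then have "?K #>\<^bsub>?F\<^esub> (u \<otimes>\<^bsub>?F\<^esub> v) = ?K #>\<^bsub>?F\<^esub> (v \<otimes>\<^bsub>?F\<^esub> u)"
      using uv by (subst R.r_coset_eq_iff[OF K]) auto
    then show "x \<otimes>\<^bsub>?E\<^esub> y = y \<otimes>\<^bsub>?E\<^esub> x"
      using uv h.hom_mult by simp
  next
    fix x assume "x \<in> carrier ?E" "E.\<pi> x = \<one>\<^bsub>G\<^esub>"
    then obtain u where u: "u \<in> R" "x = ?K #>\<^bsub>?F\<^esub> u"
      using rep by metis
    have "u [^]\<^bsub>?F\<^esub> p \<in> power_subgroup ?F p R"
      unfolding power_subgroup_def using u by (intro generate.incl) auto
    then have "u [^]\<^bsub>?F\<^esub> p \<in> ?K"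
      using in_K[of "u [^]\<^bsub>?F\<^esub> p" "\<one>\<^bsub>?F\<^esub>"] u by (simp add: derived_def generate.one)
    then have "?K #>\<^bsub>?F\<^esub> (u [^]\<^bsub>?F\<^esub> p) = \<one>\<^bsub>?E\<^esub>"
      using u by (simp add: R.r_coset_eq_self_iff[OF K] fst_Zp_expansion)
    then show "x [^]\<^bsub>?E\<^esub> p = \<one>\<^bsub>?E\<^esub>"
      using u h.hom_nat_pow[of u p] by simp
  qed
qed

lemma
  fixes p :: nat
  defines "E \<equiv> fst (Zp_expansion A p M)"
  shows generated_Zp_tilde_expansion: "generated_group A (Zp_tilde_expansion A p M)"
    and word_val_Zp_tilde_expansion_one: "set w \<subseteq> letters A \<Longrightarrow>
      word_val (Zp_tilde_expansion A p M) w = \<one>\<^bsub>fst (Zp_tilde_expansion A p M)\<^esub> \<longleftrightarrow>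
      word_val (Zp_expansion A p M) w \<in> group_center E"
    and finite_Zp_tilde_expansion: "finite A \<Longrightarrow> finite (carrier G) \<Longrightarrow> p > 0 \<Longrightarrow>
      finite (carrier (fst (Zp_tilde_expansion A p M)))"
proof -
  interpret E: marked_group A "Zp_expansion A p M"
    by unfold_locales (rule generated_Zp_expansion)
  let ?h = "\<lambda>x. group_center E #>\<^bsub>E\<^esub> x"
  have eq: "Zp_tilde_expansion A p M = (E Mod group_center E, \<lambda>a. ?h (snd (Zp_expansion A p M) a))"
    by (simp add: Zp_tilde_expansion_def E_def split_def Let_def)
  have Z: "group_center E \<lhd> E"
    unfolding E_def by (rule E.G.group_center_normal)
  have h: "group_hom E (E Mod group_center E) ?h" "?h ` carrier E = carrier (E Mod group_center E)"
    using group_hom_r_coset[OF Z] by (auto simp: carrier_FactGroup)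
  show "generated_group A (Zp_tilde_expansion A p M)"
    unfolding eq using E.generated_image(1) h by (simp add: E_def)
  show "word_val (Zp_tilde_expansion A p M) w = \<one>\<^bsub>fst (Zp_tilde_expansion A p M)\<^esub> \<longleftrightarrow>
      word_val (Zp_expansion A p M) w \<in> group_center E" if w: "set w \<subseteq> letters A"
    unfolding eq using E.generated_image(2)[OF h(1)[unfolded E_def] h(2)[unfolded E_def] w]
      E.G.r_coset_eq_self_iff[OF normal_imp_subgroup[OF Z[unfolded E_def]] E.word_val_in[OF w]]
    by (simp add: E_def)
  show "finite (carrier (fst (Zp_tilde_expansion A p M)))"
    if "finite A" "finite (carrier G)" "p > 0"
    using finite_Zp_expansion[OF that] by (simp add: eq E_def carrier_FactGroup)
qed

text \<open>If \<open>w\<close> is central in the expansion, \<open>w @ v\<close> and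
  \<open>v @ w\<close> have the same flow modulo \<open>p\<close> for every \<open>v\<close>. For
  closed \<open>v\<close> this makes cycle flows invariant under the value of \<open>w\<close>,
  which is therefore 1. For arbitrary \<open>v\<close> it then makes the flow of \<open>w\<close>
  invariant under all translations.\<close>

lemma Zp_tilde_expansion_step:
  assumes fin: "finite A" "finite (carrier G)" and card: "card A \<ge> 2" and p: "prime p"
  shows "expansion_step A (canonical_copy A (Zp_tilde_expansion A p M)) M (int p)"
proof -
  let ?T = "Zp_tilde_expansion A p M" and ?E = "Zp_expansion A p M"
  interpret T: marked_group A ?T
    by unfold_locales (rule generated_Zp_tilde_expansion)
  interpret E: marked_morphism A ?E M
    by (rule Zp_expansion_morphism)
  have p1: "int p > 1"
    using prime_gt_1_nat[OF p] by simp
  obtain a b where ab: "a \<in> A" "b \<in> A" "a \<noteq> b"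
    using card by (metis card_2_iff' card_le_Suc0_iff_eq fin(1) not_less_eq_eq numeral_2_eq_2)
  have one_iff: "word_val (canonical_copy A ?T) w = \<one>\<^bsub>fst (canonical_copy A ?T)\<^esub> \<longleftrightarrow>
    word_val ?E w \<in> group_center (fst ?E)" if "set w \<subseteq> letters A" for w
    using that by (simp add: T.word_val_canonical_copy word_val_Zp_tilde_expansion_one)
  have commute: "int p dvd flow M w g c + flow M v (inv\<^bsub>G\<^esub> word_val M w \<otimes>\<^bsub>G\<^esub> g) c
      - (flow M v g c + flow M w (inv\<^bsub>G\<^esub> word_val M v \<otimes>\<^bsub>G\<^esub> g) c)"
    if "set w \<subseteq> letters A" "word_val ?E w \<in> group_center (fst ?E)" "set v \<subseteq> letters A" "g \<in> carrier G"
    for w v g c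
  proof -
    have "word_val ?E (w @ v) = word_val ?E (v @ w)"
      using that E.M1.word_val_in[of v] by (simp add: E.M1.word_val_app group_center_def)
    then have "int p dvd flow M (w @ v) g c - flow M (v @ w) g c"
      using that by (intro Zp_expansion_flow) auto
    then show ?thesis
      using that by (simp add: flow_app)
  qed
  \<comment> \<open>In other words, central elements of the expansion map to the identity of
    \<open>G\<close>.\<close>
  have refines: "word_val M w = \<one>\<^bsub>G\<^esub>"
    if w: "set w \<subseteq> letters A" "word_val ?E w \<in> group_center (fst ?E)" for w
  proof (rule invariant_cycles_imp_one[OF fin(2) ab word_val_in[OF w(1)] p1])
    fix v g c assume "set v \<subseteq> letters A" "word_val M v = \<one>\<^bsub>G\<^esub>" "g \<in> carrier G"
    then show "int p dvd flow M v (inv\<^bsub>G\<^esub> word_val M w \<otimes>\<^bsub>G\<^esub> g) c - flow M v g c"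
      using commute[OF w, of v g c] by simp
  qed
  show ?thesis
  proof (intro expansion_step.intro marked_morphism.intro marked_morphism_axioms.intro
      expansion_step_axioms.intro)
    show "marked_group A (canonical_copy A ?T)"
      by unfold_locales (rule T.generated_canonical_copy)
    show "marked_group A M" by (rule marked_group_axioms)
    show "1 < int p" by (rule p1)
    fix w assume w: "set w \<subseteq> letters A" "word_val (canonical_copy A ?T) w = \<one>\<^bsub>fst (canonical_copy A ?T)\<^esub>"
    then have wZ: "word_val ?E w \<in> group_center (fst ?E)"
      by (simp add: one_iff)
    show one: "word_val M w = \<one>\<^bsub>G\<^esub>"
      by (rule refines[OF w(1) wZ])
    fix x y c assume xy: "x \<in> carrier G" "y \<in> carrier G" and "c \<in> A"
    \<comment> \<open>This \<open>v\<close> is chosen so that translating by the inverse of its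
      value takes \<open>x\<close> to \<open>y\<close>.\<close>
    obtain v where v: "set v \<subseteq> letters A" "word_val M v = x \<otimes>\<^bsub>G\<^esub> inv\<^bsub>G\<^esub> y"
      using xy word_val_onto[of "x \<otimes>\<^bsub>G\<^esub> inv\<^bsub>G\<^esub> y"] by auto
    have "inv\<^bsub>G\<^esub> word_val M v \<otimes>\<^bsub>G\<^esub> x = y"
      using xy v by (simp add: G.inv_mult_group G.m_assoc)
    then show "int p dvd flow M w x c - flow M w y c"
      using commute[OF w(1) wZ v(1) xy(1), of c] one xy by simp
  qed
qed

end


section \<open>Open, closed and compact sets of threads and edges\<close>

section \<open>The topology of the limit\<close>

locale marked_tower =
  fixes A :: "'a set" and M :: "nat \<Rightarrow> ('a, 'g) marked"
  assumes finite_letters: "finite A"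
    and tower_step: "\<And>n. marked_morphism A (M (Suc n)) (M n)"
    and finite_level: "\<And>n. finite (carrier (fst (M n)))"
begin

sublocale level: marked_group A "M n" for n
  using tower_step[of n] by (simp add: marked_morphism_def)

sublocale step: marked_morphism A "M (Suc n)" "M n" for n
  by (rule tower_step)

abbreviation limit where "limit \<equiv> limit_marked A M"
abbreviation limit_top where "limit_top \<equiv> limit_topology A M"
abbreviation \<T> where "\<T> \<equiv> threads A M"

lemma thread_in: "x \<in> \<T> \<Longrightarrow> x n \<in> carrier (fst (M n))"
  by (auto simp: threads_def)

lemma thread_step: "x \<in> \<T> \<Longrightarrow> canonical_morphism A (M (Suc n)) (M n) (x (Suc n)) = x n"
  by (simp add: threads_def)

lemma threadI:
  assumes "\<And>n. x n \<in> carrier (fst (M n))"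
    and "\<And>n. canonical_morphism A (M (Suc n)) (M n) (x (Suc n)) = x n"
  shows "x \<in> \<T>"
  using assms by (auto simp: threads_def)

lemma thread_eq_below: "x \<in> \<T> \<Longrightarrow> y \<in> \<T> \<Longrightarrow> x m = y m \<Longrightarrow> n \<le> m \<Longrightarrow> x n = y n"
proof (induction m)
  case (Suc m)
  have "x m = y m"
    using Suc.prems thread_step by metis
  then show ?case
    using Suc by (cases "n = Suc m") auto
qed simp

text \<open>Words yield threads through every element of a level, so lifting to the limit takes no
  compactness.\<close>

lemma word_thread: "set w \<subseteq> letters A \<Longrightarrow> (\<lambda>n. word_val (M n) w) \<in> \<T>"
  by (intro threadI level.word_val_in step.morphism_word_val)

lemma word_val_eq_below:
  assumes "set u \<subseteq> letters A" "set v \<subseteq> letters A" "word_val (M m) u = word_val (M m) v" "n \<le> m"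
  shows "word_val (M n) u = word_val (M n) v"
  using thread_eq_below[OF word_thread[OF assms(1)] word_thread[OF assms(2)] assms(3,4)] .

lemma thread_word:
  assumes "x \<in> \<T>"
  obtains w where "set w \<subseteq> letters A" "word_val (M n) w = x n"
  using level.word_val_onto[OF thread_in[OF assms]] by metis

lemma thread_onto:
  assumes "h \<in> carrier (fst (M n))"
  obtains x where "x \<in> \<T>" "x n = h"
  using level.word_val_onto[OF assms] word_thread by metis

lemma letter_thread: "l \<in> letters A \<Longrightarrow> (\<lambda>n. letter_val (M n) l) \<in> \<T>"
  by (intro threadI level.letter_val_in step.morphism_letter)

lemma thread_mult: "x \<in> \<T> \<Longrightarrow> y \<in> \<T> \<Longrightarrow> (\<lambda>n. x n \<otimes>\<^bsub>fst (M n)\<^esub> y n) \<in> \<T>"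
  by (intro threadI) (auto simp: thread_in thread_step step.morphism_mult)

lemma thread_inv: "x \<in> \<T> \<Longrightarrow> (\<lambda>n. inv\<^bsub>fst (M n)\<^esub> x n) \<in> \<T>"
  by (intro threadI) (auto simp: thread_in thread_step step.morphism_inv)

lemma carrier_limit [simp]: "carrier (fst limit) = \<T>"
  by (simp add: limit_marked_def)

lemma mult_limit [simp]: "x \<otimes>\<^bsub>fst limit\<^esub> y = (\<lambda>n. x n \<otimes>\<^bsub>fst (M n)\<^esub> y n)"
  by (simp add: limit_marked_def restrict_def)

text \<open>For a negative letter the inverse is formed in the product group with its carrier cut
  down to the threads. It agrees with the coordinatewise inverse because the threads form a
  subgroup.\<close>

lemma letter_val_limit:
  assumes "l \<in> letters A"
  shows "letter_val limit l = (\<lambda>n. letter_val (M n) l)"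
proof -
  let ?P = "product_group UNIV (\<lambda>n. fst (M n))"
  interpret P: group ?P
    by (rule product_group) (rule level.G.is_group)
  have T: "subgroup \<T> ?P"
  proof (rule P.subgroupI)
    show "\<T> \<subseteq> carrier ?P"
      by (auto simp: threads_def)
    show "\<T> \<noteq> {}"
      using word_thread[of "[]"] by auto
    show "inv\<^bsub>?P\<^esub> x \<in> \<T>" if "x \<in> \<T>" for x
      using that thread_inv[OF that] thread_in[OF that]
      by (subst inv_product_group) (auto simp: PiE_iff level.G.is_group restrict_def)
    show "x \<otimes>\<^bsub>?P\<^esub> y \<in> \<T>" if "x \<in> \<T>" "y \<in> \<T>" for x y
      using thread_mult[OF that] by (simp add: restrict_def)
  qed
  obtain a s where l: "l = (a, s)" by (cases l)
  have a: "(\<lambda>n. snd (M n) a) \<in> \<T>"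
    using letter_thread[of "(a, True)"] assms l by (simp add: letters_def level.letter_val_pos)
  show ?thesis
  proof (cases s)
    case True
    then show ?thesis
      by (simp add: l level.letter_val_pos) (simp add: letter_val_def limit_marked_def)
  next
    case False
    have "inv\<^bsub>?P\<lparr>carrier := \<T>\<rparr>\<^esub> (\<lambda>n. snd (M n) a) = inv\<^bsub>?P\<^esub> (\<lambda>n. snd (M n) a)"
      by (rule P.m_inv_consistent[OF T a])
    also have "\<dots> = (\<lambda>n. inv\<^bsub>fst (M n)\<^esub> snd (M n) a)"
      using thread_in[OF a]
      by (subst inv_product_group) (auto simp: PiE_iff level.G.is_group restrict_def)
    finally show ?thesis
      using False by (simp add: l level.letter_val_neg) (simp add: letter_val_def limit_marked_def)
  qed
qed

definition cylinder :: "nat \<Rightarrow> 'g \<Rightarrow> (nat \<Rightarrow> 'g) set" where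
  "cylinder n h = {y \<in> \<T>. y n = h}"

abbreviation prod_top where
  "prod_top \<equiv> product_topology (\<lambda>n. discrete_topology (carrier (fst (M n)))) (UNIV :: nat set)"

lemma openin_prod_top_coordinate: "openin prod_top {y \<in> topspace prod_top. y n = h}"
proof (cases "h \<in> carrier (fst (M n))")
  case True
  have "openin prod_top {y \<in> topspace prod_top. y n \<in> {h}}"
    using True
    by (intro openin_continuous_map_preimage[where Y = "discrete_topology (carrier (fst (M n)))"])
      (auto intro: continuous_map_product_projection)
  then show ?thesis by simp
next
  case False
  then have "{y \<in> topspace prod_top. y n = h} = {}"
    by (auto simp: PiE_iff)
  then show ?thesis
    by (metis openin_empty)
qed

lemma threads_subset_topspace: "\<T> \<subseteq> topspace prod_top"
  by (auto simp: threads_def)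

lemma topspace_limit [simp]: "topspace limit_top = \<T>"
  using threads_subset_topspace by (auto simp: limit_topology_def)

lemma openin_cylinder: "openin limit_top (cylinder n h)"
proof -
  have "cylinder n h = {y \<in> topspace prod_top. y n = h} \<inter> \<T>"
    using threads_subset_topspace by (auto simp: cylinder_def)
  then show ?thesis
    unfolding limit_topology_def
    by (simp only: openin_subtopology_Int[OF openin_prod_top_coordinate])
qed

text \<open>A basic open set restricts finitely many coordinates, and in a thread the highest of
  these determines the others; so one level suffices.\<close>

lemma openin_limit_iff:
  "openin limit_top U \<longleftrightarrow> U \<subseteq> \<T> \<and> (\<forall>x\<in>U. \<exists>n. \<forall>y\<in>\<T>. y n = x n \<longrightarrow> y \<in> U)"
proof (intro iffI conjI ballI)
  assume U: "openin limit_top U"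
  then show "U \<subseteq> \<T>"
    using openin_subset by fastforce
  fix x assume x: "x \<in> U"
  obtain W where W: "openin prod_top W" "U = W \<inter> \<T>"
    using U by (auto simp: limit_topology_def openin_subtopology)
  then obtain B where B: "finite {i. B i \<noteq> carrier (fst (M i))}" "x \<in> PiE UNIV B" "PiE UNIV B \<subseteq> W"
    using x unfolding openin_product_topology_alt by fastforce
  obtain N where N: "\<And>i. B i \<noteq> carrier (fst (M i)) \<Longrightarrow> i \<le> N"
    using B(1) by (metis (mono_tags, lifting) finite_nat_set_iff_bounded_le mem_Collect_eq)
  have "y \<in> U" if y: "y \<in> \<T>" "y N = x N" for y
  proof -
    have "y i \<in> B i" for i
    proof (cases "B i = carrier (fst (M i))")
      case True
      then show ?thesis using thread_in[OF y(1)] by simp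
    next
      case False
      then have "y i = x i"
        using N thread_eq_below[of y x N i] y x W by auto
      then show ?thesis using B(2) by auto
    qed
    then have "y \<in> PiE UNIV B"
      by auto
    then show ?thesis
      using B(3) W y by auto
  qed
  then show "\<exists>n. \<forall>y\<in>\<T>. y n = x n \<longrightarrow> y \<in> U"
    by blast
next
  assume U: "U \<subseteq> \<T> \<and> (\<forall>x\<in>U. \<exists>n. \<forall>y\<in>\<T>. y n = x n \<longrightarrow> y \<in> U)"
  show "openin limit_top U"
  proof (subst openin_subopen, intro ballI)
    fix x assume x: "x \<in> U"
    then obtain n where n: "\<forall>y\<in>\<T>. y n = x n \<longrightarrow> y \<in> U"
      using U by blast
    then show "\<exists>T. openin limit_top T \<and> x \<in> T \<and> T \<subseteq> U"
      using U x openin_cylinder by (intro exI[of _ "cylinder n (x n)"]) (auto simp: cylinder_def)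
  qed
qed

lemma closedin_limit_iff:
  "closedin limit_top V \<longleftrightarrow> V \<subseteq> \<T> \<and> (\<forall>x\<in>\<T>. (\<forall>n. \<exists>y\<in>V. y n = x n) \<longrightarrow> x \<in> V)"
proof -
  have "closedin limit_top V \<longleftrightarrow> V \<subseteq> \<T> \<and> (\<forall>x\<in>\<T> - V. \<exists>n. \<forall>y\<in>\<T>. y n = x n \<longrightarrow> y \<in> \<T> - V)"
    unfolding closedin_def openin_limit_iff topspace_limit by simp
  also have "\<dots> \<longleftrightarrow> V \<subseteq> \<T> \<and> (\<forall>x\<in>\<T> - V. \<not> (\<forall>n. \<exists>y\<in>V. y n = x n))"
    by (intro conj_cong ball_cong refl) auto
  also have "\<dots> \<longleftrightarrow> V \<subseteq> \<T> \<and> (\<forall>x\<in>\<T>. (\<forall>n. \<exists>y\<in>V. y n = x n) \<longrightarrow> x \<in> V)"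
    by (intro conj_cong refl) (simp only: Ball_def Diff_iff, meson)
  finally show ?thesis .
qed

text \<open>Violating one bonding condition depends on two coordinates only and so is open. The
  threads are thus closed in a product of finite discrete spaces.\<close>

lemma compact_space_limit: "compact_space limit_top"
proof -
  have bad: "openin prod_top {x \<in> topspace prod_top. canonical_morphism A (M (Suc n)) (M n) (x (Suc n)) \<noteq> x n}"
    (is "openin _ ?B") for n
  proof (subst openin_subopen, intro ballI)
    fix x assume x: "x \<in> ?B"
    have "openin prod_top ({y \<in> topspace prod_top. y n = x n} \<inter> {y \<in> topspace prod_top. y (Suc n) = x (Suc n)})"
      by (intro openin_Int openin_prod_top_coordinate)
    then show "\<exists>T. openin prod_top T \<and> x \<in> T \<and> T \<subseteq> ?B"
      by (intro exI conjI) (use x in auto)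
  qed
  have "topspace prod_top - \<T> =
    (\<Union>n. {x \<in> topspace prod_top. canonical_morphism A (M (Suc n)) (M n) (x (Suc n)) \<noteq> x n})"
    by (auto simp: threads_def)
  moreover have "openin prod_top \<dots>"
    using bad by (intro openin_Union) auto
  ultimately have "closedin prod_top \<T>"
    using threads_subset_topspace by (simp add: closedin_def)
  moreover have "compact_space prod_top"
    using finite_level by (simp add: compact_space_product_topology compact_space_discrete_topology)
  ultimately show ?thesis
    unfolding limit_topology_def by (intro compact_space_subtopology closedin_compact_space)
qed

definition edge_top :: "((nat \<Rightarrow> 'g) \<times> 'a letter) topology" where
  "edge_top = prod_topology limit_top (discrete_topology (letters A))"

lemma topspace_edge_top [simp]: "topspace edge_top = \<T> \<times> letters A"
  by (simp add: edge_top_def)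

lemma compact_space_edge_top: "compact_space edge_top"
  using compact_space_limit finite_letters
  by (simp add: edge_top_def compact_space_prod_topology compact_space_discrete_topology letters_def)

lemma openin_edge_top_iff:
  "openin edge_top U \<longleftrightarrow> U \<subseteq> \<T> \<times> letters A \<and>
    (\<forall>(x, l)\<in>U. \<exists>n. \<forall>y\<in>\<T>. y n = x n \<longrightarrow> (y, l) \<in> U)"
proof (intro iffI conjI)
  assume U: "openin edge_top U"
  then show "U \<subseteq> \<T> \<times> letters A"
    using openin_subset by fastforce
  show "\<forall>(x, l)\<in>U. \<exists>n. \<forall>y\<in>\<T>. y n = x n \<longrightarrow> (y, l) \<in> U"
  proof clarify
    fix x l assume "(x, l) \<in> U"
    then obtain V W where VW: "openin limit_top V" "x \<in> V" "l \<in> W" "V \<times> W \<subseteq> U"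
      using U unfolding edge_top_def openin_prod_topology_alt by metis
    then obtain n where "\<forall>y\<in>\<T>. y n = x n \<longrightarrow> y \<in> V"
      by (auto simp: openin_limit_iff)
    then show "\<exists>n. \<forall>y\<in>\<T>. y n = x n \<longrightarrow> (y, l) \<in> U"
      using VW by blast
  qed
next
  assume U: "U \<subseteq> \<T> \<times> letters A \<and> (\<forall>(x, l)\<in>U. \<exists>n. \<forall>y\<in>\<T>. y n = x n \<longrightarrow> (y, l) \<in> U)"
  show "openin edge_top U"
    unfolding edge_top_def openin_prod_topology_alt
  proof (intro allI impI)
    fix x l assume xl: "(x, l) \<in> U"
    then obtain n where n: "\<forall>y\<in>\<T>. y n = x n \<longrightarrow> (y, l) \<in> U"
      using U by blast
    show "\<exists>V W. openin limit_top V \<and> openin (discrete_topology (letters A)) W \<and> x \<in> V \<and> l \<in> W \<and> V \<times> W \<subseteq> U"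
      using U xl n openin_cylinder
      by (intro exI[of _ "cylinder n (x n)"] exI[of _ "{l}"]) (auto simp: cylinder_def)
  qed
qed

lemma closedin_edge_top_iff:
  "closedin edge_top E \<longleftrightarrow> E \<subseteq> \<T> \<times> letters A \<and>
    (\<forall>x\<in>\<T>. \<forall>l\<in>letters A. (\<forall>n. \<exists>y. (y, l) \<in> E \<and> y n = x n) \<longrightarrow> (x, l) \<in> E)"
proof -
  have "closedin edge_top E \<longleftrightarrow> E \<subseteq> \<T> \<times> letters A \<and> (\<forall>(x, l)\<in>\<T> \<times> letters A - E.
      \<exists>n. \<forall>y\<in>\<T>. y n = x n \<longrightarrow> (y, l) \<in> \<T> \<times> letters A - E)"
    unfolding closedin_def openin_edge_top_iff topspace_edge_top by simp
  also have "\<dots> \<longleftrightarrow> E \<subseteq> \<T> \<times> letters A \<and> (\<forall>(x, l)\<in>\<T> \<times> letters A - E.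
      \<not> (\<forall>n. \<exists>y. (y, l) \<in> E \<and> y n = x n))"
    by (intro conj_cong ball_cong refl) auto
  also have "\<dots> \<longleftrightarrow> E \<subseteq> \<T> \<times> letters A \<and>
      (\<forall>x\<in>\<T>. \<forall>l\<in>letters A. (\<forall>n. \<exists>y. (y, l) \<in> E \<and> y n = x n) \<longrightarrow> (x, l) \<in> E)"
    by (intro conj_cong refl) (simp only: Ball_def split_paired_All Diff_iff mem_Sigma_iff prod.case, meson)
  finally show ?thesis .
qed

end


section \<open>The Cayley graph of the limit as a profinite graph\<close>

section \<open>The Cayley graph of the limit\<close>

text \<open>A continuous bijection from a compact space to a Hausdorff space is a homeomorphism. It
  is injective because the relations separate points, and surjective because coherent classes are
  closed sets with the finite intersection property.\<close>

lemma homeomorphic_map_quotient_limit: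
  assumes X: "compact_space X" and I: "I \<noteq> {}"
    and equiv: "\<And>i. i \<in> I \<Longrightarrow> equiv (topspace X) (r i)"
    and "open": "\<And>i C. i \<in> I \<Longrightarrow> C \<in> topspace X // r i \<Longrightarrow> openin X C"
    and sep: "\<And>x y. x \<in> topspace X \<Longrightarrow> y \<in> topspace X \<Longrightarrow> (\<And>i. i \<in> I \<Longrightarrow> (x, y) \<in> r i) \<Longrightarrow> x = y"
    and dir: "\<And>i j. i \<in> I \<Longrightarrow> j \<in> I \<Longrightarrow> \<exists>k\<in>I. finer k i \<and> finer k j"
    and finer: "\<And>i j. i \<in> I \<Longrightarrow> j \<in> I \<Longrightarrow> finer j i \<Longrightarrow> r j \<subseteq> r i"
  shows "homeomorphic_map X (quotient_limit I finer (topspace X) r) (\<lambda>x. \<lambda>i\<in>I. r i `` {x})"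
    (is "homeomorphic_map X ?Y ?f")
proof (rule continuous_imp_homeomorphic_map)
  let ?P = "product_topology (\<lambda>i. discrete_topology (topspace X // r i)) I"
  let ?L = "{c. \<forall>i\<in>I. \<forall>j\<in>I. finer j i \<longrightarrow> c j \<subseteq> c i}"
  show "compact_space X" by (rule X)
  show "Hausdorff_space ?Y"
    unfolding quotient_limit_def
    by (intro Hausdorff_space_subtopology) (simp add: Hausdorff_space_product_topology)
  have cls: "r i `` {x} \<in> topspace X // r i" if "x \<in> topspace X" for x i
    using that by (rule quotientI)
  have fL: "?f x \<in> ?L" for x
    using finer by auto
  have comp: "continuous_map X (discrete_topology (topspace X // r i)) (\<lambda>x. r i `` {x})" if i: "i \<in> I" for i
    unfolding continuous_map_def
  proof (intro conjI allI impI)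
    show "(\<lambda>x. r i `` {x}) \<in> topspace X \<rightarrow> topspace (discrete_topology (topspace X // r i))"
      using cls by auto
    fix U assume U: "openin (discrete_topology (topspace X // r i)) U"
    have "{x \<in> topspace X. r i `` {x} \<in> U} = \<Union> U"
    proof (intro equalityI subsetI)
      fix x assume "x \<in> {x \<in> topspace X. r i `` {x} \<in> U}"
      then show "x \<in> \<Union> U"
        using equiv_class_self[OF equiv[OF i]] by blast
    next
      fix x assume "x \<in> \<Union> U"
      then obtain C where C: "C \<in> U" "x \<in> C" by blast
      then have CX: "C \<in> topspace X // r i"
        using U by auto
      then have "x \<in> topspace X"
        using C in_quotient_imp_subset[OF equiv[OF i]] by blast
      moreover have "C = r i `` {x}"
        using C CX equiv[OF i] by (metis Image_singleton_iff equiv_class_eq_iff quotientE)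
      ultimately show "x \<in> {x \<in> topspace X. r i `` {x} \<in> U}"
        using C by simp
    qed
    then show "openin X {x \<in> topspace X. r i `` {x} \<in> U}"
      using U "open"[OF i] by (auto intro!: openin_Union)
  qed
  show "continuous_map X ?Y ?f"
    unfolding quotient_limit_def continuous_map_in_subtopology
  proof
    show "continuous_map X ?P ?f"
      unfolding continuous_map_componentwise using comp by auto
    show "?f \<in> topspace X \<rightarrow> ?L"
      using fL by blast
  qed
  show "inj_on ?f (topspace X)"
  proof (rule inj_onI)
    fix x y assume xy: "x \<in> topspace X" "y \<in> topspace X" "?f x = ?f y"
    show "x = y"
    proof (rule sep[OF xy(1,2)])
      fix i assume i: "i \<in> I"
      then have "r i `` {x} = r i `` {y}"
        using fun_cong[OF xy(3), of i] by simp
      then show "(x, y) \<in> r i"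
        by (rule eq_equiv_class[OF _ equiv[OF i] xy(2)])
    qed
  qed
  show "?f ` topspace X = topspace ?Y"
  proof (intro equalityI subsetI)
    fix c assume "c \<in> ?f ` topspace X"
    then show "c \<in> topspace ?Y"
      using subsetD[OF finer] cls by (auto simp: quotient_limit_def)
  next
    fix c assume c: "c \<in> topspace ?Y"
    then have cq: "\<And>i. i \<in> I \<Longrightarrow> c i \<in> topspace X // r i" and ext: "c \<in> extensional I"
      and mono: "\<And>i j. i \<in> I \<Longrightarrow> j \<in> I \<Longrightarrow> finer j i \<Longrightarrow> c j \<subseteq> c i"
      by (auto simp: quotient_limit_def PiE_iff)
    have closed: "closedin X (c i)" if i: "i \<in> I" for i
    proof -
      have "topspace X - c i = \<Union> (topspace X // r i - {c i})"
        using Union_quotient[OF equiv[OF i]] quotient_disj[OF equiv[OF i] _ cq[OF i]] by blast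
      then show ?thesis
        using "open"[OF i] cq[OF i] in_quotient_imp_subset[OF equiv[OF i] cq[OF i]]
        by (auto simp: closedin_def)
    qed
    \<comment> \<open>Directedness puts one class, which is nonempty, inside any finitely many
      classes of the family.\<close>
    have "\<exists>k\<in>I. \<forall>i\<in>J. c k \<subseteq> c i" if "finite J" "J \<subseteq> I" for J
      using that
    proof (induction J)
      case empty
      then show ?case using I by auto
    next
      case (insert i J)
      then obtain k where k: "k \<in> I" "\<forall>j\<in>J. c k \<subseteq> c j" by auto
      then obtain m where "m \<in> I" "finer m i" "finer m k"
        using dir insert.prems by blast
      then show ?case
        using k insert.prems mono by (intro bexI[of _ m]) blast+
    qed
    then have fip: "\<Inter> \<F> \<noteq> {}" if "finite \<F>" "\<F> \<subseteq> c ` I" for \<F>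
      using that cq in_quotient_imp_non_empty[OF equiv] finite_subset_image[OF that]
      by (metis (no_types, lifting) INF_greatest subset_empty)
    have "\<Inter> (c ` I) \<noteq> {}"
      using X closed fip unfolding compact_space_fip by blast
    then obtain x where x: "\<And>i. i \<in> I \<Longrightarrow> x \<in> c i" by auto
    have "x \<in> topspace X"
      using x I cq in_quotient_imp_subset[OF equiv] by blast
    moreover have "c i = r i `` {x}" if "i \<in> I" for i
      using x[OF that] cq[OF that] equiv[OF that] by (metis Image_singleton_iff equiv_class_eq_iff quotientE)
    then have "c = ?f x"
      using ext by (auto simp: extensional_def fun_eq_iff)
    ultimately show "c \<in> ?f ` topspace X" by blast
  qed
qed

context marked_tower
begin

abbreviation \<Gamma> where "\<Gamma> \<equiv> cayley_graph A limit limit_top"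

lemma cayley_simps [simp]:
  "verts \<Gamma> = \<T>" "edges \<Gamma> = \<T> \<times> letters A" "pos_edges \<Gamma> = \<T> \<times> (A \<times> {True})"
  "src \<Gamma> = fst" "vtop \<Gamma> = limit_top" "etop \<Gamma> = edge_top"
  by (simp_all add: cayley_graph_def edge_top_def)

lemma tgt_cayley: "l \<in> letters A \<Longrightarrow> tgt \<Gamma> (x, l) = (\<lambda>n. x n \<otimes>\<^bsub>fst (M n)\<^esub> letter_val (M n) l)"
  by (simp add: cayley_graph_def letter_val_limit)

lemma einv_cayley: "einv \<Gamma> (x, l) = (tgt \<Gamma> (x, l), linv l)"
  by (simp add: cayley_graph_def)

lemma tgt_cayley_in: "x \<in> \<T> \<Longrightarrow> l \<in> letters A \<Longrightarrow> tgt \<Gamma> (x, l) \<in> \<T>"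
  using thread_mult letter_thread by (simp add: tgt_cayley)

lemma tgt_tgt_linv: "x \<in> \<T> \<Longrightarrow> l \<in> letters A \<Longrightarrow> tgt \<Gamma> (tgt \<Gamma> (x, l), linv l) = x"
  by (simp add: tgt_cayley linv_letters level.letter_val_inverse level.letter_val_in thread_in
      level.G.m_assoc)

lemma is_serre_graph_cayley: "is_serre_graph \<Gamma>"
proof -
  have "e \<in> einv \<Gamma> ` pos_edges \<Gamma>" if "e \<in> edges \<Gamma> - pos_edges \<Gamma>" for e
  proof -
    obtain x l where e: "e = (x, l)" by (cases e)
    then have l: "x \<in> \<T>" "l \<in> letters A" "linv l \<in> A \<times> {True}"
      using that by (auto simp: letters_def linv_def)
    then have "e = einv \<Gamma> (tgt \<Gamma> e, linv l)"
      by (simp add: e einv_cayley tgt_tgt_linv)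
    moreover have "(tgt \<Gamma> e, linv l) \<in> pos_edges \<Gamma>"
      using l tgt_cayley_in e by simp
    ultimately show ?thesis by blast
  qed
  moreover have "einv \<Gamma> e \<in> edges \<Gamma> - pos_edges \<Gamma>" if "e \<in> pos_edges \<Gamma>" for e
    using that tgt_cayley_in by (auto simp: einv_cayley letters_def linv_def)
  ultimately have "einv \<Gamma> ` pos_edges \<Gamma> = edges \<Gamma> - pos_edges \<Gamma>" by blast
  moreover have "einv \<Gamma> e \<in> edges \<Gamma>" "tgt \<Gamma> e \<in> \<T>" "einv \<Gamma> (einv \<Gamma> e) = e"
    "fst (einv \<Gamma> e) = tgt \<Gamma> e" "tgt \<Gamma> (einv \<Gamma> e) = fst e" if "e \<in> edges \<Gamma>" for e
  proof -
    obtain x l where "e = (x, l)" "x \<in> \<T>" "l \<in> letters A"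
      using \<open>e \<in> edges \<Gamma>\<close> by (cases e) simp
    then show "einv \<Gamma> e \<in> edges \<Gamma>" "tgt \<Gamma> e \<in> \<T>" "einv \<Gamma> (einv \<Gamma> e) = e"
      "fst (einv \<Gamma> e) = tgt \<Gamma> e" "tgt \<Gamma> (einv \<Gamma> e) = fst e"
      by (simp_all add: einv_cayley tgt_cayley_in linv_letters tgt_tgt_linv)
  qed
  moreover have "pos_edges \<Gamma> \<subseteq> edges \<Gamma>"
    by (auto simp: letters_def)
  ultimately show ?thesis
    unfolding is_serre_graph_def by (intro conjI ballI Pi_I) (simp_all, auto)
qed

lemma restrict_cayley [simp]:
  "verts (restrict_graph \<Gamma> V E) = V" "edges (restrict_graph \<Gamma> V E) = E"
  "src (restrict_graph \<Gamma> V E) = fst" "tgt (restrict_graph \<Gamma> V E) = tgt \<Gamma>"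
  "einv (restrict_graph \<Gamma> V E) = einv \<Gamma>"
  "pos_edges (restrict_graph \<Gamma> V E) = \<T> \<times> (A \<times> {True}) \<inter> E"
  "vtop (restrict_graph \<Gamma> V E) = subtopology limit_top V"
  "etop (restrict_graph \<Gamma> V E) = subtopology edge_top E"
  by (simp_all add: restrict_graph_def)

lemma restrict_cayley_self: "restrict_graph \<Gamma> \<T> (\<T> \<times> letters A) = \<Gamma>"
proof -
  have "\<T> \<times> (A \<times> {True}) \<inter> \<T> \<times> letters A = \<T> \<times> (A \<times> {True})"
    by (auto simp: letters_def)
  moreover have "subtopology limit_top \<T> = limit_top" "subtopology edge_top (\<T> \<times> letters A) = edge_top"
    using subtopology_topspace[of limit_top] subtopology_topspace[of edge_top] by simp_all
  ultimately show ?thesis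
    unfolding restrict_graph_def by (simp add: cayley_graph_def edge_top_def)
qed

lemma closed_subgraph_iff:
  "closed_subgraph \<Gamma> V E \<longleftrightarrow> closedin limit_top V \<and> closedin edge_top E \<and>
    V \<subseteq> \<T> \<and> E \<subseteq> \<T> \<times> letters A \<and>
    (\<forall>(x, l)\<in>E. x \<in> V \<and> tgt \<Gamma> (x, l) \<in> V \<and> (tgt \<Gamma> (x, l), linv l) \<in> E)"
  by (auto simp: closed_subgraph_def einv_cayley)

lemma closed_subgraph_self: "closed_subgraph \<Gamma> \<T> (\<T> \<times> letters A)"
  using closedin_topspace[of limit_top] closedin_topspace[of edge_top]
  by (auto simp: closed_subgraph_iff tgt_cayley_in linv_letters)

definition vertex_cong :: "nat \<Rightarrow> (nat \<Rightarrow> 'g) set \<Rightarrow> ((nat \<Rightarrow> 'g) \<times> (nat \<Rightarrow> 'g)) set" where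
  "vertex_cong n V = {(u, v). u \<in> V \<and> v \<in> V \<and> u n = v n}"

text \<open>Keeping the letter makes the relation respect targets, inversion and
  orientation.\<close>

definition edge_cong ::
  "nat \<Rightarrow> ((nat \<Rightarrow> 'g) \<times> 'a letter) set \<Rightarrow> (((nat \<Rightarrow> 'g) \<times> 'a letter) \<times> ((nat \<Rightarrow> 'g) \<times> 'a letter)) set" where
  "edge_cong n E = {(e, f). e \<in> E \<and> f \<in> E \<and> fst e n = fst f n \<and> snd e = snd f}"

lemma equiv_vertex_cong: "equiv V (vertex_cong n V)"
  by (intro equivI) (auto simp: vertex_cong_def refl_on_def sym_def trans_def)

lemma equiv_edge_cong: "equiv E (edge_cong n E)"
  by (intro equivI) (auto simp: edge_cong_def refl_on_def sym_def trans_def)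

lemma level_congruence:
  assumes sub: "closed_subgraph \<Gamma> V E"
  shows "finite_continuous_congruence (restrict_graph \<Gamma> V E) (vertex_cong n V, edge_cong n E)"
proof -
  have V: "V \<subseteq> \<T>" and E: "E \<subseteq> \<T> \<times> letters A"
    and tgt: "\<And>x l. (x, l) \<in> E \<Longrightarrow> x \<in> V \<and> tgt \<Gamma> (x, l) \<in> V \<and> (tgt \<Gamma> (x, l), linv l) \<in> E"
    using sub by (auto simp: closed_subgraph_iff)
  have "V // vertex_cong n V \<subseteq> (\<lambda>h. {v \<in> V. v n = h}) ` carrier (fst (M n))"
  proof
    fix C assume "C \<in> V // vertex_cong n V"
    then obtain x where x: "x \<in> V" "C = vertex_cong n V `` {x}"
      by (auto simp: quotient_def)
    have "C = {v \<in> V. v n = x n}"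
      using x by (auto simp: vertex_cong_def)
    then show "C \<in> (\<lambda>h. {v \<in> V. v n = h}) ` carrier (fst (M n))"
      using x V thread_in by (intro rev_image_eqI[of "x n"]) auto
  qed
  then have 1: "finite (V // vertex_cong n V)"
    using finite_level finite_subset by blast
  have "E // edge_cong n E \<subseteq> (\<lambda>(h, l). {e \<in> E. fst e n = h \<and> snd e = l}) ` (carrier (fst (M n)) \<times> letters A)"
  proof
    fix C assume "C \<in> E // edge_cong n E"
    then obtain x l where xl: "(x, l) \<in> E" "C = edge_cong n E `` {(x, l)}"
      by (auto simp: quotient_def)
    have "C = {e \<in> E. fst e n = x n \<and> snd e = l}"
      using xl by (auto simp: edge_cong_def)
    moreover have "(x n, l) \<in> carrier (fst (M n)) \<times> letters A"
      using xl E thread_in by auto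
    ultimately show "C \<in> (\<lambda>(h, l). {e \<in> E. fst e n = h \<and> snd e = l}) ` (carrier (fst (M n)) \<times> letters A)"
      by (intro rev_image_eqI[of "(x n, l)"]) auto
  qed
  moreover have "finite (letters A)"
    using finite_letters by (simp add: letters_def)
  ultimately have 2: "finite (E // edge_cong n E)"
    using finite_level by (meson finite_SigmaI finite_imageI finite_subset)
  have 3: "openin (subtopology limit_top V) C" if "C \<in> V // vertex_cong n V" for C
  proof -
    obtain x where "x \<in> V" "C = vertex_cong n V `` {x}"
      using \<open>C \<in> V // vertex_cong n V\<close> by (rule quotientE)
    then have "C = V \<inter> cylinder n (x n)"
      using V by (auto simp: vertex_cong_def cylinder_def)
    then show ?thesis
      using openin_cylinder by (auto intro: openin_subtopology_Int2)
  qed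
  have 4: "openin (subtopology edge_top E) C" if "C \<in> E // edge_cong n E" for C
  proof -
    obtain x l where xl: "(x, l) \<in> E" "C = edge_cong n E `` {(x, l)}"
      using \<open>C \<in> E // edge_cong n E\<close> by (metis quotientE surj_pair)
    then have "C = E \<inter> (cylinder n (x n) \<times> {l})"
      using E by (auto simp: edge_cong_def cylinder_def)
    moreover have "openin edge_top (cylinder n (x n) \<times> {l})"
      unfolding edge_top_def using openin_cylinder xl E by (auto simp: openin_prod_Times_iff)
    ultimately show ?thesis
      by (auto intro: openin_subtopology_Int2)
  qed
  have 5: "(fst e, fst f) \<in> vertex_cong n V \<and> (tgt \<Gamma> e, tgt \<Gamma> f) \<in> vertex_cong n V \<and>
      (einv \<Gamma> e, einv \<Gamma> f) \<in> edge_cong n E \<and> (e \<in> \<T> \<times> (A \<times> {True}) \<inter> E \<longleftrightarrow> f \<in> \<T> \<times> (A \<times> {True}) \<inter> E)"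
    if ef: "(e, f) \<in> edge_cong n E" for e f
  proof -
    obtain x y l where e: "e = (x, l)" and f: "f = (y, l)"
      using ef by (cases e; cases f) (auto simp: edge_cong_def)
    have xy: "(x, l) \<in> E" "(y, l) \<in> E" "x n = y n"
      using ef e f by (auto simp: edge_cong_def)
    then have "tgt \<Gamma> (x, l) n = tgt \<Gamma> (y, l) n"
      using E by (auto simp: tgt_cayley)
    then show ?thesis
      using xy tgt E by (auto simp: e f vertex_cong_def edge_cong_def einv_cayley)
  qed
  show ?thesis
    unfolding finite_continuous_congruence_def graph_congruence_def
    using 1 2 3 4 5 equiv_vertex_cong equiv_edge_cong by (simp add: split_def)
qed

text \<open>The level congruences form a chain and separate points, so they present the graph as a
  limit of finite quotients.\<close>

lemma profinite_graph_cayley: "profinite_graph \<Gamma>"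
proof -
  let ?c = "\<lambda>n. (vertex_cong n \<T>, edge_cong n (\<T> \<times> letters A))"
  let ?I = "range ?c"
  have fcc: "finite_continuous_congruence \<Gamma> (?c n)" for n
    using level_congruence[OF closed_subgraph_self, of n] by (simp only: restrict_cayley_self)
  have mono: "finer_cong (?c m) (?c n)" if "n \<le> m" for n m
    by (auto simp: finer_cong_def vertex_cong_def edge_cong_def intro: thread_eq_below[OF _ _ _ that])
  have dir: "\<exists>k\<in>?I. finer_cong k i \<and> finer_cong k j" if "i \<in> ?I" "j \<in> ?I" for i j
    using that mono by (metis (no_types, lifting) imageE max.cobounded1 max.cobounded2 rangeI)
  have "homeomorphic_map limit_top (quotient_limit ?I finer_cong (topspace limit_top) fst) (\<lambda>v. \<lambda>i\<in>?I. fst i `` {v})"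
  proof (rule homeomorphic_map_quotient_limit[OF compact_space_limit _ _ _ _ dir])
    show "equiv (topspace limit_top) (fst i)" if "i \<in> ?I" for i
      using that equiv_vertex_cong by auto
    show "openin limit_top C" if "i \<in> ?I" "C \<in> topspace limit_top // fst i" for i C
      using that fcc by (auto simp: finite_continuous_congruence_def)
    show "x = y" if *: "\<And>i. i \<in> ?I \<Longrightarrow> (x, y) \<in> fst i" for x y
    proof
      show "x n = y n" for n
        using *[of "?c n"] by (auto simp: vertex_cong_def)
    qed
  qed (auto simp: finer_cong_def)
  moreover have "homeomorphic_map edge_top (quotient_limit ?I finer_cong (topspace edge_top) snd) (\<lambda>v. \<lambda>i\<in>?I. snd i `` {v})"
  proof (rule homeomorphic_map_quotient_limit[OF compact_space_edge_top _ _ _ _ dir])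
    show "equiv (topspace edge_top) (snd i)" if "i \<in> ?I" for i
      using that equiv_edge_cong by auto
    show "openin edge_top C" if "i \<in> ?I" "C \<in> topspace edge_top // snd i" for i C
      using that fcc by (auto simp: finite_continuous_congruence_def)
    show "e = f" if *: "\<And>i. i \<in> ?I \<Longrightarrow> (e, f) \<in> snd i" for e f
    proof -
      have "fst e n = fst f n \<and> snd e = snd f" for n
        using *[of "?c n"] by (auto simp: edge_cong_def)
      then show ?thesis by (auto intro!: prod_eqI)
    qed
  qed (auto simp: finer_cong_def)
  ultimately show ?thesis
    unfolding profinite_graph_def using is_serre_graph_cayley fcc dir
    by (intro conjI exI[of _ ?I]) auto
qed

end


section \<open>Connectedness of closed subgraphs, tested level by level\<close>

section \<open>Connected subgraphs\<close>

text \<open>End points in \<open>quotient_graph\<close> are defined by saturating an image; this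
  shows that the result is a single class.\<close>

lemma equiv_image_class:
  assumes "equiv V \<theta>" "equiv E \<eta>" "\<And>e f. (e, f) \<in> \<eta> \<Longrightarrow> (s e, s f) \<in> \<theta>" "e \<in> E"
  shows "\<theta> `` (s ` (\<eta> `` {e})) = \<theta> `` {s e}"
proof -
  have "(e, e) \<in> \<eta>"
    using equiv_class_self[OF assms(2,4)] by simp
  moreover have "\<theta> `` {s f} = \<theta> `` {s e}" if "f \<in> \<eta> `` {e}" for f
    using equiv_class_eq[OF assms(1) assms(3)[of e f]] that by simp
  then have "(\<Union>f\<in>\<eta> `` {e}. \<theta> `` {s f}) = (\<Union>f\<in>\<eta> `` {e}. \<theta> `` {s e})"
    by (rule SUP_cong[OF refl])
  moreover have "\<theta> `` (s ` (\<eta> `` {e})) = (\<Union>f\<in>\<eta> `` {e}. \<theta> `` {s f})"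
    by blast
  ultimately show ?thesis
    by (simp del: SUP_const) blast
qed

context marked_tower
begin

text \<open>For closed subgraphs, \<open>connected_profinite\<close> comes down to paths in this
  relation at every level.\<close>

definition adj :: "nat \<Rightarrow> ((nat \<Rightarrow> 'g) \<times> 'a letter) set \<Rightarrow> ('g \<times> 'g) set" where
  "adj n E = {(fst e n, tgt \<Gamma> e n) |e. e \<in> E}"

lemma adjI: "e \<in> E \<Longrightarrow> (fst e n, tgt \<Gamma> e n) \<in> adj n E"
  unfolding adj_def by blast

text \<open>Each point has a cylinder whose part in \<open>V\<close> stays inside its class.
  Finitely many of these cover the compact set \<open>V\<close>, and the highest level among them
  serves for all points.\<close>

lemma clopen_classes_contain_levels:
  assumes V: "closedin limit_top V" and eq: "equiv V \<theta>"
    and "open": "\<And>C. C \<in> V // \<theta> \<Longrightarrow> openin (subtopology limit_top V) C"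
  shows "\<exists>n. \<forall>x\<in>V. \<forall>y\<in>V. x n = y n \<longrightarrow> (x, y) \<in> \<theta>"
proof -
  have VT: "V \<subseteq> \<T>"
    using V by (simp add: closedin_limit_iff)
  have loc: "\<exists>n. \<forall>y\<in>V. y n = x n \<longrightarrow> (x, y) \<in> \<theta>" if x: "x \<in> V" for x
  proof -
    have "openin (subtopology limit_top V) (\<theta> `` {x})"
      using "open" x by (simp add: quotientI)
    then obtain U where U: "openin limit_top U" "\<theta> `` {x} = U \<inter> V"
      by (auto simp: openin_subtopology)
    have "x \<in> U"
      using U(2) x eq by (metis IntD1 equiv_class_self)
    then obtain n where "\<forall>y\<in>\<T>. y n = x n \<longrightarrow> y \<in> U"
      using U by (auto simp: openin_limit_iff)
    then have "\<forall>y\<in>V. y n = x n \<longrightarrow> y \<in> \<theta> `` {x}"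
      using U VT by auto
    then show ?thesis by auto
  qed
  then obtain N where N: "\<And>x y. x \<in> V \<Longrightarrow> y \<in> V \<Longrightarrow> y (N x) = x (N x) \<Longrightarrow> (x, y) \<in> \<theta>"
    by metis
  have "compactin limit_top V"
    using V compact_space_limit by (rule closedin_compact_space[rotated])
  moreover have "\<And>U. U \<in> (\<lambda>x. cylinder (N x) (x (N x))) ` V \<Longrightarrow> openin limit_top U"
    using openin_cylinder by auto
  moreover have "V \<subseteq> \<Union> ((\<lambda>x. cylinder (N x) (x (N x))) ` V)"
    using VT by (auto simp: cylinder_def)
  ultimately obtain \<F> where F: "finite \<F>" "\<F> \<subseteq> (\<lambda>x. cylinder (N x) (x (N x))) ` V" "V \<subseteq> \<Union> \<F>"
    unfolding compactin_def by meson
  then obtain X where X: "X \<subseteq> V" "finite X" "\<F> = (\<lambda>x. cylinder (N x) (x (N x))) ` X"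
    using finite_subset_image[OF F(1,2)] by blast
  \<comment> \<open>If \<open>V\<close> is empty this is the maximum of the empty set, and any value
    will do.\<close>
  define n where "n = Max (N ` X)"
  have "(a, b) \<in> \<theta>" if ab: "a \<in> V" "b \<in> V" "a n = b n" for a b
  proof -
    obtain x where x: "x \<in> X" "a (N x) = x (N x)"
      using F(3) X(3) ab(1) by (auto simp: cylinder_def)
    have "N x \<le> n"
      using X x by (simp add: n_def)
    then have "b (N x) = x (N x)"
      using thread_eq_below[of a b n "N x"] ab VT x by (metis subsetD)
    then have "(x, a) \<in> \<theta>" "(x, b) \<in> \<theta>"
      using N X x ab by auto
    then show ?thesis
      using eq by (meson equiv_def symD transD)
  qed
  then show ?thesis by blast
qed

text \<open>Some level refines the vertex classes of the given congruence, and a path at that level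
  maps to a path in the quotient.\<close>

lemma connected_profinite_restrictI:
  assumes sub: "closed_subgraph \<Gamma> V E"
    and conn: "\<And>n u v. u \<in> V \<Longrightarrow> v \<in> V \<Longrightarrow> (u n, v n) \<in> (adj n E)\<^sup>*"
  shows "connected_profinite (restrict_graph \<Gamma> V E)"
  unfolding connected_profinite_def
proof (intro allI impI)
  fix c assume c: "finite_continuous_congruence (restrict_graph \<Gamma> V E) c"
  obtain \<theta> \<eta> where c_eq: "c = (\<theta>, \<eta>)" by (cases c)
  let ?Q = "quotient_graph (restrict_graph \<Gamma> V E) (\<theta>, \<eta>)"
  let ?S = "{(src ?Q e, tgt ?Q e) |e. e \<in> edges ?Q}"
  have VE: "closedin limit_top V" "E \<subseteq> \<T> \<times> letters A"
    and tgt: "\<And>e. e \<in> E \<Longrightarrow> fst e \<in> V \<and> tgt \<Gamma> e \<in> V"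
    using sub by (auto simp: closed_subgraph_iff)
  have eqs: "equiv V \<theta>" "equiv E \<eta>"
    and cong: "\<And>e f. (e, f) \<in> \<eta> \<Longrightarrow> (fst e, fst f) \<in> \<theta>" "\<And>e f. (e, f) \<in> \<eta> \<Longrightarrow> (tgt \<Gamma> e, tgt \<Gamma> f) \<in> \<theta>"
    and "open": "\<And>C. C \<in> V // \<theta> \<Longrightarrow> openin (subtopology limit_top V) C"
    using c by (auto simp: c_eq finite_continuous_congruence_def graph_congruence_def)
  obtain n where n: "\<And>x y. x \<in> V \<Longrightarrow> y \<in> V \<Longrightarrow> x n = y n \<Longrightarrow> (x, y) \<in> \<theta>"
    using clopen_classes_contain_levels[OF VE(1) eqs(1) "open"] by blast
  have edge: "(\<theta> `` {fst e}, \<theta> `` {tgt \<Gamma> e}) \<in> ?S" if e: "e \<in> E" for e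
  proof -
    have "src ?Q (\<eta> `` {e}) = \<theta> `` {fst e}" "tgt ?Q (\<eta> `` {e}) = \<theta> `` {tgt \<Gamma> e}"
      using equiv_image_class[OF eqs cong(1) e] equiv_image_class[OF eqs cong(2) e]
      by (simp_all add: quotient_graph_def)
    moreover have "\<eta> `` {e} \<in> edges ?Q"
      using e by (simp add: quotient_graph_def quotientI)
    ultimately show ?thesis
      by (auto intro!: exI[of _ "\<eta> `` {e}"])
  qed
  \<comment> \<open>Consecutive edges of a path at level \<open>n\<close> meet only in their
    coordinates at \<open>n\<close>. Vertices that agree there share a class, so the induction
    covers every \<open>v\<close> over \<open>z\<close>.\<close>
  have path: "\<forall>v\<in>V. v n = z \<longrightarrow> (\<theta> `` {u}, \<theta> `` {v}) \<in> ?S\<^sup>*" if u: "u \<in> V" and z: "(u n, z) \<in> (adj n E)\<^sup>*" for u z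
    using z
  proof (induction rule: rtrancl_induct)
    case base
    have "\<theta> `` {u} = \<theta> `` {v}" if "v \<in> V" "v n = u n" for v
      using n[OF u that(1)] that(2) by (intro equiv_class_eq[OF eqs(1)]) simp
    then show ?case
      by auto
  next
    case (step y z)
    then obtain e where e: "e \<in> E" "y = fst e n" "z = tgt \<Gamma> e n"
      by (auto simp: adj_def)
    have "(\<theta> `` {u}, \<theta> `` {fst e}) \<in> ?S\<^sup>*"
      using step.IH e tgt by blast
    then have *: "(\<theta> `` {u}, \<theta> `` {tgt \<Gamma> e}) \<in> ?S\<^sup>*"
      using edge[OF e(1)] by (rule rtrancl.rtrancl_into_rtrancl)
    have "\<theta> `` {v} = \<theta> `` {tgt \<Gamma> e}" if "v \<in> V" "v n = z" for v
      using n[of v "tgt \<Gamma> e"] that e tgt equiv_class_eq[OF eqs(1)] by metis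
    then show ?case
      using * by auto
  qed
  have "(X, Y) \<in> ?S\<^sup>*" if XY: "X \<in> V // \<theta>" "Y \<in> V // \<theta>" for X Y
  proof -
    obtain u where u: "u \<in> V" "X = \<theta> `` {u}"
      using XY(1) by (rule quotientE)
    obtain v where v: "v \<in> V" "Y = \<theta> `` {v}"
      using XY(2) by (rule quotientE)
    show ?thesis
      using path[OF u(1) conn[OF u(1) v(1)]] u v by blast
  qed
  then show "connected_graph (quotient_graph (restrict_graph \<Gamma> V E) c)"
    unfolding connected_graph_def c_eq by (simp add: quotient_graph_def)
qed

text \<open>The level congruence is itself one of the finite quotients, and its paths are paths of
  \<open>adj\<close>.\<close>

lemma connected_profinite_restrictD:
  assumes sub: "closed_subgraph \<Gamma> V E" and conn: "connected_profinite (restrict_graph \<Gamma> V E)"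
    and uv: "u \<in> V" "v \<in> V"
  shows "(u n, v n) \<in> (adj n E)\<^sup>*"
proof -
  let ?\<theta> = "vertex_cong n V" and ?\<eta> = "edge_cong n E"
  let ?Q = "quotient_graph (restrict_graph \<Gamma> V E) (?\<theta>, ?\<eta>)"
  let ?S = "{(src ?Q e, tgt ?Q e) |e. e \<in> edges ?Q}"
  have tgt: "\<And>e. e \<in> E \<Longrightarrow> fst e \<in> V \<and> tgt \<Gamma> e \<in> V"
    using sub by (auto simp: closed_subgraph_iff)
  have cong: "\<And>e f. (e, f) \<in> ?\<eta> \<Longrightarrow> (fst e, fst f) \<in> ?\<theta>" "\<And>e f. (e, f) \<in> ?\<eta> \<Longrightarrow> (tgt \<Gamma> e, tgt \<Gamma> f) \<in> ?\<theta>"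
    using level_congruence[OF sub, of n]
    by (auto simp: finite_continuous_congruence_def graph_congruence_def)
  have "connected_graph ?Q"
    using conn level_congruence[OF sub] by (simp add: connected_profinite_def)
  moreover have "?\<theta> `` {u} \<in> verts ?Q" "?\<theta> `` {v} \<in> verts ?Q"
    using uv by (simp_all add: quotient_graph_def quotientI)
  ultimately have "(?\<theta> `` {u}, ?\<theta> `` {v}) \<in> ?S\<^sup>*"
    by (auto simp: connected_graph_def)
  then have "\<forall>w \<in> ?\<theta> `` {v}. (u n, w n) \<in> (adj n E)\<^sup>*"
  proof (induction rule: rtrancl_induct)
    case base
    then show ?case by (auto simp: vertex_cong_def)
  next
    case (step Y Z)
    then obtain C where C: "C \<in> E // ?\<eta>" "Y = src ?Q C" "Z = tgt ?Q C"
      by (auto simp: quotient_graph_def)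
    obtain e where e: "e \<in> E" "C = ?\<eta> `` {e}"
      using C(1) by (rule quotientE)
    have YZ: "Y = ?\<theta> `` {fst e}" "Z = ?\<theta> `` {tgt \<Gamma> e}"
      using equiv_image_class[OF equiv_vertex_cong equiv_edge_cong cong(1) e(1)]
        equiv_image_class[OF equiv_vertex_cong equiv_edge_cong cong(2) e(1)] C e
      by (simp_all add: quotient_graph_def)
    then have "(u n, fst e n) \<in> (adj n E)\<^sup>*"
      using step.IH tgt[OF e(1)] by (auto simp: vertex_cong_def)
    moreover have "(fst e n, tgt \<Gamma> e n) \<in> adj n E"
      using e(1) by (rule adjI)
    ultimately have "(u n, tgt \<Gamma> e n) \<in> (adj n E)\<^sup>*"
      by (rule rtrancl.rtrancl_into_rtrancl)
    then show ?case
      using YZ by (auto simp: vertex_cong_def)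
  qed
  then show ?thesis
    using uv by (auto simp: vertex_cong_def)
qed

lemma adj_below:
  assumes "E \<subseteq> \<T> \<times> letters A" "x \<in> \<T>" "y \<in> \<T>" "(x m, y m) \<in> (adj m E)\<^sup>*" "n \<le> m"
  shows "(x n, y n) \<in> (adj n E)\<^sup>*"
proof -
  have "\<forall>y\<in>\<T>. y m = z \<longrightarrow> (x n, y n) \<in> (adj n E)\<^sup>*" if "(x m, z) \<in> (adj m E)\<^sup>*" for z
    using that
  proof (induction rule: rtrancl_induct)
    case base
    then show ?case
      using thread_eq_below[OF _ assms(2) _ assms(5)] by (metis rtrancl.rtrancl_refl)
  next
    case (step z z')
    then obtain e where e: "e \<in> E" "z = fst e m" "z' = tgt \<Gamma> e m"
      by (auto simp: adj_def)
    have eT: "fst e \<in> \<T>" "tgt \<Gamma> e \<in> \<T>"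
      using e assms(1) tgt_cayley_in[of "fst e" "snd e"] by auto
    then have "(x n, fst e n) \<in> (adj n E)\<^sup>*"
      using step.IH e by blast
    moreover have "(fst e n, tgt \<Gamma> e n) \<in> adj n E"
      using e(1) by (rule adjI)
    ultimately have "(x n, tgt \<Gamma> e n) \<in> (adj n E)\<^sup>*"
      by (rule rtrancl.rtrancl_into_rtrancl)
    then show ?case
      using thread_eq_below[OF _ eT(2) _ assms(5)] e by metis
  qed
  then show ?thesis
    using assms by blast
qed

end

context marked_tower
begin

lemma adj_sym:
  assumes "closed_subgraph \<Gamma> V E"
  shows "sym (adj n E)"
proof (rule symI)
  fix s t assume "(s, t) \<in> adj n E"
  then obtain x l where xl: "(x, l) \<in> E" "s = x n" "t = tgt \<Gamma> (x, l) n"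
    by (auto simp: adj_def)
  then have "x \<in> \<T>" "l \<in> letters A" "(tgt \<Gamma> (x, l), linv l) \<in> E"
    using assms by (auto simp: closed_subgraph_iff)
  then show "(t, s) \<in> adj n E"
    using adjI[of "(tgt \<Gamma> (x, l), linv l)" E n] xl by (simp add: tgt_tgt_linv)
qed

text \<open>Paths at different levels need not be compatible, so \<open>E\<close> may fail to be
  connected. Cutting down to what no level separates from \<open>u\<close> gives a subgraph;
  compactness shows that its edges still supply the paths at each level.\<close>

lemma ex_connected_subgraph:
  assumes sub: "closed_subgraph \<Gamma> V E" and uv: "u \<in> V" "v \<in> V"
    and conn: "\<And>n. (u n, v n) \<in> (adj n E)\<^sup>*"
  shows "\<exists>V' E'. V' \<subseteq> V \<and> E' \<subseteq> E \<and> (V', E') \<in> connected_subgraphs \<Gamma> {u, v}"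
proof -
  have V: "V \<subseteq> \<T>" "closedin limit_top V" and E: "E \<subseteq> \<T> \<times> letters A" "closedin edge_top E"
    and E_sub: "\<And>x l. (x, l) \<in> E \<Longrightarrow> x \<in> V \<and> tgt \<Gamma> (x, l) \<in> V \<and> (tgt \<Gamma> (x, l), linv l) \<in> E"
    using sub by (auto simp: closed_subgraph_iff)
  \<comment> \<open>The vertices that no level separates from \<open>u\<close>; an edge of
    \<open>E\<close> that starts here also ends here.\<close>
  define V' where "V' = {x \<in> V. \<forall>n. (u n, x n) \<in> (adj n E)\<^sup>*}"
  define E' where "E' = {e \<in> E. fst e \<in> V'}"
  have u: "u \<in> \<T>"
    using uv V by auto
  have V'_closed: "closedin limit_top V'"
    unfolding closedin_limit_iff
  proof (intro conjI ballI impI)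
    show "V' \<subseteq> \<T>"
      using V by (auto simp: V'_def)
    fix x assume x: "x \<in> \<T>" "\<forall>n. \<exists>y\<in>V'. y n = x n"
    then have "x \<in> V"
      using V(2) unfolding closedin_limit_iff V'_def by blast
    moreover have "(u n, x n) \<in> (adj n E)\<^sup>*" for n
      using x(2) unfolding V'_def by (metis (mono_tags, lifting) mem_Collect_eq)
    ultimately show "x \<in> V'"
      by (simp add: V'_def)
  qed
  have E'_closed: "closedin edge_top E'"
    unfolding closedin_edge_top_iff
  proof (intro conjI ballI impI)
    show "E' \<subseteq> \<T> \<times> letters A"
      using E by (auto simp: E'_def)
    fix x l assume xl: "x \<in> \<T>" "l \<in> letters A" "\<forall>n. \<exists>y. (y, l) \<in> E' \<and> y n = x n"
    then have "(x, l) \<in> E"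
      using E(2) unfolding closedin_edge_top_iff E'_def by blast
    moreover have "\<forall>n. \<exists>y\<in>V'. y n = x n"
      using xl(3) by (fastforce simp: E'_def)
    then have "x \<in> V'"
      using V'_closed xl(1) by (simp add: closedin_limit_iff)
    ultimately show "(x, l) \<in> E'"
      by (simp add: E'_def)
  qed
  have tgt_V': "tgt \<Gamma> (x, l) \<in> V'" if "(x, l) \<in> E'" for x l
  proof -
    have "(x, l) \<in> E" "x \<in> V'"
      using that by (auto simp: E'_def)
    moreover have "(x n, tgt \<Gamma> (x, l) n) \<in> adj n E" for n
      using adjI[OF \<open>(x, l) \<in> E\<close>, of n] by simp
    ultimately show ?thesis
      using E_sub by (auto simp: V'_def intro: rtrancl.rtrancl_into_rtrancl)
  qed
  have sub': "closed_subgraph \<Gamma> V' E'"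
    unfolding closed_subgraph_iff
  proof (intro conjI V'_closed E'_closed)
    show "V' \<subseteq> \<T>" "E' \<subseteq> \<T> \<times> letters A"
      using V E by (auto simp: V'_def E'_def)
    show "\<forall>(x, l)\<in>E'. x \<in> V' \<and> tgt \<Gamma> (x, l) \<in> V' \<and> (tgt \<Gamma> (x, l), linv l) \<in> E'"
      using tgt_V' E_sub by (auto simp: E'_def)
  qed
  have from_u: "(u n, x n) \<in> (adj n E')\<^sup>*" if x: "x \<in> V'" for x n
  proof -
    \<comment> \<open>\<open>D m\<close> has the edges that level \<open>m\<close> does not separate
      from \<open>u\<close>. The set \<open>C m\<close> below has those of them whose image at level
      \<open>n\<close> is not supplied by \<open>E'\<close>; it will be empty for large
      \<open>m\<close>.\<close>
    define D where "D = (\<lambda>m. {e \<in> E. (u m, fst e m) \<in> (adj m E)\<^sup>*})"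
    define C where "C = (\<lambda>m. {e \<in> D m. (fst e n, tgt \<Gamma> e n) \<notin> adj n E'})"
    have ET: "fst e \<in> \<T>" if "e \<in> E" for e
      using that E by auto
    have D_mono: "D m \<subseteq> D k" if "k \<le> m" for k m
      using adj_below[OF E(1) u ET _ that] by (auto simp: D_def)
    have "\<exists>m. C m = {}"
    proof (rule ccontr)
      assume "\<nexists>m. C m = {}"
      then have ne: "\<And>m. C m \<noteq> {}" by blast
      have "closedin edge_top (C m)" for m
        unfolding closedin_edge_top_iff
      proof (intro conjI ballI impI)
        show "C m \<subseteq> \<T> \<times> letters A"
          using E by (auto simp: C_def D_def)
        fix x l assume xl: "x \<in> \<T>" "l \<in> letters A" "\<forall>k. \<exists>y. (y, l) \<in> C m \<and> y k = x k"
        then have xE: "(x, l) \<in> E"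
          using E(2) unfolding closedin_edge_top_iff C_def D_def by blast
        \<comment> \<open>For an edge of \<open>E\<close>, membership in \<open>C m\<close> depends
          only on the letter and the coordinates \<open>m\<close> and \<open>n\<close>.\<close>
        obtain y where y: "(y, l) \<in> C m" "y (max m n) = x (max m n)"
          using xl(3) by blast
        then have "y \<in> \<T>"
          using ET[of "(y, l)"] y(1) by (simp add: C_def D_def)
        then have "y m = x m" "y n = x n"
          using thread_eq_below[of y x "max m n"] xl(1) y(2) by auto
        then show "(x, l) \<in> C m"
          using y(1) xE xl(2) by (simp add: C_def D_def tgt_cayley)
      qed
      moreover have "decseq C"
        using D_mono by (auto simp: decseq_def C_def)
      ultimately have "(\<Inter>m. C m) \<noteq> {}"
        using compact_space_imp_nest[OF compact_space_edge_top] ne by metis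
      then obtain e where "e \<in> (\<Inter>m. C m)" by blast
      then have e: "e \<in> C m" for m by blast
      \<comment> \<open>No level separates the start of \<open>e\<close> from \<open>u\<close>, so
        \<open>e\<close> survives in \<open>E'\<close> and its image is supplied after all.\<close>
      then have "e \<in> E'"
        using E_sub[of "fst e" "snd e"] by (auto simp: C_def D_def E'_def V'_def)
      then show False
        using e[of n] adjI by (auto simp: C_def)
    qed
    then obtain m where m: "C m = {}" by blast
    \<comment> \<open>High enough for \<open>C k\<close> to be empty and for paths at level
      \<open>k\<close> to project to level \<open>n\<close>.\<close>
    define k where "k = max m n"
    have "C k = {}"
      using m D_mono[of m k] by (auto simp: C_def k_def)
    then have "adj n (D k) \<subseteq> adj n E'"
      by (auto simp: adj_def C_def)
    moreover have "(u k, z) \<in> (adj k (D k))\<^sup>*" if "(u k, z) \<in> (adj k E)\<^sup>*" for z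
      using that
    proof (induction rule: rtrancl_induct)
      case (step y z)
      then obtain e where e: "e \<in> E" "y = fst e k" "z = tgt \<Gamma> e k"
        by (auto simp: adj_def)
      then have "e \<in> D k"
        using step.hyps by (simp add: D_def)
      then show ?case
        using step.IH e adjI[of e "D k" k] by (auto intro: rtrancl.rtrancl_into_rtrancl)
    qed simp
    then have "(u k, x k) \<in> (adj k (D k))\<^sup>*"
      using x by (simp add: V'_def)
    then have "(u n, x n) \<in> (adj n (D k))\<^sup>*"
      using x V u E(1) by (intro adj_below[of _ _ _ k n]) (auto simp: D_def V'_def k_def)
    ultimately show ?thesis
      using rtrancl_mono by blast
  qed
  have "connected_profinite (restrict_graph \<Gamma> V' E')"
  proof (rule connected_profinite_restrictI[OF sub'])
    fix n x y assume "x \<in> V'" "y \<in> V'"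
    then have "(x n, u n) \<in> (adj n E')\<^sup>*" "(u n, y n) \<in> (adj n E')\<^sup>*"
      using from_u sym_rtrancl[OF adj_sym[OF sub']] by (auto dest: symD)
    then show "(x n, y n) \<in> (adj n E')\<^sup>*"
      by (rule rtrancl_trans)
  qed
  moreover have "u \<in> V'" "v \<in> V'"
    using uv conn by (auto simp: V'_def)
  ultimately show ?thesis
    using sub' by (intro exI[of _ V'] exI[of _ E']) (auto simp: V'_def E'_def connected_subgraphs_def)
qed

text \<open>The letters of the edges spell the word. An edge crossed backwards is named by its
  positive inverse, which belongs to \<open>E\<close> as well.\<close>

lemma path_imp_word:
  assumes sub: "closed_subgraph \<Gamma> V E" and u: "u \<in> \<T>" and "(u m, z) \<in> (adj m E)\<^sup>*"
  shows "\<exists>w. set w \<subseteq> letters A \<and> z = u m \<otimes>\<^bsub>fst (M m)\<^esub> word_val (M m) w \<and>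
    (\<forall>(h, c)\<in>path_edges (M m) w. \<exists>x. (x, (c, True)) \<in> E \<and> x m = u m \<otimes>\<^bsub>fst (M m)\<^esub> h)"
  using assms(3)
proof (induction rule: rtrancl_induct)
  case base
  then show ?case
    using u thread_in by (intro exI[of _ "[]"]) auto
next
  case (step y z)
  then obtain w where w: "set w \<subseteq> letters A" "y = u m \<otimes>\<^bsub>fst (M m)\<^esub> word_val (M m) w"
    "\<forall>(h, c)\<in>path_edges (M m) w. \<exists>x. (x, (c, True)) \<in> E \<and> x m = u m \<otimes>\<^bsub>fst (M m)\<^esub> h"
    by blast
  obtain x c s where e: "(x, (c, s)) \<in> E" "y = x m" "z = tgt \<Gamma> (x, (c, s)) m"
    using step.hyps(2) by (auto simp: adj_def)
  have l: "(c, s) \<in> letters A" "c \<in> A" "x \<in> \<T>" "(tgt \<Gamma> (x, (c, s)), linv (c, s)) \<in> E"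
    using e(1) sub by (auto simp: closed_subgraph_iff letters_def)
  have c: "snd (M m) c \<in> carrier (fst (M m))"
    using l level.marking_in by auto
  have um: "u m \<in> carrier (fst (M m))" and wm: "word_val (M m) w \<in> carrier (fst (M m))"
    using u thread_in level.word_val_in w by auto
  have z: "z = u m \<otimes>\<^bsub>fst (M m)\<^esub> word_val (M m) (w @ [(c, s)])"
  proof -
    have "z = u m \<otimes>\<^bsub>fst (M m)\<^esub> word_val (M m) w \<otimes>\<^bsub>fst (M m)\<^esub> letter_val (M m) (c, s)"
      using e w(2) l(1) by (simp add: tgt_cayley)
    then show ?thesis
      using w(1) l(1) um wm level.letter_val_in[of "(c, s)" m]
      by (simp add: level.word_val_app level.G.m_assoc)
  qed
  have "\<exists>x. (x, (c, True)) \<in> E \<and> x m = u m \<otimes>\<^bsub>fst (M m)\<^esub> h" if "(h, c) \<in> path_edges (M m) (w @ [(c, s)]) - path_edges (M m) w" for h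
  proof (cases s)
    case True
    then show ?thesis
      using that w e l level.path_edges_snoc(1)[OF w(1) l(2), of m] by auto
  next
    case False
    then have "h = word_val (M m) w \<otimes>\<^bsub>fst (M m)\<^esub> inv\<^bsub>fst (M m)\<^esub> snd (M m) c"
      using that level.path_edges_snoc(2)[OF w(1) l(2), of m] by auto
    then have "tgt \<Gamma> (x, (c, s)) m = u m \<otimes>\<^bsub>fst (M m)\<^esub> h"
      using False l um wm c e(2) w(2) by (simp add: tgt_cayley level.letter_val_neg level.G.m_assoc flip: e(2))
    then show ?thesis
      using l(4) False by (auto simp: linv_def)
  qed
  moreover have "d = c" if "(h, d) \<in> path_edges (M m) (w @ [(c, s)]) - path_edges (M m) w" for h d
    using that level.path_edges_snoc[OF w(1) l(2), of m] by (cases s) auto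
  ultimately have "\<forall>(h, d)\<in>path_edges (M m) (w @ [(c, s)]). \<exists>x. (x, (d, True)) \<in> E \<and> x m = u m \<otimes>\<^bsub>fst (M m)\<^esub> h"
    using w(3) by blast
  moreover have "set (w @ [(c, s)]) \<subseteq> letters A"
    using w l by auto
  ultimately show ?case
    using z by blast
qed

text \<open>Converse of \<open>path_imp_word\<close>; negative letters use the symmetry of
  \<open>adj\<close>.\<close>

lemma word_imp_path:
  assumes sub: "closed_subgraph \<Gamma> V E" and u: "u \<in> \<T>" and "set w \<subseteq> letters A"
    and "\<And>h c. (h, c) \<in> path_edges (M n) w \<Longrightarrow> \<exists>x. (x, (c, True)) \<in> E \<and> x n = u n \<otimes>\<^bsub>fst (M n)\<^esub> h"
  shows "(u n, u n \<otimes>\<^bsub>fst (M n)\<^esub> word_val (M n) w) \<in> (adj n E)\<^sup>*"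
  using assms(3,4)
proof (induction w rule: rev_induct)
  case Nil
  then show ?case
    using u thread_in by simp
next
  case (snoc l w)
  obtain c s where l: "l = (c, s)" by (cases l)
  have w: "set w \<subseteq> letters A" and lA: "(c, s) \<in> letters A" "c \<in> A"
    using snoc.prems l by (auto simp: letters_def)
  have c: "snd (M n) c \<in> carrier (fst (M n))"
    using lA level.marking_in by auto
  have un: "u n \<in> carrier (fst (M n))" and wn: "word_val (M n) w \<in> carrier (fst (M n))"
    using u thread_in level.word_val_in w by auto
  have IH: "(u n, u n \<otimes>\<^bsub>fst (M n)\<^esub> word_val (M n) w) \<in> (adj n E)\<^sup>*"
  proof (rule snoc.IH[OF w])
    fix h c assume "(h, c) \<in> path_edges (M n) w"
    then have "(h, c) \<in> path_edges (M n) (w @ [l])"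
      using level.path_edges_app[of w "[l]" n] snoc.prems by auto
    then show "\<exists>x. (x, (c, True)) \<in> E \<and> x n = u n \<otimes>\<^bsub>fst (M n)\<^esub> h"
      by (rule snoc.prems(2))
  qed
  have val: "word_val (M n) (w @ [l]) = word_val (M n) w \<otimes>\<^bsub>fst (M n)\<^esub> letter_val (M n) (c, s)"
    using w lA l c by (simp add: level.word_val_app level.letter_val_in)
  have "(u n \<otimes>\<^bsub>fst (M n)\<^esub> word_val (M n) w, u n \<otimes>\<^bsub>fst (M n)\<^esub> word_val (M n) (w @ [l])) \<in> adj n E"
  proof (cases s)
    case True
    then obtain x where x: "(x, (c, True)) \<in> E" "x n = u n \<otimes>\<^bsub>fst (M n)\<^esub> word_val (M n) w"
      using snoc.prems(2)[of "word_val (M n) w" c] level.path_edges_snoc(1)[OF w lA(2), of n] l by auto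
    then show ?thesis
      using adjI[OF x(1), of n] True lA un wn val c
      by (simp add: tgt_cayley level.letter_val_pos level.G.m_assoc)
  next
    case False
    let ?h = "word_val (M n) w \<otimes>\<^bsub>fst (M n)\<^esub> inv\<^bsub>fst (M n)\<^esub> snd (M n) c"
    obtain x where x: "(x, (c, True)) \<in> E" "x n = u n \<otimes>\<^bsub>fst (M n)\<^esub> ?h"
      using snoc.prems(2)[of ?h c] level.path_edges_snoc(2)[OF w lA(2), of n] l False by auto
    have cT: "(c, True) \<in> letters A"
      using lA by (simp add: letters_def)
    have "(x n, tgt \<Gamma> (x, (c, True)) n) \<in> adj n E"
      using adjI[OF x(1), of n] by simp
    moreover have "tgt \<Gamma> (x, (c, True)) n = u n \<otimes>\<^bsub>fst (M n)\<^esub> word_val (M n) w"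
      using x(2) cT un wn c by (simp add: tgt_cayley level.letter_val_pos level.G.m_assoc)
    ultimately show ?thesis
      using symD[OF adj_sym[OF sub]] x(2) val False c by (simp add: level.letter_val_neg)
  qed
  then show ?case
    using IH by (rule rtrancl.rtrancl_into_rtrancl[rotated])
qed

lemma connected_profinite_cayley: "connected_profinite \<Gamma>"
proof -
  have "connected_profinite (restrict_graph \<Gamma> \<T> (\<T> \<times> letters A))"
  proof (rule connected_profinite_restrictI[OF closed_subgraph_self])
    fix n u v assume uv: "u \<in> \<T>" "v \<in> \<T>"
    obtain w where w: "set w \<subseteq> letters A" "word_val (M n) w = inv\<^bsub>fst (M n)\<^esub> u n \<otimes>\<^bsub>fst (M n)\<^esub> v n"
      using level.word_val_onto[of "inv\<^bsub>fst (M n)\<^esub> u n \<otimes>\<^bsub>fst (M n)\<^esub> v n" n] uv thread_in by auto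
    have "(u n, u n \<otimes>\<^bsub>fst (M n)\<^esub> word_val (M n) w) \<in> (adj n (\<T> \<times> letters A))\<^sup>*"
    proof (rule word_imp_path[OF closed_subgraph_self uv(1) w(1)])
      fix h c assume "(h, c) \<in> path_edges (M n) w"
      then have "h \<in> carrier (fst (M n))" "c \<in> A"
        using level.path_edges_carrier[OF w(1)] by auto
      then obtain x where "x \<in> \<T>" "x n = u n \<otimes>\<^bsub>fst (M n)\<^esub> h"
        using thread_onto[of "u n \<otimes>\<^bsub>fst (M n)\<^esub> h" n] thread_in[OF uv(1)] by auto
      then show "\<exists>x. (x, (c, True)) \<in> \<T> \<times> letters A \<and> x n = u n \<otimes>\<^bsub>fst (M n)\<^esub> h"
        using \<open>c \<in> A\<close> by (auto simp: letters_def)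
    qed
    then show "(u n, v n) \<in> (adj n (\<T> \<times> letters A))\<^sup>*"
      using w uv thread_in by (simp add: level.G.m_assoc[symmetric])
  qed
  then show ?thesis
    by (simp only: restrict_cayley_self)
qed

text \<open>With \<open>hull_edges\<close> this forms the intersection in \<open>tree_like\<close>,
  called \<open>T\<close> at the outset.\<close>

definition hull_verts where "hull_verts u v = (\<Inter>(V, E) \<in> connected_subgraphs \<Gamma> {u, v}. V)"
definition hull_edges where "hull_edges u v = (\<Inter>(V, E) \<in> connected_subgraphs \<Gamma> {u, v}. E)"

lemma closed_subgraph_hull:
  assumes "u \<in> \<T>" "v \<in> \<T>"
  shows "closed_subgraph \<Gamma> (hull_verts u v) (hull_edges u v)"
proof -
  let ?C = "connected_subgraphs \<Gamma> {u, v}"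
  \<comment> \<open>The whole graph is a member, so the intersections run over a nonempty
    family.\<close>
  have top: "(\<T>, \<T> \<times> letters A) \<in> ?C"
    using assms closed_subgraph_self connected_profinite_cayley
    by (simp add: connected_subgraphs_def restrict_cayley_self)
  have sub: "closed_subgraph \<Gamma> V E" if "(V, E) \<in> ?C" for V E
    using that by (simp add: connected_subgraphs_def)
  have "closedin limit_top (hull_verts u v)"
    unfolding hull_verts_def using top sub by (intro closedin_INT) (auto simp: closed_subgraph_iff)
  moreover have "closedin edge_top (hull_edges u v)"
    unfolding hull_edges_def using top sub by (intro closedin_INT) (auto simp: closed_subgraph_iff)
  moreover have "hull_verts u v \<subseteq> \<T>" "hull_edges u v \<subseteq> \<T> \<times> letters A"
    using top by (auto simp: hull_verts_def hull_edges_def)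
  moreover have "x \<in> hull_verts u v \<and> tgt \<Gamma> (x, l) \<in> hull_verts u v \<and> (tgt \<Gamma> (x, l), linv l) \<in> hull_edges u v"
    if "(x, l) \<in> hull_edges u v" for x l
  proof -
    have "x \<in> V \<and> tgt \<Gamma> (x, l) \<in> V \<and> (tgt \<Gamma> (x, l), linv l) \<in> E" if "(V, E) \<in> ?C" for V E
      using sub[OF that] that \<open>(x, l) \<in> hull_edges u v\<close> by (auto simp: hull_edges_def closed_subgraph_iff)
    then show ?thesis
      by (auto simp: hull_verts_def hull_edges_def)
  qed
  ultimately show ?thesis
    unfolding closed_subgraph_iff by blast
qed

text \<open>A connected closed subgraph inside the hull that contains \<open>u\<close> and
  \<open>v\<close> is a member of the intersected family. It therefore includes the hull and equals
  it.\<close>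

lemma tree_likeI:
  assumes "\<And>u v n. u \<in> \<T> \<Longrightarrow> v \<in> \<T> \<Longrightarrow> (u n, v n) \<in> (adj n (hull_edges u v))\<^sup>*"
  shows "tree_like \<Gamma>"
proof -
  have "connected_profinite (restrict_graph \<Gamma> (hull_verts u v) (hull_edges u v))"
    if uv: "u \<in> \<T>" "v \<in> \<T>" for u v
  proof -
    have "u \<in> hull_verts u v" "v \<in> hull_verts u v"
      by (auto simp: hull_verts_def connected_subgraphs_def)
    then obtain V E where VE: "V \<subseteq> hull_verts u v" "E \<subseteq> hull_edges u v" "(V, E) \<in> connected_subgraphs \<Gamma> {u, v}"
      using ex_connected_subgraph[OF closed_subgraph_hull[OF uv] _ _ assms[OF uv]] by blast
    then have "hull_verts u v = V" "hull_edges u v = E"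
      by (auto simp: hull_verts_def hull_edges_def)
    then show ?thesis
      using VE(3) by (simp add: connected_subgraphs_def)
  qed
  then show ?thesis
    unfolding tree_like_def hull_verts_def hull_edges_def
    using profinite_graph_cayley connected_profinite_cayley by simp
qed

end


section \<open>From forced edges at the levels to edges of every connecting subgraph\<close>

section \<open>Forced edges in the limit\<close>

context marked_tower
begin

lemma morphism_below: "k \<le> m \<Longrightarrow> marked_morphism A (M m) (M k)"
proof (intro marked_morphism.intro marked_morphism_axioms.intro level.marked_group_axioms)
  fix w assume "k \<le> m" "set w \<subseteq> letters A" "word_val (M m) w = \<one>\<^bsub>fst (M m)\<^esub>"
  then show "word_val (M k) w = \<one>\<^bsub>fst (M k)\<^esub>"
    using word_val_eq_below[of w "[]" m k] by simp
qed

lemma canonical_morphism_thread: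
  assumes "k \<le> m" "x \<in> \<T>"
  shows "canonical_morphism A (M m) (M k) (x m) = x k"
proof -
  interpret mk: marked_morphism A "M m" "M k"
    by (rule morphism_below[OF assms(1)])
  obtain w where w: "set w \<subseteq> letters A" "word_val (M m) w = x m"
    using thread_word[OF assms(2)] .
  then have "word_val (M k) w = x k"
    using thread_eq_below[OF word_thread[OF w(1)] assms(2), of m k] assms(1) by simp
  then show ?thesis
    using mk.morphism_word_val[OF w(1)] w(2) by simp
qed

lemma path_edges_below_iff:
  assumes "k \<le> m" "set w \<subseteq> letters A"
  shows "(h, a) \<in> path_edges (M k) w \<longleftrightarrow> (\<exists>x\<in>\<T>. (x m, a) \<in> path_edges (M m) w \<and> x k = h)"
proof -
  interpret mk: marked_morphism A "M m" "M k"
    by (rule morphism_below[OF assms(1)])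
  have "(\<exists>x\<in>\<T>. (x m, a) \<in> path_edges (M m) w \<and> x k = h) \<longleftrightarrow>
    (\<exists>h'. (h', a) \<in> path_edges (M m) w \<and> canonical_morphism A (M m) (M k) h' = h)"
  proof
    assume "\<exists>h'. (h', a) \<in> path_edges (M m) w \<and> canonical_morphism A (M m) (M k) h' = h"
    then obtain h' where h': "(h', a) \<in> path_edges (M m) w" "canonical_morphism A (M m) (M k) h' = h"
      by blast
    then obtain x where "x \<in> \<T>" "x m = h'"
      using level.path_edges_carrier[OF assms(2)] thread_onto by blast
    then show "\<exists>x\<in>\<T>. (x m, a) \<in> path_edges (M m) w \<and> x k = h"
      using h' canonical_morphism_thread[OF assms(1)] by auto
  qed (use canonical_morphism_thread[OF assms(1)] in auto)
  then show ?thesis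
    unfolding mk.path_edges_morphism[OF assms(2)] by force
qed

definition forced_at :: "(nat \<Rightarrow> 'g) \<Rightarrow> nat \<Rightarrow> nat \<Rightarrow> ('g \<times> 'a) set" where
  "forced_at g m n = {(h, a). h \<in> carrier (fst (M n)) \<and> a \<in> A \<and>
    (\<forall>w. set w \<subseteq> letters A \<longrightarrow> word_val (M m) w = g m \<longrightarrow> (h, a) \<in> path_edges (M n) w)}"

text \<open>Leaving open the level \<open>m\<close> at which an edge becomes forced makes the notion
  stable under projection, as \<open>forced_below\<close> shows.\<close>

definition forced_edges :: "(nat \<Rightarrow> 'g) \<Rightarrow> nat \<Rightarrow> ('g \<times> 'a) set" where
  "forced_edges g n = (\<Union>m\<in>{n..}. forced_at g m n)"

lemma forced_at_mono:
  assumes "g \<in> \<T>" "m \<le> m'"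
  shows "forced_at g m n \<subseteq> forced_at g m' n"
proof -
  have "word_val (M m) w = g m" if "set w \<subseteq> letters A" "word_val (M m') w = g m'" for w
    using thread_eq_below[OF word_thread[OF that(1)] assms(1), of m' m] assms(2) that(2) by simp
  then show ?thesis
    by (auto simp: forced_at_def)
qed

lemma forced_below:
  assumes "x \<in> \<T>" "(x m, a) \<in> forced_edges g m" "k \<le> m"
  shows "(x k, a) \<in> forced_edges g k"
proof -
  obtain m' where m': "m \<le> m'" "(x m, a) \<in> forced_at g m' m"
    using assms(2) by (auto simp: forced_edges_def)
  then have "(x k, a) \<in> forced_at g m' k"
    using path_edges_below_iff[OF assms(3)] assms(1) thread_in by (auto simp: forced_at_def)
  then show ?thesis
    using m' assms(3) by (auto simp: forced_edges_def intro!: bexI[of _ m'])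
qed

text \<open>A connected closed subgraph with \<open>u\<close> and \<open>v\<close> has, at each
  level, a path from \<open>u\<close> to \<open>v\<close>. Its label has the value of
  \<open>?g\<close>, so up to translation by \<open>u\<close> it passes all forced edges. The
  subgraph thus has edges that agree with the given one at every level, and it is closed.\<close>

lemma forced_edge_in_hull:
  assumes u: "u \<in> \<T>" and v: "v \<in> \<T>" and y: "y \<in> \<T>" and a: "a \<in> A"
    and forced: "\<And>k. k \<ge> n \<Longrightarrow> (y k, a) \<in> forced_edges (\<lambda>k. inv\<^bsub>fst (M k)\<^esub> u k \<otimes>\<^bsub>fst (M k)\<^esub> v k) k"
  shows "((\<lambda>k. u k \<otimes>\<^bsub>fst (M k)\<^esub> y k), (a, True)) \<in> hull_edges u v"
  unfolding hull_edges_def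
proof (clarify)
  fix V E assume VE: "(V, E) \<in> connected_subgraphs \<Gamma> {u, v}"
  let ?x = "\<lambda>k. u k \<otimes>\<^bsub>fst (M k)\<^esub> y k" and ?g = "\<lambda>k. inv\<^bsub>fst (M k)\<^esub> u k \<otimes>\<^bsub>fst (M k)\<^esub> v k"
  have sub: "closed_subgraph \<Gamma> V E" and conn: "connected_profinite (restrict_graph \<Gamma> V E)"
    and uv: "u \<in> V" "v \<in> V"
    using VE by (auto simp: connected_subgraphs_def)
  have x: "?x \<in> \<T>"
    by (rule thread_mult[OF u y])
  have near: "\<exists>z. (z, (a, True)) \<in> E \<and> z k = ?x k" if k: "k \<ge> n" for k
  proof -
    obtain m where m: "k \<le> m" "(y k, a) \<in> forced_at ?g m k"
      using forced[OF k] by (auto simp: forced_edges_def)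
    obtain w where w: "set w \<subseteq> letters A" "v m = u m \<otimes>\<^bsub>fst (M m)\<^esub> word_val (M m) w"
      "\<forall>(h, c)\<in>path_edges (M m) w. \<exists>x. (x, (c, True)) \<in> E \<and> x m = u m \<otimes>\<^bsub>fst (M m)\<^esub> h"
      using path_imp_word[OF sub u connected_profinite_restrictD[OF sub conn uv, of m]] by blast
    have "word_val (M m) w = ?g m"
      using w u thread_in level.word_val_in by (simp add: level.G.m_assoc[symmetric])
    then have "(y k, a) \<in> path_edges (M k) w"
      using m w(1) by (auto simp: forced_at_def)
    then obtain t where t: "t \<in> \<T>" "(t m, a) \<in> path_edges (M m) w" "t k = y k"
      using path_edges_below_iff[OF m(1) w(1)] by blast
    then obtain z where z: "(z, (a, True)) \<in> E" "z m = u m \<otimes>\<^bsub>fst (M m)\<^esub> t m"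
      using w(3) by blast
    have "z \<in> \<T>"
      using z(1) sub by (auto simp: closed_subgraph_iff)
    then have "z k = u k \<otimes>\<^bsub>fst (M k)\<^esub> t k"
      using thread_eq_below[OF _ thread_mult[OF u t(1)], of z m k] z(2) m(1) by simp
    then show ?thesis
      using z t by auto
  qed
  \<comment> \<open>Levels below \<open>n\<close> are reached by projection.\<close>
  have "\<exists>z. (z, (a, True)) \<in> E \<and> z k = ?x k" for k
  proof -
    obtain z where z: "(z, (a, True)) \<in> E" "z (max k n) = ?x (max k n)"
      using near[of "max k n"] by auto
    moreover have "z \<in> \<T>"
      using z(1) sub by (auto simp: closed_subgraph_iff)
    ultimately show ?thesis
      using thread_eq_below[OF _ x, of z "max k n" k] by auto
  qed
  moreover have "closedin edge_top E"
    using sub by (simp add: closed_subgraph_iff)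
  ultimately show "(?x, (a, True)) \<in> E"
    using x a unfolding closedin_edge_top_iff by (auto simp: letters_def)
qed

end

locale expanding_tower = marked_tower A M
  for A :: "'a set" and M :: "nat \<Rightarrow> ('a, 'g) marked" +
  fixes p :: "nat \<Rightarrow> int"
  assumes card_letters: "card A \<ge> 2"
    and expansion: "\<And>n. expansion_step A (M (Suc n)) (M n) (p n)"
begin

text \<open>If \<open>a\<close> were trivial at the next level, its one-edge path would have
  constant flow modulo \<open>p n\<close>; but this flow is 1 at the identity and 0 at
  \<open>x\<close>.\<close>

lemma marking_nontrivial:
  assumes "x \<in> carrier (fst (M n))" "x \<noteq> \<one>\<^bsub>fst (M n)\<^esub>" "a \<in> A"
  shows "snd (M (Suc n)) a \<noteq> \<one>\<^bsub>fst (M (Suc n))\<^esub>"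
proof
  interpret E: expansion_step A "M (Suc n)" "M n" "p n"
    by (rule expansion)
  assume "snd (M (Suc n)) a = \<one>\<^bsub>fst (M (Suc n))\<^esub>"
  then have "p n dvd flow (M n) [(a, True)] \<one>\<^bsub>fst (M n)\<^esub> a - flow (M n) [(a, True)] x a"
    using assms by (intro E.steady) (auto simp: letters_def level.letter_val_pos)
  then show False
    using E.p_gt_1 assms by simp
qed

text \<open>This is \<open>forced_edges_connect\<close> for the levels \<open>m\<close>,
  \<open>m + 1\<close> and \<open>m + 2\<close>. The nontrivial generators that it demands come from
  \<open>g\<close> being nontrivial at level \<open>m - 1\<close>, whence the strict
  inequality.\<close>

lemma forced_connects:
  assumes g: "g \<in> \<T>" "g n \<noteq> \<one>\<^bsub>fst (M n)\<^esub>" and m: "n < m"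
  shows "\<exists>w. set w \<subseteq> letters A \<and> word_val (M m) w = g m \<and> path_edges (M m) w \<subseteq> forced_edges g m"
proof -
  obtain k where k: "m = Suc k" "n \<le> k"
    using m by (cases m) auto
  obtain a b where ab: "a \<in> A" "b \<in> A" "a \<noteq> b"
    using card_letters by (metis card_2_iff' card_le_Suc0_iff_eq finite_letters not_less_eq_eq numeral_2_eq_2)
  have "g k \<noteq> \<one>\<^bsub>fst (M k)\<^esub>"
    using thread_eq_below[OF g(1) word_thread[of "[]"], of k n] k(2) g(2) by auto
  then have nt: "snd (M m) c \<noteq> \<one>\<^bsub>fst (M m)\<^esub>" if "c \<in> A" for c
    using marking_nontrivial[OF thread_in[OF g(1)] _ that] k by simp
  interpret S: two_steps A "M (Suc (Suc m))" "M (Suc m)" "M m" "p m" "p (Suc m)"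
    by (intro two_steps.intro expansion)
  obtain w\<^sub>0 where w\<^sub>0: "set w\<^sub>0 \<subseteq> letters A" "word_val (M (Suc (Suc m))) w\<^sub>0 = g (Suc (Suc m))"
    using thread_word[OF g(1)] .
  obtain w where w: "set w \<subseteq> letters A" "word_val (M m) w = word_val (M m) w\<^sub>0"
    "path_edges (M m) w \<subseteq> S.forced w\<^sub>0"
    using S.forced_edges_connect[OF finite_letters finite_level finite_level ab nt[OF ab(1)] nt[OF ab(2)] w\<^sub>0(1)]
    by blast
  have "word_val (M m) w\<^sub>0 = g m"
    using thread_eq_below[OF word_thread[OF w\<^sub>0(1)] g(1), of "Suc (Suc m)" m] w\<^sub>0(2) by simp
  moreover have "S.forced w\<^sub>0 = forced_at g (Suc (Suc m)) m"
    by (simp add: S.forced_def forced_at_def w\<^sub>0)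
  moreover have "forced_at g (Suc (Suc m)) m \<subseteq> forced_edges g m"
    unfolding forced_edges_def by (intro UN_upper) simp
  ultimately show ?thesis
    using w by (intro exI[of _ w]) auto
qed

text \<open>Compactness: the threads over \<open>h\<close> whose edge is forced at level
  \<open>k + j\<close> form a decreasing sequence of nonempty closed sets, and a common element is
  the desired lift.\<close>

lemma forced_edge_lift:
  assumes g: "g \<in> \<T>" "g n \<noteq> \<one>\<^bsub>fst (M n)\<^esub>" and k: "n < k" and h: "(h, a) \<in> forced_edges g k"
  obtains y where "y \<in> \<T>" "y k = h" "\<And>j. j \<ge> k \<Longrightarrow> (y j, a) \<in> forced_edges g j"
proof -
  define L where "L = (\<lambda>j. {y \<in> \<T>. y k = h \<and> (y (k + j), a) \<in> forced_edges g (k + j)})"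
  have "closedin limit_top (L j)" for j
    unfolding closedin_limit_iff
  proof (intro conjI ballI impI)
    show "L j \<subseteq> \<T>" by (auto simp: L_def)
    fix x assume x: "x \<in> \<T>" "\<forall>i. \<exists>y\<in>L j. y i = x i"
    then obtain y where y: "y \<in> L j" "y (k + j) = x (k + j)" by blast
    then have "y k = x k"
      using thread_eq_below[OF _ x(1), of y "k + j" k] by (simp add: L_def)
    then show "x \<in> L j"
      using x(1) y by (simp add: L_def)
  qed
  moreover have "L j \<noteq> {}" for j
  proof -
    obtain m where m: "k \<le> m" "(h, a) \<in> forced_at g m k"
      using h by (auto simp: forced_edges_def)
    \<comment> \<open>At this level a path of forced edges leads to \<open>g\<close>. As
      \<open>h\<close> is forced by then, one edge of the path lies over it, and the projection of
      that edge to level \<open>k + j\<close> is forced.\<close>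
    define m' where "m' = max m (k + j)"
    have m': "(h, a) \<in> forced_at g m' k" "n < m'" "k \<le> m'" "k + j \<le> m'"
      using forced_at_mono[OF g(1), of m m' k] m k by (auto simp: m'_def)
    obtain w where w: "set w \<subseteq> letters A" "word_val (M m') w = g m'" "path_edges (M m') w \<subseteq> forced_edges g m'"
      using forced_connects[OF g m'(2)] by blast
    then have "(h, a) \<in> path_edges (M k) w"
      using m'(1) by (auto simp: forced_at_def)
    then obtain y where y: "y \<in> \<T>" "(y m', a) \<in> path_edges (M m') w" "y k = h"
      using path_edges_below_iff[OF m'(3) w(1)] by blast
    then have "(y (k + j), a) \<in> forced_edges g (k + j)"
      using forced_below[OF y(1) _ m'(4)] w(3) by blast
    then show ?thesis
      using y by (auto simp: L_def)
  qed
  moreover have "decseq L"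
    using forced_below by (auto simp: decseq_def L_def)
  ultimately have "(\<Inter>j. L j) \<noteq> {}"
    by (intro compact_space_imp_nest[OF compact_space_limit])
  then obtain y where "y \<in> (\<Inter>j. L j)" by blast
  then have y: "y \<in> L j" for j by blast
  have "(y j, a) \<in> forced_edges g j" if "j \<ge> k" for j
    using y[of "j - k"] that by (simp add: L_def)
  then show ?thesis
    using that[of y] y[of 0] by (simp add: L_def)
qed

theorem tree_like_cayley_graph: "tree_like \<Gamma>"
proof (rule tree_likeI)
  fix u v n assume u: "u \<in> \<T>" and v: "v \<in> \<T>"
  let ?g = "\<lambda>k. inv\<^bsub>fst (M k)\<^esub> u k \<otimes>\<^bsub>fst (M k)\<^esub> v k"
  have g: "?g \<in> \<T>"
    by (rule thread_mult[OF thread_inv[OF u] v])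
  show "(u n, v n) \<in> (adj n (hull_edges u v))\<^sup>*"
  proof (cases "u = v")
    case False
    then obtain n\<^sub>0 where "u n\<^sub>0 \<noteq> v n\<^sub>0" by (auto simp: fun_eq_iff)
    then have n\<^sub>0: "?g n\<^sub>0 \<noteq> \<one>\<^bsub>fst (M n\<^sub>0)\<^esub>"
      using level.G.inv_mult_eq_one_iff[OF thread_in[OF u] thread_in[OF v], of n\<^sub>0] by simp
    \<comment> \<open>Forced edges connect beyond level \<open>n\<^sub>0\<close>; the path found at
      level \<open>m\<close> is finally projected to level \<open>n\<close>.\<close>
    define m where "m = max n (Suc n\<^sub>0)"
    have m: "n\<^sub>0 < m" "n \<le> m" by (auto simp: m_def)
    obtain w where w: "set w \<subseteq> letters A" "word_val (M m) w = ?g m" "path_edges (M m) w \<subseteq> forced_edges ?g m"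
      using forced_connects[OF g n\<^sub>0 m(1)] by blast
    have "(u m, u m \<otimes>\<^bsub>fst (M m)\<^esub> word_val (M m) w) \<in> (adj m (hull_edges u v))\<^sup>*"
    proof (rule word_imp_path[OF closed_subgraph_hull[OF u v] u w(1)])
      fix h c assume hc: "(h, c) \<in> path_edges (M m) w"
      then have "(h, c) \<in> forced_edges ?g m" "c \<in> A"
        using w level.path_edges_carrier[OF w(1)] by auto
      then obtain y where y: "y \<in> \<T>" "y m = h" "\<And>j. j \<ge> m \<Longrightarrow> (y j, c) \<in> forced_edges ?g j"
        using forced_edge_lift[OF g n\<^sub>0 m(1)] by blast
      show "\<exists>x. (x, (c, True)) \<in> hull_edges u v \<and> x m = u m \<otimes>\<^bsub>fst (M m)\<^esub> h"
        using forced_edge_in_hull[OF u v y(1) \<open>c \<in> A\<close> y(3)] y(2) by blast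
    qed
    moreover have "u m \<otimes>\<^bsub>fst (M m)\<^esub> word_val (M m) w = v m"
      using w(2) thread_in[OF u] thread_in[OF v] by (simp add: level.G.m_assoc[symmetric])
    ultimately have "(u m, v m) \<in> (adj m (hull_edges u v))\<^sup>*"
      by simp
    then show ?thesis
      using closed_subgraph_hull[OF u v] u v m(2) by (intro adj_below[of _ u v m n]) (auto simp: closed_subgraph_iff)
  qed simp
qed

end

lemma tilde_seq_generated_finite:
  assumes "finite A" "generated_group A (G, \<phi>)" "finite (carrier G)"
    and "\<And>n. n \<ge> 1 \<Longrightarrow> prime (p n)"
  shows "generated_group A (tilde_seq A p (G, \<phi>) n) \<and> finite (carrier (fst (tilde_seq A p (G, \<phi>) n)))"
proof (induction n)
  case 0
  interpret marked_group A "(G, \<phi>)"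
    by unfold_locales (rule assms(2))
  show ?case
    using generated_canonical_copy finite_canonical_copy assms(3) by simp
next
  case (Suc n)
  let ?M = "tilde_seq A p (G, \<phi>) n" and ?p = "p (Suc n)"
  interpret M: marked_group A ?M
    using Suc by unfold_locales simp
  interpret T: marked_group A "Zp_tilde_expansion A ?p ?M"
    by unfold_locales (rule M.generated_Zp_tilde_expansion)
  have "?p > 0"
    using assms(4)[of "Suc n"] prime_gt_0_nat by simp
  then have "finite (carrier (fst (Zp_tilde_expansion A ?p ?M)))"
    using M.finite_Zp_tilde_expansion assms(1) Suc by blast
  then show ?case
    using T.generated_canonical_copy T.finite_canonical_copy by simp
qed

theorem theorem5p9:
  fixes A :: "'a set" and G :: "'g monoid" and \<phi> :: "'a \<Rightarrow> 'g" and p :: "nat \<Rightarrow> nat"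
  assumes "finite A" and "card A \<ge> 2"
    and "generated_group A (G, \<phi>)" and "finite (carrier G)"
    and "\<And>n. n \<ge> 1 \<Longrightarrow> prime (p n)"
  shows "tree_like
    (cayley_graph A
      (limit_marked A (tilde_seq A p (G, \<phi>)))
      (limit_topology A (tilde_seq A p (G, \<phi>))))"
proof -
  let ?M = "tilde_seq A p (G, \<phi>)"
  have gen: "generated_group A (?M n)" and fin: "finite (carrier (fst (?M n)))" for n
    using tilde_seq_generated_finite[OF assms(1,3,4,5)] by auto
  have step: "expansion_step A (?M (Suc n)) (?M n) (int (p (Suc n)))" for n
  proof -
    interpret marked_group A "?M n"
      by unfold_locales (rule gen)
    show ?thesis
      using Zp_tilde_expansion_step[OF assms(1) fin assms(2), of "p (Suc n)"] assms(5) by simp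
  qed
  \<comment> \<open>Level \<open>n + 1\<close> expands level \<open>n\<close> by the prime
    \<open>p (Suc n)\<close>, whence the shift of the index.\<close>
  interpret expanding_tower A ?M "\<lambda>n. int (p (Suc n))"
    using assms(1,2) fin step
    by (intro expanding_tower.intro marked_tower.intro expanding_tower_axioms.intro)
      (auto dest: expansion_step.axioms(1))
  show ?thesis
    by (rule tree_like_cayley_graph)
qed

end
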